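(* Let $B$ be a finite soluble skew brace such that every subbrace of $B$ of prime-power order is centrally nilpotent (as a skew brace) and is a left ideal of $B$. Then $B$ has a Carter subbrace.
   Context: A skew (left) brace is a set $B$ with two group operations $(B,+)$ and $(B,\cdot)$ (neither assumed commutative) such that $a(b+c)=ab-a+ac$ for all $a,b,c\in B$; the two groups share the same identity $0$. The lambda map is $\lambda\colon (B,\cdot)\to\mathrm{Aut}(B,+)$, $\lambda_a(b)=-a+ab$. A subbrace of $B$ is a subset that is a subgroup of both $(B,+)$ and $(B,\cdot)$. A left ideal of $B$ is a subbrace $A$ with $\lambda_b(A)\subseteq A$ for all $b\in B$. An ideal of $B$ is a left ideal that is normal in both $(B,+)$ and $(B,\cdot)$; one can form the quotient skew brace by an ideal. $\mathrm{Soc}(B)=\ker\lambda\cap Z(B,+)$ and $Z(B)=\mathrm{Soc}(B)\cap Z(B,\cdot)$ are ideals of $B$. Put $Z_1(B)=Z(B)$ and $Z_{n+1}(B)/Z_n(B)=Z(B/Z_n(B))$. $B$ is centrally nilpotent if $Z_n(B)=B$ for some $n\ge 1$. $B$ is abelian if $(B,+)$ is abelian and the two operations coincide. $B$ is soluble if it admits a series of ideals $0=I_0\subseteq I_1\subseteq\dots\subseteq I_n=B$ of $B$ with each factor $I_{j}/I_{j-1}$ abelian. A subbrace $C$ of $B$ is self-idealising in $B$ if it is not an ideal of any subbrace of $B$ strictly containing $C$. A Carter subbrace of $B$ is a centrally nilpotent, self-idealising subbrace of $B$. *)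

theory Defs
  imports "HOL-Algebra.Algebra"
begin

text \<open>
  A skew brace is carried by the record type of rings: \<open>\<oplus>\<close>, \<open>\<zero>\<close>, \<open>\<ominus>\<close> belong to \<open>(B,+)\<close>, which is
  the group \<open>add_monoid B\<close>, and \<open>\<otimes>\<close>, \<open>\<one>\<close>, \<open>inv\<close> to \<open>(B,\<cdot>)\<close>. Only the record and its
  notation are shared with rings; \<open>\<oplus>\<close> need not be commutative. That \<open>\<zero> = \<one>\<close> follows from the axioms,
  see \<open>zero_eq_one\<close> below.
\<close>

locale skew_brace =
  fixes B (structure)
  assumes add_group: "group (add_monoid B)"
    and mult_group: "group B"
    and brace_distrib: "\<lbrakk>a \<in> carrier B; b \<in> carrier B; c \<in> carrier B\<rbrakk>
      \<Longrightarrow> a \<otimes> (b \<oplus> c) = (a \<otimes> b) \<ominus> a \<oplus> (a \<otimes> c)"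

definition lambda_map :: "('a, 'm) ring_scheme \<Rightarrow> 'a \<Rightarrow> 'a \<Rightarrow> 'a" where
  "lambda_map B a b = \<ominus>\<^bsub>B\<^esub> a \<oplus>\<^bsub>B\<^esub> (a \<otimes>\<^bsub>B\<^esub> b)"

definition subbrace :: "'a set \<Rightarrow> ('a, 'm) ring_scheme \<Rightarrow> bool" where
  "subbrace A B \<longleftrightarrow> subgroup A (add_monoid B) \<and> subgroup A B"

definition left_ideal :: "'a set \<Rightarrow> ('a, 'm) ring_scheme \<Rightarrow> bool" where
  "left_ideal A B \<longleftrightarrow> subbrace A B \<and> (\<forall>b\<in>carrier B. lambda_map B b ` A \<subseteq> A)"

definition brace_ideal :: "'a set \<Rightarrow> ('a, 'm) ring_scheme \<Rightarrow> bool" where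
  "brace_ideal A B \<longleftrightarrow> left_ideal A B \<and> A \<lhd> add_monoid B \<and> A \<lhd> B"

text \<open>
  For an ideal \<open>I\<close> the additive and the multiplicative cosets coincide (\<open>coset_eq\<close> below), so both
  operations on cosets are products of subsets.
\<close>

definition quotient_brace :: "('a, 'm) ring_scheme \<Rightarrow> 'a set \<Rightarrow> 'a set ring" where
  "quotient_brace B I =
    \<lparr>carrier = a_rcosets\<^bsub>B\<^esub> I, monoid.mult = set_mult B, one = I, ring.zero = I, add = set_add B\<rparr>"

definition group_centre :: "('a, 'm) monoid_scheme \<Rightarrow> 'a set" where
  "group_centre G = {a \<in> carrier G. \<forall>b\<in>carrier G. a \<otimes>\<^bsub>G\<^esub> b = b \<otimes>\<^bsub>G\<^esub> a}"

definition lambda_kernel :: "('a, 'm) ring_scheme \<Rightarrow> 'a set" where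
  "lambda_kernel B = {a \<in> carrier B. \<forall>b\<in>carrier B. lambda_map B a b = b}"

definition socle :: "('a, 'm) ring_scheme \<Rightarrow> 'a set" where
  "socle B = lambda_kernel B \<inter> group_centre (add_monoid B)"

definition centre :: "('a, 'm) ring_scheme \<Rightarrow> 'a set" where
  "centre B = socle B \<inter> group_centre B"

text \<open>The upper central series starts at index 1; the value at 0 is only a convention.\<close>

fun central_series :: "('a, 'm) ring_scheme \<Rightarrow> nat \<Rightarrow> 'a set" where
  "central_series B 0 = {\<zero>\<^bsub>B\<^esub>}"
| "central_series B (Suc 0) = centre B"
| "central_series B (Suc (Suc n)) =
    {a \<in> carrier B. central_series B (Suc n) +>\<^bsub>B\<^esub> a
      \<in> centre (quotient_brace B (central_series B (Suc n)))}"

definition centrally_nilpotent :: "('a, 'm) ring_scheme \<Rightarrow> bool" where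
  "centrally_nilpotent B \<longleftrightarrow> (\<exists>n\<ge>1. central_series B n = carrier B)"

definition abelian_brace :: "('a, 'm) ring_scheme \<Rightarrow> bool" where
  "abelian_brace B \<longleftrightarrow> comm_group (add_monoid B) \<and>
    (\<forall>a\<in>carrier B. \<forall>b\<in>carrier B. a \<otimes>\<^bsub>B\<^esub> b = a \<oplus>\<^bsub>B\<^esub> b)"

definition soluble_brace :: "('a, 'm) ring_scheme \<Rightarrow> bool" where
  "soluble_brace B \<longleftrightarrow> (\<exists>(n::nat) I. I 0 = {\<zero>\<^bsub>B\<^esub>} \<and> I n = carrier B \<and>
    (\<forall>j\<le>n. brace_ideal (I j) B) \<and>
    (\<forall>j<n. I j \<subseteq> I (Suc j) \<and>
      abelian_brace (quotient_brace (B\<lparr>carrier := I (Suc j)\<rparr>) (I j))))"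

definition self_idealising :: "'a set \<Rightarrow> ('a, 'm) ring_scheme \<Rightarrow> bool" where
  "self_idealising C B \<longleftrightarrow>
    (\<forall>D. subbrace D B \<and> C \<subset> D \<longrightarrow> \<not> brace_ideal C (B\<lparr>carrier := D\<rparr>))"

definition carter_subbrace :: "'a set \<Rightarrow> ('a, 'm) ring_scheme \<Rightarrow> bool" where
  "carter_subbrace C B \<longleftrightarrow>
    subbrace C B \<and> centrally_nilpotent (B\<lparr>carrier := C\<rparr>) \<and> self_idealising C B"

context skew_brace
begin

interpretation A: group "add_monoid B"
  rewrites "carrier (add_monoid B) = carrier B"
    and "monoid.mult (add_monoid B) = add B"
    and "one (add_monoid B) = ring.zero B"
    and "m_inv (add_monoid B) = a_inv B"
  using add_group by (simp_all add: a_inv_def)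

interpretation M: group B
  by (rule mult_group)

lemma mult_zero:
  assumes a: "a \<in> carrier B" shows "a \<otimes> \<zero> = a"
proof -
  let ?x = "a \<otimes> \<zero>"
  have x: "?x \<in> carrier B" using a by simp
  have "?x \<oplus> (\<ominus> a \<oplus> ?x) = ?x \<oplus> \<zero>"
    using brace_distrib[OF a A.one_closed A.one_closed] a x by (simp add: a_minus_def A.m_assoc)
  then have "\<ominus> a \<oplus> ?x = \<zero>"
    using a x A.l_cancel by (metis A.inv_closed A.m_closed A.one_closed)
  then show ?thesis
    using a x by (metis A.inv_closed A.inv_inv A.inv_equality A.inv_comm)
qed

lemma zero_eq_one: "\<zero> = \<one>"
  using mult_zero[OF M.one_closed] by simp

lemma lambda_closed: "\<lbrakk>a \<in> carrier B; b \<in> carrier B\<rbrakk> \<Longrightarrow> lambda_map B a b \<in> carrier B"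
  by (simp add: lambda_map_def)

lemma mult_eq_add_lambda:
  "\<lbrakk>a \<in> carrier B; b \<in> carrier B\<rbrakk> \<Longrightarrow> a \<otimes> b = a \<oplus> lambda_map B a b"
  by (simp add: lambda_map_def A.m_assoc[symmetric])

lemma lambda_add:
  "\<lbrakk>a \<in> carrier B; b \<in> carrier B; c \<in> carrier B\<rbrakk>
    \<Longrightarrow> lambda_map B a (b \<oplus> c) = lambda_map B a b \<oplus> lambda_map B a c"
  by (simp add: lambda_map_def brace_distrib a_minus_def A.m_assoc)

lemma lambda_mult:
  assumes a: "a \<in> carrier B" and b: "b \<in> carrier B" and c: "c \<in> carrier B"
  shows "lambda_map B (a \<otimes> b) c = lambda_map B a (lambda_map B b c)"
proof -
  let ?l = "lambda_map B"
  have "(a \<otimes> b) \<oplus> ?l (a \<otimes> b) c = a \<otimes> (b \<otimes> c)"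
    using a b c by (simp add: mult_eq_add_lambda[symmetric] M.m_assoc)
  also have "\<dots> = a \<oplus> ?l a (b \<oplus> ?l b c)"
    using a b c by (metis M.m_closed mult_eq_add_lambda)
  also have "\<dots> = (a \<otimes> b) \<oplus> ?l a (?l b c)"
    using a b c by (simp add: lambda_add lambda_closed mult_eq_add_lambda A.m_assoc)
  finally show ?thesis
    using a b c by (simp add: lambda_closed)
qed

lemma lambda_one: "b \<in> carrier B \<Longrightarrow> lambda_map B \<one> b = b"
  by (simp add: lambda_map_def zero_eq_one[symmetric])

lemma left_ideal_coset_eq:
  assumes I: "left_ideal I B" and b: "b \<in> carrier B"
  shows "b <# I = b <+ I"
proof
  have sub: "I \<subseteq> carrier B"
    using I by (auto simp: left_ideal_def subbrace_def dest: subgroup.subset)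
  have cl: "lambda_map B c x \<in> I" if "c \<in> carrier B" "x \<in> I" for c x
    using I that by (auto simp: left_ideal_def)
  show "b <# I \<subseteq> b <+ I"
  proof
    fix y assume "y \<in> b <# I"
    then obtain x where "x \<in> I" "y = b \<otimes> x" by (auto simp: l_coset_def)
    then show "y \<in> b <+ I"
      using mult_eq_add_lambda[OF b, of x] cl[OF b, of x] sub by (auto simp: a_l_coset_def')
  qed
  show "b <+ I \<subseteq> b <# I"
  proof
    fix y assume "y \<in> b <+ I"
    then obtain x where x: "x \<in> I" "y = b \<oplus> x" by (auto simp: a_l_coset_def')
    let ?z = "lambda_map B (inv b) x"
    have z: "?z \<in> I" using cl b x by simp
    have "lambda_map B b ?z = x"
      using lambda_mult[OF b, of "inv b" x] b x sub lambda_one[of x] by auto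
    then have "y = b \<otimes> ?z"
      using mult_eq_add_lambda[OF b, of ?z] z sub x by auto
    then show "y \<in> b <# I" using z by (auto simp: l_coset_def)
  qed
qed

lemma coset_eq:
  assumes I: "brace_ideal I B" and b: "b \<in> carrier B"
  shows "I #> b = I +> b"
proof -
  have "I #> b = b <# I" "I +> b = b <+ I"
    using I b normal.coset_eq[of I B] normal.coset_eq[of I "add_monoid B"]
    by (auto simp: brace_ideal_def a_r_coset_def a_l_coset_def)
  then show ?thesis
    using left_ideal_coset_eq[of I b] I b by (simp add: brace_ideal_def)
qed

lemma skew_brace_quotient:
  assumes I: "brace_ideal I B"
  shows "skew_brace (quotient_brace B I)"
proof -
  let ?Q = "quotient_brace B I"
  interpret NA: normal I "add_monoid B" using I by (simp add: brace_ideal_def)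
  interpret NM: normal I B using I by (simp add: brace_ideal_def)
  have eq: "rcosets I = a_rcosets I"
    using coset_eq[OF I] by (auto simp: RCOSETS_def A_RCOSETS_def')
  have addQ: "add_monoid ?Q = add_monoid B Mod I"
    by (simp add: quotient_brace_def FactGroup_def A_RCOSETS_def set_add_def)
  have gA: "group (add_monoid ?Q)"
    unfolding addQ by (rule NA.factorgroup_is_group)
  have "group (B Mod I)" by (rule NM.factorgroup_is_group)
  then have gM: "group ?Q"
    by (simp add: group_def monoid_def group_axioms_def Units_def quotient_brace_def
        FactGroup_def eq)
  have add: "(I +> a) \<oplus>\<^bsub>?Q\<^esub> (I +> b) = I +> (a \<oplus> b)"
    if "a \<in> carrier B" "b \<in> carrier B" for a b
    using NA.rcos_sum[of a b] that by (simp add: quotient_brace_def set_add_def a_r_coset_def)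
  have mult: "(I +> a) \<otimes>\<^bsub>?Q\<^esub> (I +> b) = I +> (a \<otimes> b)"
    if "a \<in> carrier B" "b \<in> carrier B" for a b
    using NM.rcos_sum[of a b] that by (simp add: quotient_brace_def coset_eq[OF I])
  have car: "\<exists>a\<in>carrier B. U = I +> a" if "U \<in> carrier ?Q" for U
    using that by (auto simp: quotient_brace_def A_RCOSETS_def')
  have car': "I +> a \<in> carrier ?Q" if "a \<in> carrier B" for a
    using that by (auto simp: quotient_brace_def A_RCOSETS_def')
  have neg: "\<ominus>\<^bsub>?Q\<^esub> (I +> a) = I +> (\<ominus> a)" if a: "a \<in> carrier B" for a
  proof -
    have "inv\<^bsub>add_monoid ?Q\<^esub> (I +> a) = I +> (\<ominus> a)"
    proof (rule group.inv_equality[OF gA])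
      have "I +> \<zero> = I"
        using A.coset_mult_one[of I] NA.subset by (simp add: a_r_coset_def)
      then show "(I +> (\<ominus> a)) \<otimes>\<^bsub>add_monoid ?Q\<^esub> (I +> a) = \<one>\<^bsub>add_monoid ?Q\<^esub>"
        using a add[of "\<ominus> a" a] by (simp add: quotient_brace_def)
    qed (use a car' in auto)
    then show ?thesis by (simp add: a_inv_def)
  qed
  show ?thesis
  proof (rule skew_brace.intro)
    fix U V W assume "U \<in> carrier ?Q" "V \<in> carrier ?Q" "W \<in> carrier ?Q"
    then obtain a b c where abc: "a \<in> carrier B" "b \<in> carrier B" "c \<in> carrier B"
      "U = I +> a" "V = I +> b" "W = I +> c"
      using car by metis
    then show "U \<otimes>\<^bsub>?Q\<^esub> (V \<oplus>\<^bsub>?Q\<^esub> W) = (U \<otimes>\<^bsub>?Q\<^esub> V) \<ominus>\<^bsub>?Q\<^esub> U \<oplus>\<^bsub>?Q\<^esub> (U \<otimes>\<^bsub>?Q\<^esub> W)"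
      by (simp add: a_minus_def add mult neg brace_distrib)
  qed (rule gA, rule gM)
qed

end

end

theory Submission
  imports Defs
begin

text \<open>
  A Carter subbrace is built down a soluble series \<open>B = I\<^sub>n \<supseteq> \<dots> \<supseteq> I\<^sub>0 = 0\<close>: for each \<open>j\<close> there is a
  self-idealising subbrace \<open>C \<supseteq> I\<^sub>j\<close> for which \<open>C/I\<^sub>j\<close> is nilpotent, starting from \<open>C = B\<close> at \<open>j = n\<close>.
  The descent takes place inside \<open>B\<close>. Instead of forming the quotient brace, "nilpotent modulo \<open>I\<close>"
  (\<open>nilpotent_over\<close>) asks that for every prime \<open>q\<close> some ideal \<open>R \<supseteq> I\<close> of \<open>C\<close> induces a Sylow
  \<open>q\<close>-subgroup of \<open>C/I\<close>.

  The argument rests on two consequences of finiteness and of the hypothesis. First, every finite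
  skew brace has Sylow subbraces (\<open>exists_sylow_subbrace\<close>). Secondly, these are left ideals here, and
  a left ideal \<open>S\<close> has well-behaved normalisers: its additive normaliser in a subbrace \<open>C\<close> is
  \<open>\<lambda>\<close>-invariant, hence a subbrace, and once \<open>S\<close> is normal in \<open>(C,+)\<close> its multiplicative normaliser
  consists of the elements whose class modulo \<open>S\<close> is fixed by \<open>\<lambda>\<^sub>S\<close>, hence is a subbrace as well.

  For the step from \<open>N = I\<^sub>j\<^sub>+\<^sub>1\<close> to \<open>I = I\<^sub>j\<close>, let \<open>K\<close> be the subbrace found for \<open>N\<close>. A subbrace \<open>C \<supseteq> I\<close>
  that is minimal subject to \<open>N + C = K\<close> is nilpotent modulo \<open>I\<close>: by the Frattini argument both
  normalisers of a Sylow subbrace of \<open>C\<close> still supplement \<open>N\<close> in \<open>K\<close>, so they are all of \<open>C\<close>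
  (\<open>minimal_supplement_nilpotent_over\<close>). Among the supplements that are nilpotent modulo \<open>I\<close>, a
  largest one is self-idealising. Indeed, if \<open>C\<close> is an ideal of \<open>D\<close>, then \<open>N + C = K\<close> is an ideal of
  \<open>N + D\<close>, so \<open>D \<subseteq> K\<close> and \<open>D = (N \<inter> D) + C\<close>; here \<open>N \<inter> D\<close> is abelian modulo \<open>I\<close>, and a sum of two
  ideals that are nilpotent modulo \<open>I\<close> is nilpotent modulo \<open>I\<close>, as in Fitting's theorem
  (\<open>nilpotent_over_sum\<close>). This is \<open>self_idealising_nilpotent_over_step\<close>.

  At \<open>j = 0\<close> all Sylow subbraces of \<open>C\<close> are ideals of \<open>C\<close>, and by hypothesis they are centrally
  nilpotent; then so is \<open>C\<close> (\<open>centrally_nilpotent_if_sylow_ideals\<close>).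
\<close>

section \<open>Finite groups: orders of products and actions of p-groups\<close>

lemma (in group) inv_mult_cancel:
  assumes "a \<in> carrier G" "b \<in> carrier G"
  shows "inv a \<otimes> (a \<otimes> b) = b" and "a \<otimes> (inv a \<otimes> b) = b"
  using assms by (simp_all flip: m_assoc)

lemmas (in group) group_normalise = m_assoc inv_mult_group inv_mult_cancel

lemma set_multI: "\<lbrakk>a \<in> A; b \<in> B\<rbrakk> \<Longrightarrow> a \<otimes>\<^bsub>G\<^esub> b \<in> A <#>\<^bsub>G\<^esub> B"
  unfolding set_mult_def by blast

lemma set_multE:
  assumes "x \<in> A <#>\<^bsub>G\<^esub> B"
  obtains a b where "a \<in> A" "b \<in> B" "x = a \<otimes>\<^bsub>G\<^esub> b"
  using assms unfolding set_mult_def by blast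

lemma (in group) finite_subgroupI:
  assumes fin: "finite (carrier G)" and sub: "A \<subseteq> carrier G" and one: "\<one> \<in> A"
    and closed: "\<And>x y. \<lbrakk>x \<in> A; y \<in> A\<rbrakk> \<Longrightarrow> x \<otimes> y \<in> A"
  shows "subgroup A G"
proof (rule subgroupI)
  fix x assume x: "x \<in> A"
  have "inj_on (\<lambda>y. x \<otimes> y) A"
    using sub x by (intro inj_onI) (simp add: subset_iff)
  then have "(\<lambda>y. x \<otimes> y) ` A = A"
    using closed x fin sub by (intro endo_inj_surj) (auto intro: finite_subset)
  then obtain y where y: "y \<in> A" "x \<otimes> y = \<one>" using one by (metis imageE)
  then have "inv x = y" using x sub inv_comm[of x y] by (intro inv_equality) auto
  then show "inv x \<in> A" using y by simp
next
  show "A \<noteq> {}" using one by blast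
qed (fact sub closed)+

lemma (in group) card_set_mult_Int:
  assumes fin: "finite (carrier G)" and A: "subgroup A G" and B: "subgroup B G"
  shows "card (A <#> B) * card (A \<inter> B) = card A * card B"
proof -
  interpret A: subgroup A G by (rule A)
  interpret B: subgroup B G by (rule B)
  have finAB: "finite A" "finite B" by (rule finite_subset[OF A.subset fin] finite_subset[OF B.subset fin])+
  let ?h = "\<lambda>(a, b). a \<otimes> b"
  have img: "?h ` (A \<times> B) = A <#> B" unfolding set_mult_def by force
  have fib: "card {p \<in> A \<times> B. ?h p = y} = card (A \<inter> B)" if "y \<in> A <#> B" for y
  proof -
    obtain a b where ab: "a \<in> A" "b \<in> B" "y = a \<otimes> b" using \<open>y \<in> A <#> B\<close> by (auto simp: set_mult_def)
    \<comment> \<open>The pairs with product \<open>a b\<close> arise by moving a common element across.\<close>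
    have "bij_betw (\<lambda>d. (a \<otimes> d, inv d \<otimes> b)) (A \<inter> B) {p \<in> A \<times> B. ?h p = y}"
    proof (rule bij_betwI[where g = "\<lambda>(a', b'). inv a \<otimes> a'"])
      show "(\<lambda>d. (a \<otimes> d, inv d \<otimes> b)) \<in> A \<inter> B \<rightarrow> {p \<in> A \<times> B. ?h p = y}"
      proof
        fix d assume d: "d \<in> A \<inter> B"
        have "a \<otimes> d \<otimes> (inv d \<otimes> b) = a \<otimes> b"
          using d ab by (simp add: group_normalise)
        then show "(a \<otimes> d, inv d \<otimes> b) \<in> {p \<in> A \<times> B. ?h p = y}" using d ab by auto
      qed
      show "(\<lambda>(a', b'). inv a \<otimes> a') \<in> {p \<in> A \<times> B. ?h p = y} \<rightarrow> A \<inter> B"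
      proof
        fix p assume p: "p \<in> {p \<in> A \<times> B. ?h p = y}"
        then obtain a' b' where p': "p = (a', b')" "a' \<in> A" "b' \<in> B" "a' \<otimes> b' = a \<otimes> b"
          using ab by auto
        have "inv a \<otimes> a' = b \<otimes> inv b'"
        proof -
          have c: "a \<in> carrier G" "b \<in> carrier G" "a' \<in> carrier G" "b' \<in> carrier G" using p' ab by auto
          have "inv a \<otimes> a' = inv a \<otimes> (a' \<otimes> b') \<otimes> inv b'" using c by (simp add: group_normalise)
          also have "\<dots> = b \<otimes> inv b'" unfolding p'(4) using c by (simp add: group_normalise)
          finally show ?thesis .
        qed
        then have "inv a \<otimes> a' \<in> B" using p' ab by simp
        then show "(\<lambda>(a', b'). inv a \<otimes> a') p \<in> A \<inter> B" using p' ab by simp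
      qed
      show "(case (a \<otimes> d, inv d \<otimes> b) of (a', b') \<Rightarrow> inv a \<otimes> a') = d" if "d \<in> A \<inter> B" for d
        using that ab by (simp add: group_normalise)
      show "(a \<otimes> (case p of (a', b') \<Rightarrow> inv a \<otimes> a'), inv (case p of (a', b') \<Rightarrow> inv a \<otimes> a') \<otimes> b) = p"
        if p: "p \<in> {p \<in> A \<times> B. ?h p = y}" for p
      proof -
        obtain a' b' where p': "p = (a', b')" "a' \<in> A" "b' \<in> B" "a' \<otimes> b' = a \<otimes> b"
          using p ab by auto
        have c: "a \<in> carrier G" "b \<in> carrier G" "a' \<in> carrier G" "b' \<in> carrier G" using p' ab by auto
        have "a \<otimes> (inv a \<otimes> a') = a'" using c by (simp add: group_normalise)
        moreover have "inv (inv a \<otimes> a') \<otimes> b = b'"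
        proof -
          have "inv (inv a \<otimes> a') \<otimes> b = inv a' \<otimes> (a \<otimes> b)" using c by (simp add: group_normalise)
          also have "\<dots> = inv a' \<otimes> (a' \<otimes> b')" using p' by simp
          also have "\<dots> = b'" using c by (simp add: group_normalise)
          finally show ?thesis .
        qed
        ultimately show ?thesis using p' by simp
      qed
    qed
    then show ?thesis by (rule bij_betw_same_card[symmetric])
  qed
  have "card A * card B = (\<Sum>p\<in>A \<times> B. 1)"
    unfolding card_eq_sum[symmetric] card_cartesian_product ..
  also have "\<dots> = (\<Sum>y\<in>A <#> B. \<Sum>p\<in>{p \<in> A \<times> B. ?h p = y}. 1)"
    unfolding img[symmetric] using finAB by (intro sum.image_gen) simp
  also have "\<dots> = (\<Sum>y\<in>A <#> B. card (A \<inter> B))"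
    by (rule sum.cong[OF refl], unfold card_eq_sum[symmetric], rule fib)
  finally show ?thesis by simp
qed

lemma (in group) card_subgroup_dvd:
  assumes "finite (carrier G)" "subgroup A G" "subgroup B G" "A \<subseteq> B"
  shows "card A dvd card B"
proof -
  interpret B: group "G\<lparr>carrier := B\<rparr>" by (rule subgroup_imp_group[OF assms(3)])
  have "subgroup A (G\<lparr>carrier := B\<rparr>)" by (rule subgroup_incl[OF assms(2-4)])
  from B.lagrange[OF this] have "card (rcosets\<^bsub>G\<lparr>carrier := B\<rparr>\<^esub> A) * card A = card B"
    by (simp add: order_def)
  from dvd_triv_right[of "card A" "card (rcosets\<^bsub>G\<lparr>carrier := B\<rparr>\<^esub> A)", unfolded this]
  show ?thesis .
qed

lemma (in group) card_subgroup_pos: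
  "\<lbrakk>finite (carrier G); subgroup A G\<rbrakk> \<Longrightarrow> 0 < card A"
  by (rule subgroup.finite_imp_card_positive)

lemma (in group) set_mult_subgroupI:
  assumes fin: "finite (carrier G)" and S: "subgroup S G" and T: "subgroup T G"
    and nrm: "\<And>s t. \<lbrakk>s \<in> S; t \<in> T\<rbrakk> \<Longrightarrow> t \<otimes> s \<otimes> inv t \<in> S"
  shows "subgroup (S <#> T) G"
proof (rule finite_subgroupI[OF fin])
  interpret S: subgroup S G by (rule S)
  interpret T: subgroup T G by (rule T)
  show "S <#> T \<subseteq> carrier G" by (rule setmult_subset_G[OF S.subset T.subset])
  show "\<one> \<in> S <#> T" using set_multI[OF S.one_closed T.one_closed, where G = G] by simp
  fix x y assume "x \<in> S <#> T" "y \<in> S <#> T"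
  then obtain s t s' t' where st: "s \<in> S" "t \<in> T" "x = s \<otimes> t" "s' \<in> S" "t' \<in> T" "y = s' \<otimes> t'"
    by (elim set_multE)
  have c: "s \<in> carrier G" "t \<in> carrier G" "s' \<in> carrier G" "t' \<in> carrier G" using st by auto
  have "x \<otimes> y = (s \<otimes> (t \<otimes> s' \<otimes> inv t)) \<otimes> (t \<otimes> t')"
    using c st by (simp add: group_normalise)
  then show "x \<otimes> y \<in> S <#> T" using st nrm[of s' t] T.m_closed set_multI[of _ S _ T G] by simp
qed

lemma prime_dvd_if_dvd_prime_power:
  fixes q :: nat
  assumes q: "Factorial_Ring.prime q" and v: "v dvd q ^ k" "v \<noteq> 1"
  shows "q dvd v"
proof -
  obtain i where i: "v = q ^ i" using divides_primepow_nat[OF q] v(1) by blast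
  then have "i \<noteq> 0" using v(2) by (intro notI) simp
  then show ?thesis unfolding i by (intro dvd_power) simp
qed

lemma prime_power_dvd_coprime_eq_1:
  fixes q :: nat
  assumes "Factorial_Ring.prime q" "v dvd q ^ k" "v dvd m" "\<not> q dvd m"
  shows "v = 1"
  using assms prime_dvd_if_dvd_prime_power dvd_trans by blast

text \<open>
  In terms of \<open>U/I\<close>: a normal Sylow \<open>q\<close>-subgroup contains all \<open>q\<close>-subgroups. The index of \<open>S\<close> in
  \<open>S T\<close> divides that of \<open>I\<close> in \<open>T\<close>, a power of \<open>q\<close>, and that of \<open>S\<close> in \<open>U\<close>, which is prime to \<open>q\<close>.
\<close>
lemma (in group) q_subgroup_le_normal_sylow:
  fixes q :: nat
  assumes fin: "finite (carrier G)" and q: "Factorial_Ring.prime q"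
    and sub: "subgroup I G" "subgroup S G" "subgroup T G" "subgroup U G"
    and le: "I \<subseteq> S" "I \<subseteq> T" "S \<subseteq> U" "T \<subseteq> U"
    and nrm: "\<And>s t. \<lbrakk>s \<in> S; t \<in> T\<rbrakk> \<Longrightarrow> t \<otimes> s \<otimes> inv t \<in> S"
    and T: "card T = q ^ j * card I" and U: "card U = m * card S" and m: "\<not> q dvd m"
  shows "T \<subseteq> S"
proof -
  have ST: "subgroup (S <#> T) G" using set_mult_subgroupI[OF fin sub(2,3) nrm] by blast
  have SleST: "S \<subseteq> S <#> T"
  proof
    fix s assume "s \<in> S"
    then show "s \<in> S <#> T"
      using set_multI[of s S \<one> T G] subgroup.one_closed[OF sub(3)] subgroup.mem_carrier[OF sub(2)] by simp
  qed
  have TleST: "T \<subseteq> S <#> T"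
  proof
    fix t assume "t \<in> T"
    then show "t \<in> S <#> T"
      using set_multI[of \<one> S t T G] subgroup.one_closed[OF sub(2)] subgroup.mem_carrier[OF sub(3)] by simp
  qed
  have STX: "S <#> T \<subseteq> U"
  proof
    fix x assume "x \<in> S <#> T"
    then obtain s t where "s \<in> S" "t \<in> T" "x = s \<otimes> t" by (rule set_multE)
    then show "x \<in> U" using le subgroup.m_closed[OF sub(4), of s t] by blast
  qed
  have pos: "0 < card I" "0 < card S" "0 < card T" "0 < card U"
    using sub fin card_subgroup_pos by auto
  obtain v where v: "card (S <#> T) = card S * v" using card_subgroup_dvd[OF fin sub(2) ST SleST] unfolding dvd_def by blast
  obtain y where y: "card (S \<inter> T) = card I * y"
    using card_subgroup_dvd[OF fin sub(1) subgroups_Inter_pair[OF sub(2,3)]] le unfolding dvd_def by blast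
  obtain w where w: "card U = card (S <#> T) * w" using card_subgroup_dvd[OF fin ST sub(4) STX] unfolding dvd_def by blast
  have "v dvd m" using w v U pos by (auto simp: dvd_def)
  moreover have "v dvd q ^ j"
  proof -
    have "v * y * (card S * card I) = q ^ j * (card S * card I)"
      using card_set_mult_Int[OF fin sub(2,3)] v y T by (simp add: mult_ac)
    then have "v * y = q ^ j" using pos by simp
    then show ?thesis by (rule dvdI[OF sym])
  qed
  ultimately have "v = 1" using prime_power_dvd_coprime_eq_1[OF q] m by blast
  then have "card (S <#> T) = card S" using v by simp
  then have "S <#> T = S"
    using card_subset_eq[OF finite_subset[OF subgroup.subset[OF ST] fin] SleST] by simp
  then show ?thesis using TleST by simp
qed

text \<open>
  The points moved by \<open>T\<close> form orbits whose sizes are powers of \<open>q\<close> other than \<open>1\<close>.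
\<close>
lemma (in group) p_action_card:
  fixes q :: nat and act :: "'a \<Rightarrow> 'x \<Rightarrow> 'x"
  assumes q: "Factorial_Ring.prime q" and T: "subgroup T G" "card T = q ^ k" and U: "finite U"
    and closed: "\<And>g x. \<lbrakk>g \<in> T; x \<in> U\<rbrakk> \<Longrightarrow> act g x \<in> U"
    and one: "\<And>x. x \<in> U \<Longrightarrow> act \<one> x = x"
    and comp: "\<And>g h x. \<lbrakk>g \<in> T; h \<in> T; x \<in> U\<rbrakk> \<Longrightarrow> act (g \<otimes> h) x = act g (act h x)"
  shows "q dvd card (U - {x \<in> U. \<forall>g\<in>T. act g x = x})"
proof -
  let ?T = "G\<lparr>carrier := T\<rparr>" and ?\<phi> = "\<lambda>g. \<lambda>x\<in>U. act g x"
  interpret T: subgroup T G by (rule T)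
  interpret TG: group ?T by (rule subgroup_imp_group[OF T(1)])
  have inverse: "act (inv g) (act g x) = x" "act g (act (inv g) x) = x" if "g \<in> T" "x \<in> U" for g x
    using that comp[of "inv g" g x] comp[of g "inv g" x] one by auto
  have bij: "?\<phi> g \<in> Bij U" if "g \<in> T" for g
    unfolding Bij_def using that closed inverse
    by (auto intro!: bij_betwI[where g = "act (inv g)"])
  have "?\<phi> \<in> hom ?T (BijGroup U)"
    by (auto simp: hom_def BijGroup_def bij compose_def comp closed fun_eq_iff)
  then interpret group_action ?T U ?\<phi>
    by (simp add: group_action_def group_hom_def group_hom_axioms_def group_BijGroup TG.is_group)
  let ?F = "{x \<in> U. \<forall>g\<in>T. act g x = x}" and ?O = "orbit ?T ?\<phi>"
  have O: "?O x = {act g x |g. g \<in> T}" if "x \<in> U" for x using that by (simp add: orbit_def)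
  have OU: "?O x \<subseteq> U - ?F" if x: "x \<in> U - ?F" for x
  proof
    fix y assume "y \<in> ?O x"
    then obtain g where g: "g \<in> T" "y = act g x" using O x by blast
    have xU: "x \<in> U" and xF: "x \<notin> ?F" using x by simp_all
    have "y \<notin> ?F"
    proof
      assume "y \<in> ?F"
      then have "act (inv g) y = y" "act g y = y" using g(1) by simp_all
      then have "x = y" using inverse(1)[OF g(1) xU] g(2) by simp
      then show False using \<open>y \<in> ?F\<close> xF by simp
    qed
    then show "y \<in> U - ?F" using closed[OF g(1) xU] g(2) by blast
  qed
  have "U - ?F = \<Union> (?O ` (U - ?F))"
  proof
    show "U - ?F \<subseteq> \<Union> (?O ` (U - ?F))" using orbit_refl by blast
    show "\<Union> (?O ` (U - ?F)) \<subseteq> U - ?F" using OU by (rule UN_least)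
  qed
  moreover have "q dvd card (\<Union> (?O ` (U - ?F)))"
  proof (rule dvd_partition)
    have "\<Union> (?O ` (U - ?F)) \<subseteq> U" using OU by (intro UN_least) blast
    then show "finite (\<Union> (?O ` (U - ?F)))" using U by (rule finite_subset)
    show "\<forall>c\<in>?O ` (U - ?F). q dvd card c"
    proof
      fix c assume "c \<in> ?O ` (U - ?F)"
      then obtain x where x: "x \<in> U" "x \<notin> ?F" "c = ?O x" by blast
      then obtain g where g: "g \<in> T" "act g x \<noteq> x" by blast
      have mem: "act g x \<in> c" "x \<in> c" using x g(1) O orbit_refl[OF x(1)] by blast+
      have "card c \<noteq> 1"
      proof
        assume "card c = 1"
        then obtain z where "c = {z}" by (rule card_1_singletonE)
        then show False using mem g(2) by simp
      qed
      moreover have "card c dvd q ^ k"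
        using dvdI[OF sym[OF orbit_stabilizer_theorem[OF x(1)]]] x(3) T(2) by (simp add: order_def)
      ultimately show "q dvd card c" using prime_dvd_if_dvd_prime_power[OF q] by blast
    qed
    show "\<forall>c1\<in>?O ` (U - ?F). \<forall>c2\<in>?O ` (U - ?F). c1 \<noteq> c2 \<longrightarrow> c1 \<inter> c2 = {}"
    proof (intro ballI impI)
      fix c d assume cd: "c \<in> ?O ` (U - ?F)" "d \<in> ?O ` (U - ?F)" "c \<noteq> d"
      then have "c \<in> orbits ?T U ?\<phi>" "d \<in> orbits ?T U ?\<phi>" unfolding orbits_def by blast+
      from disjoint_union[OF this] show "c \<inter> d = {}" using cd(3) by blast
    qed
  qed
  ultimately show ?thesis by simp
qed

lemma (in group) p_action_fixed_point:
  fixes q :: nat and act :: "'a \<Rightarrow> 'x \<Rightarrow> 'x"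
  assumes q: "Factorial_Ring.prime q" and T: "subgroup T G" "card T = q ^ k" and U: "finite U"
    and closed: "\<And>g x. \<lbrakk>g \<in> T; x \<in> U\<rbrakk> \<Longrightarrow> act g x \<in> U"
    and one: "\<And>x. x \<in> U \<Longrightarrow> act \<one> x = x"
    and comp: "\<And>g h x. \<lbrakk>g \<in> T; h \<in> T; x \<in> U\<rbrakk> \<Longrightarrow> act (g \<otimes> h) x = act g (act h x)"
    and nd: "\<not> q dvd card U"
  shows "\<exists>x\<in>U. \<forall>g\<in>T. act g x = x"
proof (rule ccontr)
  assume "\<not> ?thesis"
  then have "U - {x \<in> U. \<forall>g\<in>T. act g x = x} = U" by blast
  then show False using p_action_card[where act = act, OF q T U closed one comp] nd by simp
qed

text \<open>
  \<open>T\<close> acts on the left cosets of \<open>S\<close>, whose number is prime to \<open>q\<close>, and a coset \<open>g S\<close> is fixed by \<open>t\<close>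
  exactly if \<open>g\<close> conjugates \<open>t\<close> into \<open>S\<close>.
\<close>
lemma (in group) q_subgroup_conjugate_into_sylow:
  fixes q :: nat
  assumes fin: "finite (carrier G)" and q: "Factorial_Ring.prime q"
    and T: "subgroup T G" "card T = q ^ k"
    and S: "subgroup S G" "order G = w * card S" "\<not> q dvd w"
  shows "\<exists>g\<in>carrier G. \<forall>t\<in>T. inv g \<otimes> t \<otimes> g \<in> S"
proof -
  interpret S: subgroup S G by (rule S)
  interpret T: subgroup T G by (rule T)
  have cS: "card S > 0" using card_subgroup_pos[OF fin S(1)] .
  have "card (lcosets S) * card S = order G" using l_lagrange[OF fin S(1)] by simp
  then have "card (lcosets S) = w" using S(2) cS by simp
  moreover have "finite (lcosets S)"
    using finite_subset[OF lcosets_subset_PowG[OF S(1)]] fin by simp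
  moreover have act: "g <#\<^bsub>G\<^esub> x \<in> lcosets S" "\<one> <#\<^bsub>G\<^esub> x = x"
      "(h \<otimes> g) <#\<^bsub>G\<^esub> x = h <#\<^bsub>G\<^esub> (g <#\<^bsub>G\<^esub> x)"
    if g: "g \<in> T" and h: "h \<in> T" and x: "x \<in> lcosets S" for g h x
  proof -
    obtain a where a: "a \<in> carrier G" "x = a <# S" using x unfolding LCOSETS_def by blast
    have c: "g \<in> carrier G" "h \<in> carrier G" "x \<subseteq> carrier G"
      unfolding a(2) by (rule T.mem_carrier[OF g] T.mem_carrier[OF h] l_coset_subset_G[OF S.subset a(1)])+
    have "g <#\<^bsub>G\<^esub> x = (g \<otimes> a) <# S" unfolding a(2) by (rule lcos_m_assoc[OF S.subset c(1) a(1)])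
    then show "g <#\<^bsub>G\<^esub> x \<in> lcosets S" unfolding LCOSETS_def using c a(1) by blast
    show "\<one> <#\<^bsub>G\<^esub> x = x" by (rule lcos_mult_one[OF c(3)])
    show "(h \<otimes> g) <#\<^bsub>G\<^esub> x = h <#\<^bsub>G\<^esub> (g <#\<^bsub>G\<^esub> x)" by (rule lcos_m_assoc[OF c(3,2,1), symmetric])
  qed
  ultimately have "\<exists>x\<in>lcosets S. \<forall>g\<in>T. g <#\<^bsub>G\<^esub> x = x"
    by (intro p_action_fixed_point[OF q T]) (rule act T.one_closed S(3) | assumption | simp add: S(3))+
  then obtain x where x: "x \<in> lcosets S" "\<forall>g\<in>T. g <#\<^bsub>G\<^esub> x = x" by blast
  then obtain g where g: "g \<in> carrier G" "x = g <# S" by (auto simp: LCOSETS_def)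
  have "inv g \<otimes> t \<otimes> g \<in> S" if t: "t \<in> T" for t
  proof -
    have "g \<in> x" using g lcos_self[OF g(1) S(1)] by simp
    then have "t \<otimes> g \<in> t <#\<^bsub>G\<^esub> x" unfolding l_coset_def by blast
    then have "t \<otimes> g \<in> g <# S" using x t g by simp
    then obtain s where "s \<in> S" "t \<otimes> g = g \<otimes> s" by (auto simp: l_coset_def)
    then have "inv g \<otimes> t \<otimes> g = s"
      using g t S.mem_carrier by (simp add: group_normalise)
    then show ?thesis using \<open>s \<in> S\<close> by simp
  qed
  then show ?thesis using g by blast
qed

lemma (in group) q_subgroup_conjugate_into_sylow_of_subgroup:
  fixes q :: nat
  assumes fin: "finite (carrier G)" and q: "Factorial_Ring.prime q"
    and sub: "subgroup T G" "subgroup S G" "subgroup R G" and le: "T \<subseteq> R" "S \<subseteq> R"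
    and T: "card T = q ^ k" and R: "card R = w * card S" "\<not> q dvd w"
  shows "\<exists>g\<in>R. \<forall>t\<in>T. inv g \<otimes> t \<otimes> g \<in> S"
proof -
  let ?R = "G\<lparr>carrier := R\<rparr>"
  interpret R: group ?R by (rule subgroup_imp_group[OF sub(3)])
  have "finite (carrier ?R)" using finite_subset[OF subgroup.subset[OF sub(3)] fin] by simp
  moreover have "subgroup T ?R" "subgroup S ?R" using subgroup_incl sub le by blast+
  moreover have "order ?R = w * card S" using R by (simp add: order_def)
  ultimately have "\<exists>g\<in>carrier ?R. \<forall>t\<in>T. inv\<^bsub>?R\<^esub> g \<otimes>\<^bsub>?R\<^esub> t \<otimes>\<^bsub>?R\<^esub> g \<in> S"
    by (intro R.q_subgroup_conjugate_into_sylow[OF _ q _ T _ _ R(2)])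
  then obtain g where g: "g \<in> R" "\<forall>t\<in>T. inv\<^bsub>?R\<^esub> g \<otimes> t \<otimes> g \<in> S" by auto
  then show ?thesis using m_inv_consistent[OF sub(3) g(1)] by auto
qed

lemma (in group) subgroup_conjugate:
  assumes fin: "finite (carrier G)" and S: "subgroup S G" and c: "c \<in> carrier G"
  shows "subgroup ((\<lambda>x. c \<otimes> x \<otimes> inv c) ` S) G" and "card ((\<lambda>x. c \<otimes> x \<otimes> inv c) ` S) = card S"
proof -
  interpret S: subgroup S G by (rule S)
  show "subgroup ((\<lambda>x. c \<otimes> x \<otimes> inv c) ` S) G"
  proof (rule finite_subgroupI[OF fin])
    show "(\<lambda>x. c \<otimes> x \<otimes> inv c) ` S \<subseteq> carrier G" using c by auto
    show "\<one> \<in> (\<lambda>x. c \<otimes> x \<otimes> inv c) ` S" using c by (intro image_eqI[of _ _ \<one>]) auto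
    fix u v assume "u \<in> (\<lambda>x. c \<otimes> x \<otimes> inv c) ` S" "v \<in> (\<lambda>x. c \<otimes> x \<otimes> inv c) ` S"
    then obtain x y where xy: "x \<in> S" "y \<in> S" "u = c \<otimes> x \<otimes> inv c" "v = c \<otimes> y \<otimes> inv c" by blast
    then have "u \<otimes> v = c \<otimes> (x \<otimes> y) \<otimes> inv c" using c by (simp add: group_normalise)
    then show "u \<otimes> v \<in> (\<lambda>x. c \<otimes> x \<otimes> inv c) ` S" using xy by (intro image_eqI[of _ _ "x \<otimes> y"]) auto
  qed
  show "card ((\<lambda>x. c \<otimes> x \<otimes> inv c) ` S) = card S"
    using c by (intro card_image inj_onI) simp
qed

text \<open>
  The conjugate of \<open>Q\<close> by \<open>c\<close> is a \<open>q\<close>-subgroup of \<open>R\<close>, so some \<open>r \<in> R\<close> conjugates it back into \<open>Q\<close>.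
\<close>
lemma (in group) frattini_argument:
  fixes q :: nat
  assumes fin: "finite (carrier G)" and q: "Factorial_Ring.prime q"
    and sub: "subgroup Q G" "subgroup R G" and le: "Q \<subseteq> R"
    and Q: "card Q = q ^ k" and R: "card R = w * card Q" "\<not> q dvd w"
    and c: "c \<in> carrier G" and nrm: "\<And>x. x \<in> Q \<Longrightarrow> c \<otimes> x \<otimes> inv c \<in> R"
  shows "\<exists>r\<in>R. \<forall>x\<in>Q. (inv r \<otimes> c) \<otimes> x \<otimes> inv (inv r \<otimes> c) \<in> Q"
proof -
  interpret Q: subgroup Q G by (rule sub(1))
  interpret R: subgroup R G by (rule sub(2))
  let ?T = "(\<lambda>x. c \<otimes> x \<otimes> inv c) ` Q"
  have T: "subgroup ?T G" "card ?T = q ^ k" "?T \<subseteq> R"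
    using subgroup_conjugate[OF fin sub(1) c] Q nrm by auto
  obtain r where r: "r \<in> R" "\<forall>t\<in>?T. inv r \<otimes> t \<otimes> r \<in> Q"
    using q_subgroup_conjugate_into_sylow_of_subgroup[OF fin q T(1) sub T(3) le T(2) R] by blast
  have "(inv r \<otimes> c) \<otimes> x \<otimes> inv (inv r \<otimes> c) \<in> Q" if x: "x \<in> Q" for x
  proof -
    have "(inv r \<otimes> c) \<otimes> x \<otimes> inv (inv r \<otimes> c) = inv r \<otimes> (c \<otimes> x \<otimes> inv c) \<otimes> r"
      using r(1) c x by (simp add: group_normalise)
    then show ?thesis using r(2) x by simp
  qed
  then show ?thesis using r(1) by blast
qed

text \<open>
  A Sylow subgroup \<open>P\<close> acts on the set of all of them by conjugation. A fixed point is
  normalised by \<open>P\<close>, so it contains \<open>P\<close> and equals \<open>P\<close>: there is exactly one fixed point.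
\<close>
lemma (in group) sylow_subgroups_card:
  fixes q :: nat
  assumes fin: "finite (carrier G)" and q: "Factorial_Ring.prime q"
    and ord: "order G = m * q ^ b" "\<not> q dvd m"
  shows "\<not> q dvd card {S. subgroup S G \<and> card S = q ^ b}"
proof
  let ?Y = "{S. subgroup S G \<and> card S = q ^ b}" and ?c = "\<lambda>g S. (\<lambda>x. g \<otimes> x \<otimes> inv g) ` S"
  assume dvd: "q dvd card ?Y"
  have finY: "finite ?Y"
    by (rule finite_subset[of _ "Pow (carrier G)"]) (use fin subgroup.subset in auto)
  obtain P where P: "subgroup P G" "card P = q ^ b"
    using sylow_thm[OF q is_group, of b m] ord fin by (auto simp: mult.commute)
  interpret P: subgroup P G by (rule P(1))
  have fixed: "{S \<in> ?Y. \<forall>g\<in>P. ?c g S = S} = {P}"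
  proof (intro equalityI subsetI)
    fix S assume "S \<in> {S \<in> ?Y. \<forall>g\<in>P. ?c g S = S}"
    then have S: "subgroup S G" "card S = q ^ b" "\<And>g. g \<in> P \<Longrightarrow> ?c g S = S" by auto
    have triv: "subgroup {\<one>} G" by (rule triv_subgroup)
    have "P \<subseteq> S"
      by (rule q_subgroup_le_normal_sylow[OF fin q triv S(1) P(1) subgroup_self, of b m])
        (use S P ord subgroup.subset[OF S(1)] subgroup.one_closed[OF S(1)] in \<open>auto simp: order_def\<close>)
    then show "S \<in> {P}"
      using card_subset_eq[OF finite_subset[OF subgroup.subset[OF S(1)] fin]] S(2) P(2) by auto
  next
    fix S assume "S \<in> {P}"
    have "?c g P = P" if g: "g \<in> P" for g
    proof (rule card_subset_eq[OF finite_subset[OF P.subset fin]])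
      show "?c g P \<subseteq> P" using g by auto
      show "card (?c g P) = card P" using subgroup_conjugate(2)[OF fin P(1)] g by simp
    qed
    then show "S \<in> {S \<in> ?Y. \<forall>g\<in>P. ?c g S = S}" using P \<open>S \<in> {P}\<close> by simp
  qed
  have "q dvd card (?Y - {S \<in> ?Y. \<forall>g\<in>P. ?c g S = S})"
  proof (rule p_action_card[OF q P finY])
    fix g S assume "g \<in> P" "S \<in> ?Y"
    then show "?c g S \<in> ?Y" using subgroup_conjugate[OF fin, of S g] by simp
  next
    fix S assume "S \<in> ?Y"
    then have "S \<subseteq> carrier G" using subgroup.subset by blast
    then show "?c \<one> S = S" by (force simp: subset_iff)
  next
    fix g h S assume gh: "g \<in> P" "h \<in> P" "S \<in> ?Y"
    then have "S \<subseteq> carrier G" using subgroup.subset by blast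
    then show "?c (g \<otimes> h) S = ?c g (?c h S)"
      using gh unfolding image_image by (intro image_cong) (auto simp: group_normalise subset_iff)
  qed
  then have "q dvd card ?Y - 1"
    unfolding fixed using P finY by (simp add: card_Diff_singleton)
  moreover have "card ?Y > 0" using P finY by (auto simp: card_gt_0_iff)
  ultimately have "q dvd 1" using dvd by (metis Suc_pred' dvd_diffD1 One_nat_def Suc_leI)
  then show False using q by simp
qed

text \<open>
  The index of \<open>L\<close> in \<open>R\<close> divides both a power of \<open>q\<close> and a number prime to \<open>q\<close>.
\<close>
lemma (in group) eq_of_coprime_indices:
  fixes q :: nat
  assumes fin: "finite (carrier G)" and q: "Factorial_Ring.prime q"
    and sub: "subgroup M G" "subgroup Q G" "subgroup L G" "subgroup R G"
    and le: "M \<subseteq> L" "Q \<subseteq> L" "L \<subseteq> R"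
    and M: "card R = q ^ k * card M" and Q: "card R = w * card Q" "\<not> q dvd w"
  shows "L = R"
proof -
  have pos: "0 < card L" "0 < card M" "0 < card Q" using sub fin card_subgroup_pos by auto
  obtain u where u: "card R = card L * u"
    using card_subgroup_dvd[OF fin sub(3,4) le(3)] by (rule dvdE)
  obtain v where v: "card L = card M * v"
    using card_subgroup_dvd[OF fin sub(1,3) le(1)] by (rule dvdE)
  obtain y where y: "card L = card Q * y"
    using card_subgroup_dvd[OF fin sub(2,3) le(2)] by (rule dvdE)
  have "card M * (u * v) = card M * q ^ k" using M u v by (simp add: mult_ac)
  then have "q ^ k = u * v" using pos by simp
  moreover have "card Q * (u * y) = card Q * w" using Q u y by (simp add: mult_ac)
  then have "w = u * y" using pos by simp
  ultimately have "u = 1" using prime_power_dvd_coprime_eq_1[OF q _ _ Q(2), of u k] by simp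
  then show ?thesis
    using card_subset_eq[OF finite_subset[OF subgroup.subset[OF sub(4)] fin] le(3)] u by simp
qed

lemma (in group) card_set_mult_commute:
  assumes fin: "finite (carrier G)" and "subgroup A G" "subgroup B G"
  shows "card (A <#> B) = card (B <#> A)"
proof -
  have "card (A <#> B) * card (A \<inter> B) = card (B <#> A) * card (A \<inter> B)"
    using card_set_mult_Int[OF fin assms(2,3)] card_set_mult_Int[OF fin assms(3,2)]
    by (simp add: Int_commute mult.commute)
  moreover have "card (A \<inter> B) > 0"
    using card_subgroup_pos[OF fin subgroups_Inter_pair[OF assms(2,3)]] .
  ultimately show ?thesis by simp
qed

text \<open>
  \<open>|B : A| = |B N : A N| \<sqdot> |B \<inter> N : A \<inter> N|\<close>.
\<close>
lemma (in group) index_set_mult_dvd: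
  assumes fin: "finite (carrier G)" and sub: "subgroup A G" "subgroup B G" "subgroup N G"
    and le: "A \<subseteq> B" and m: "card B = m * card A" and u: "card (B <#> N) = u * card (A <#> N)"
  shows "u dvd m"
proof -
  have int: "subgroup (A \<inter> N) G" "subgroup (B \<inter> N) G" using subgroups_Inter_pair sub by blast+
  have "A \<inter> N \<subseteq> B \<inter> N" using le by blast
  from card_subgroup_dvd[OF fin int this] obtain t where t: "card (B \<inter> N) = card (A \<inter> N) * t" by (rule dvdE)
  have pos: "card A > 0" "card N > 0" using card_subgroup_pos[OF fin] sub by blast+
  have "u * t * (card (A <#> N) * card (A \<inter> N)) = card (B <#> N) * card (B \<inter> N)"
    using u t by (simp add: mult_ac)
  also have "\<dots> = card B * card N" by (rule card_set_mult_Int[OF fin sub(2,3)])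
  finally have "u * t * (card A * card N) = m * (card A * card N)"
    using m card_set_mult_Int[OF fin sub(1,3)] by (simp add: mult_ac)
  then have "m = u * t" using pos by simp
  then show ?thesis by simp
qed

section \<open>Subbraces, ideals and congruences\<close>

text \<open>
  Ideals of a subbrace \<open>D\<close> in terms of the operations of \<open>B\<close>. The restricted brace has its own
  inverses and its own \<open>\<lambda>\<close>; they agree with those of \<open>B\<close> on \<open>D\<close>, whence \<open>brace_ideal_restrict\<close>
  below.
\<close>
definition ideal_in :: "('a, 'm) ring_scheme \<Rightarrow> 'a set \<Rightarrow> 'a set \<Rightarrow> bool" where
  "ideal_in B A D \<longleftrightarrow> subbrace A B \<and> A \<subseteq> D \<and>
    (\<forall>d\<in>D. \<forall>a\<in>A. lambda_map B d a \<in> A \<and> d \<oplus>\<^bsub>B\<^esub> a \<oplus>\<^bsub>B\<^esub> (\<ominus>\<^bsub>B\<^esub> d) \<in> A \<and> d \<otimes>\<^bsub>B\<^esub> a \<otimes>\<^bsub>B\<^esub> inv\<^bsub>B\<^esub> d \<in> A)"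

context skew_brace
begin

interpretation A: group "add_monoid B"
  rewrites "carrier (add_monoid B) = carrier B"
    and "monoid.mult (add_monoid B) = add B"
    and "one (add_monoid B) = ring.zero B"
    and "m_inv (add_monoid B) = a_inv B"
    and "set_mult (add_monoid B) = set_add B"
    and "r_coset (add_monoid B) = a_r_coset B"
    and "l_coset (add_monoid B) = a_l_coset B"
  using add_group by (simp_all add: a_inv_def set_add_def a_r_coset_def a_l_coset_def)

interpretation M: group B
  by (rule mult_group)

lemma subbrace_subset: "subbrace A B \<Longrightarrow> A \<subseteq> carrier B"
  unfolding subbrace_def by (blast dest: subgroup.subset)

lemma subbrace_mem: "\<lbrakk>subbrace A B; x \<in> A\<rbrakk> \<Longrightarrow> x \<in> carrier B"
  using subbrace_subset by blast

lemma subbrace_closed: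
  assumes A: "subbrace A B" and xy: "x \<in> A" "y \<in> A"
  shows "x \<oplus> y \<in> A" "x \<otimes> y \<in> A" "\<ominus> x \<in> A" "inv x \<in> A" "\<zero> \<in> A" "\<one> \<in> A" "lambda_map B x y \<in> A"
proof -
  have A': "subgroup A (add_monoid B)" "subgroup A B" using A by (auto simp: subbrace_def)
  show c: "x \<oplus> y \<in> A" "x \<otimes> y \<in> A" "inv x \<in> A" "\<zero> \<in> A" "\<one> \<in> A"
    using subgroup.m_closed[OF A'(1) xy] subgroup.m_closed[OF A'(2) xy] subgroup.m_inv_closed[OF A'(2) xy(1)]
      subgroup.one_closed[OF A'(1)] subgroup.one_closed[OF A'(2)] by simp_all
  show n: "\<ominus> x \<in> A" using subgroup.m_inv_closed[OF A'(1) xy(1)] by (simp add: a_inv_def)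
  show "lambda_map B x y \<in> A"
    unfolding lambda_map_def using subgroup.m_closed[OF A'(1) n c(2)] by simp
qed

lemma subbrace_finiteI:
  assumes "finite (carrier B)" "A \<subseteq> carrier B" "\<zero> \<in> A"
    and "\<And>x y. \<lbrakk>x \<in> A; y \<in> A\<rbrakk> \<Longrightarrow> x \<oplus> y \<in> A"
    and "\<And>x y. \<lbrakk>x \<in> A; y \<in> A\<rbrakk> \<Longrightarrow> x \<otimes> y \<in> A"
  shows "subbrace A B"
  unfolding subbrace_def
  using A.finite_subgroupI[of A] M.finite_subgroupI[of A] assms zero_eq_one by simp

lemma subbrace_Int: "\<lbrakk>subbrace C B; subbrace D B\<rbrakk> \<Longrightarrow> subbrace (C \<inter> D) B"
  unfolding subbrace_def using A.subgroups_Inter_pair[of C D] M.subgroups_Inter_pair[of C D] by blast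

lemma subbrace_carrier: "subbrace (carrier B) B"
  unfolding subbrace_def using A.subgroup_self M.subgroup_self by simp

lemma subbrace_is_skew_brace:
  assumes D: "subbrace D B"
  shows "skew_brace (B\<lparr>carrier := D\<rparr>)"
proof -
  have D': "subgroup D (add_monoid B)" "subgroup D B" using D by (auto simp: subbrace_def)
  have inv: "\<ominus>\<^bsub>B\<lparr>carrier := D\<rparr>\<^esub> x = \<ominus> x" if "x \<in> D" for x
    using A.m_inv_consistent[OF D'(1) that] by (simp add: a_inv_def)
  show ?thesis
  proof (rule skew_brace.intro)
    show "group (add_monoid (B\<lparr>carrier := D\<rparr>))" using A.subgroup_imp_group[OF D'(1)] by simp
    show "group (B\<lparr>carrier := D\<rparr>)" by (rule M.subgroup_imp_group[OF D'(2)])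
    fix a b c
    assume "a \<in> carrier (B\<lparr>carrier := D\<rparr>)" "b \<in> carrier (B\<lparr>carrier := D\<rparr>)" "c \<in> carrier (B\<lparr>carrier := D\<rparr>)"
    then have *: "a \<in> D" "b \<in> D" "c \<in> D" by simp_all
    then have "a \<otimes> (b \<oplus> c) = (a \<otimes> b) \<oplus> \<ominus> a \<oplus> (a \<otimes> c)"
      using brace_distrib[of a b c] subbrace_mem[OF D] by (simp add: a_minus_def)
    then show "a \<otimes>\<^bsub>B\<lparr>carrier := D\<rparr>\<^esub> (b \<oplus>\<^bsub>B\<lparr>carrier := D\<rparr>\<^esub> c)
      = a \<otimes>\<^bsub>B\<lparr>carrier := D\<rparr>\<^esub> b \<ominus>\<^bsub>B\<lparr>carrier := D\<rparr>\<^esub> a \<oplus>\<^bsub>B\<lparr>carrier := D\<rparr>\<^esub> (a \<otimes>\<^bsub>B\<lparr>carrier := D\<rparr>\<^esub> c)"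
      using *(1) by (simp add: a_minus_def inv)
  qed
qed

lemma restrict_operations:
  assumes D: "subbrace D B" and d: "d \<in> D"
  shows "\<ominus>\<^bsub>B\<lparr>carrier := D\<rparr>\<^esub> d = \<ominus> d" "inv\<^bsub>B\<lparr>carrier := D\<rparr>\<^esub> d = inv d"
    "lambda_map (B\<lparr>carrier := D\<rparr>) d = lambda_map B d"
proof -
  have D': "subgroup D (add_monoid B)" "subgroup D B" using D by (auto simp: subbrace_def)
  show "\<ominus>\<^bsub>B\<lparr>carrier := D\<rparr>\<^esub> d = \<ominus> d" using A.m_inv_consistent[OF D'(1) d] by (simp add: a_inv_def)
  then show "lambda_map (B\<lparr>carrier := D\<rparr>) d = lambda_map B d"
    by (simp add: lambda_map_def fun_eq_iff)
  show "inv\<^bsub>B\<lparr>carrier := D\<rparr>\<^esub> d = inv d" by (rule M.m_inv_consistent[OF D'(2) d])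
qed

lemma subbrace_restrict:
  assumes D: "subbrace D B"
  shows "subbrace A (B\<lparr>carrier := D\<rparr>) \<longleftrightarrow> subbrace A B \<and> A \<subseteq> D"
proof -
  have D': "subgroup D (add_monoid B)" "subgroup D B" using D by (auto simp: subbrace_def)
  have "subgroup A ((add_monoid B)\<lparr>carrier := D\<rparr>) \<longleftrightarrow> subgroup A (add_monoid B) \<and> A \<subseteq> D"
    using A.incl_subgroup[OF D'(1)] A.subgroup_incl[OF _ D'(1)] subgroup.subset[of A "(add_monoid B)\<lparr>carrier := D\<rparr>"] by auto
  moreover have "subgroup A (B\<lparr>carrier := D\<rparr>) \<longleftrightarrow> subgroup A B \<and> A \<subseteq> D"
    using M.incl_subgroup[OF D'(2)] M.subgroup_incl[OF _ D'(2)] subgroup.subset[of A "B\<lparr>carrier := D\<rparr>"] by auto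
  ultimately show ?thesis by (auto simp: subbrace_def)
qed

lemma brace_ideal_restrict:
  assumes D: "subbrace D B"
  shows "brace_ideal A (B\<lparr>carrier := D\<rparr>) \<longleftrightarrow> ideal_in B A D"
proof -
  interpret D: skew_brace "B\<lparr>carrier := D\<rparr>" by (rule subbrace_is_skew_brace[OF D])
  note r = restrict_operations[OF D]
  have r1: "inv\<^bsub>add_monoid (B\<lparr>carrier := D\<rparr>)\<^esub> d = \<ominus> d" if "d \<in> D" for d
    using r(1)[OF that] by (simp add: a_inv_def)
  have a: "A \<lhd> add_monoid (B\<lparr>carrier := D\<rparr>) \<longleftrightarrow>
      subgroup A (add_monoid (B\<lparr>carrier := D\<rparr>)) \<and> (\<forall>d\<in>D. \<forall>a\<in>A. d \<oplus> a \<oplus> (\<ominus> d) \<in> A)"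
    using group.normal_inv_iff[OF D.add_group, of A] r1 by simp
  have m: "A \<lhd> B\<lparr>carrier := D\<rparr> \<longleftrightarrow>
      subgroup A (B\<lparr>carrier := D\<rparr>) \<and> (\<forall>d\<in>D. \<forall>a\<in>A. d \<otimes> a \<otimes> inv d \<in> A)"
    using group.normal_inv_iff[OF D.mult_group, of A] r(2) by simp
  have s: "subgroup A (add_monoid (B\<lparr>carrier := D\<rparr>))" "subgroup A (B\<lparr>carrier := D\<rparr>)"
    if "subbrace A (B\<lparr>carrier := D\<rparr>)" using that by (simp_all add: subbrace_def)
  show ?thesis
    unfolding brace_ideal_def left_ideal_def ideal_in_def a m subbrace_restrict[OF D]
    using s[unfolded subbrace_restrict[OF D]] r(3) by (auto simp: image_subset_iff)
qed

lemma brace_ideal_iff: "brace_ideal A B \<longleftrightarrow> ideal_in B A (carrier B)"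
proof -
  have "B\<lparr>carrier := carrier B\<rparr> = B" by simp
  then show ?thesis using brace_ideal_restrict[OF subbrace_carrier] by metis
qed

lemma ideal_in_restrict:
  assumes D: "subbrace D B" and E: "E \<subseteq> D"
  shows "ideal_in (B\<lparr>carrier := D\<rparr>) A E \<longleftrightarrow> ideal_in B A E"
proof -
  have "\<ominus>\<^bsub>B\<lparr>carrier := D\<rparr>\<^esub> d = \<ominus> d" "inv\<^bsub>B\<lparr>carrier := D\<rparr>\<^esub> d = inv d"
    "lambda_map (B\<lparr>carrier := D\<rparr>) d = lambda_map B d" if "d \<in> E" for d
    using restrict_operations[OF D, of d] that E by auto
  then show ?thesis
    unfolding ideal_in_def subbrace_restrict[OF D] using E by (auto simp del: subset_iff)
qed

lemma ideal_in_mono: "\<lbrakk>ideal_in B A D; E \<subseteq> D; A \<subseteq> E\<rbrakk> \<Longrightarrow> ideal_in B A E"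
  unfolding ideal_in_def by blast

lemma ideal_in_Int:
  assumes A: "ideal_in B A D" and C: "subbrace C B" "C \<subseteq> D"
  shows "ideal_in B (A \<inter> C) C"
proof -
  have "subbrace (A \<inter> C) B" using A C subbrace_Int by (simp add: ideal_in_def)
  moreover have "lambda_map B d a \<in> A \<inter> C \<and> d \<oplus> a \<oplus> \<ominus> d \<in> A \<inter> C \<and> d \<otimes> a \<otimes> inv d \<in> A \<inter> C"
    if "d \<in> C" "a \<in> A \<inter> C" for d a
  proof -
    have "a \<in> A" "a \<in> C" "d \<in> D" using that C(2) by auto
    then show ?thesis using A that(1) subbrace_closed[OF C(1)] by (simp add: ideal_in_def)
  qed
  ultimately show ?thesis by (simp add: ideal_in_def)
qed

lemma left_ideal_iff:
  "left_ideal A B \<longleftrightarrow> subbrace A B \<and> (\<forall>b\<in>carrier B. \<forall>a\<in>A. lambda_map B b a \<in> A)"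
  unfolding left_ideal_def by blast

text \<open>
  This allows computing with classes modulo \<open>I\<close> inside \<open>B\<close>, without passing to the quotient
  brace.
\<close>
lemma ideal_cong:
  assumes I: "brace_ideal I B"
    and c: "x \<in> carrier B" "x' \<in> carrier B" "y \<in> carrier B" "y' \<in> carrier B"
    and eq: "I +> x = I +> x'" "I +> y = I +> y'"
  shows "I +> (x \<oplus> y) = I +> (x' \<oplus> y')" "I +> (x \<otimes> y) = I +> (x' \<otimes> y')"
    "I +> (\<ominus> x) = I +> (\<ominus> x')" "I +> (inv x) = I +> (inv x')"
    "I +> (lambda_map B x y) = I +> (lambda_map B x' y')"
proof -
  interpret NA: normal I "add_monoid B" using I by (simp add: brace_ideal_def)
  interpret NM: normal I B using I by (simp add: brace_ideal_def)
  have add: "I +> (a \<oplus> b) = (I +> a) <+>\<^bsub>B\<^esub> (I +> b)" if "a \<in> carrier B" "b \<in> carrier B" for a b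
    using NA.rcos_sum[of a b] that by (simp add: set_add_def a_r_coset_def)
  have mult: "I +> (a \<otimes> b) = (I +> a) <#> (I +> b)" if "a \<in> carrier B" "b \<in> carrier B" for a b
    using NM.rcos_sum[of a b] that by (simp add: coset_eq[OF I])
  have neg: "I +> (\<ominus> a) = set_inv\<^bsub>add_monoid B\<^esub> (I +> a)" if "a \<in> carrier B" for a
    using NA.rcos_inv[of a] that by (simp add: a_r_coset_def a_inv_def)
  have inv: "I +> (inv a) = set_inv\<^bsub>B\<^esub> (I +> a)" if "a \<in> carrier B" for a
    using NM.rcos_inv[of a] that by (simp add: coset_eq[OF I])
  show "I +> (x \<oplus> y) = I +> (x' \<oplus> y')" using c eq add by simp
  show m: "I +> (x \<otimes> y) = I +> (x' \<otimes> y')" using c eq mult by simp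
  show n: "I +> (\<ominus> x) = I +> (\<ominus> x')" using c eq neg by simp
  show "I +> (inv x) = I +> (inv x')" using c eq inv by simp
  show "I +> (lambda_map B x y) = I +> (lambda_map B x' y')"
    unfolding lambda_map_def using c m n add by simp
qed

lemma coset_memI: "\<lbrakk>subgroup I (add_monoid B); x \<in> carrier B\<rbrakk> \<Longrightarrow> x \<in> I +> x"
  using A.rcos_self[of x I] by simp

lemma coset_eq_iff:
  assumes I: "subgroup I (add_monoid B)" and x: "x \<in> carrier B" and y: "y \<in> carrier B"
  shows "I +> x = I +> y \<longleftrightarrow> (\<exists>i\<in>I. x = i \<oplus> y)"
proof
  assume "I +> x = I +> y"
  then have "x \<in> I +> y" using coset_memI[OF I x] by simp
  then show "\<exists>i\<in>I. x = i \<oplus> y" by (auto simp: a_r_coset_def')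
next
  assume "\<exists>i\<in>I. x = i \<oplus> y"
  then have "x \<in> I +> y" by (auto simp: a_r_coset_def')
  from A.repr_independence[OF this y I] show "I +> x = I +> y" by simp
qed

text \<open>
  \<open>I + C\<close> is the preimage of the image of \<open>C\<close> modulo \<open>I\<close>.
\<close>
lemma set_add_iff_coset:
  assumes I: "subgroup I (add_monoid B)" and C: "C \<subseteq> carrier B"
  shows "x \<in> I <+>\<^bsub>B\<^esub> C \<longleftrightarrow> x \<in> carrier B \<and> (\<exists>c\<in>C. I +> x = I +> c)"
proof
  assume "x \<in> I <+>\<^bsub>B\<^esub> C"
  then obtain i c where ic: "i \<in> I" "c \<in> C" "x = i \<oplus> c" unfolding set_add_def' by blast
  have "x \<in> carrier B" using ic C subgroup.subset[OF I] by auto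
  then show "x \<in> carrier B \<and> (\<exists>c\<in>C. I +> x = I +> c)" using ic C coset_eq_iff[OF I, of x c] by blast
next
  assume "x \<in> carrier B \<and> (\<exists>c\<in>C. I +> x = I +> c)"
  then obtain c where c: "x \<in> carrier B" "c \<in> C" "I +> x = I +> c" by blast
  then obtain i where "i \<in> I" "x = i \<oplus> c" using C coset_eq_iff[OF I, of x c] by blast
  then show "x \<in> I <+>\<^bsub>B\<^esub> C" using c unfolding set_add_def' by blast
qed

lemma set_add_eq_set_mult:
  assumes I: "brace_ideal I B" and C: "C \<subseteq> carrier B"
  shows "I <+>\<^bsub>B\<^esub> C = I <#> C"
proof -
  have "I <+>\<^bsub>B\<^esub> C = (\<Union>c\<in>C. I +> c)" unfolding set_add_def' a_r_coset_def' by blast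
  also have "\<dots> = (\<Union>c\<in>C. I #> c)" using C coset_eq[OF I] by blast
  also have "\<dots> = I <#> C" unfolding set_mult_def r_coset_def by blast
  finally show ?thesis .
qed

lemma ideal_subgroups:
  assumes "brace_ideal I B"
  shows "subbrace I B" "subgroup I (add_monoid B)" "subgroup I B"
  using assms by (simp_all add: brace_ideal_def left_ideal_def subbrace_def)

lemma subbrace_set_add:
  assumes fin: "finite (carrier B)" and I: "brace_ideal I B" and C: "subbrace C B"
  shows "subbrace (I <+>\<^bsub>B\<^esub> C) B"
proof (rule subbrace_finiteI[OF fin])
  note mem = set_add_iff_coset[OF ideal_subgroups(2)[OF I] subbrace_subset[OF C]]
  show "I <+>\<^bsub>B\<^esub> C \<subseteq> carrier B" using mem by blast
  have "\<zero> \<in> C" using C subgroup.one_closed[of C "add_monoid B"] by (simp add: subbrace_def)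
  then show "\<zero> \<in> I <+>\<^bsub>B\<^esub> C" unfolding mem by auto
  fix x y assume "x \<in> I <+>\<^bsub>B\<^esub> C" "y \<in> I <+>\<^bsub>B\<^esub> C"
  then obtain c d where cd: "x \<in> carrier B" "y \<in> carrier B" "c \<in> C" "d \<in> C" "I +> x = I +> c" "I +> y = I +> d"
    unfolding mem by blast
  note cong = ideal_cong[OF I cd(1) subbrace_mem[OF C cd(3)] cd(2) subbrace_mem[OF C cd(4)] cd(5,6)]
  show "x \<oplus> y \<in> I <+>\<^bsub>B\<^esub> C" unfolding mem using cd cong(1) subbrace_closed(1)[OF C cd(3,4)] by blast
  show "x \<otimes> y \<in> I <+>\<^bsub>B\<^esub> C" unfolding mem using cd cong(2) subbrace_closed(2)[OF C cd(3,4)] by blast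
qed

text \<open>
  Modulo \<open>I\<close> the image of \<open>C\<close> is an ideal of the image of \<open>D\<close>, and \<open>I + C\<close> and \<open>I + D\<close> are the
  preimages.
\<close>
lemma ideal_in_set_add:
  assumes fin: "finite (carrier B)" and I: "brace_ideal I B" and D: "subbrace D B" and C: "ideal_in B C D"
  shows "ideal_in B (I <+>\<^bsub>B\<^esub> C) (I <+>\<^bsub>B\<^esub> D)"
proof -
  have CD: "subbrace C B" "C \<subseteq> D" using C by (auto simp: ideal_in_def)
  note memC = set_add_iff_coset[OF ideal_subgroups(2)[OF I] subbrace_subset[OF CD(1)]]
  note memD = set_add_iff_coset[OF ideal_subgroups(2)[OF I] subbrace_subset[OF D]]
  have "lambda_map B x y \<in> I <+>\<^bsub>B\<^esub> C \<and> x \<oplus> y \<oplus> \<ominus> x \<in> I <+>\<^bsub>B\<^esub> C \<and> x \<otimes> y \<otimes> inv x \<in> I <+>\<^bsub>B\<^esub> C"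
    if xy: "x \<in> I <+>\<^bsub>B\<^esub> D" "y \<in> I <+>\<^bsub>B\<^esub> C" for x y
  proof -
    obtain d c where cd: "x \<in> carrier B" "y \<in> carrier B" "d \<in> D" "c \<in> C" "I +> x = I +> d" "I +> y = I +> c"
      using xy unfolding memC memD by blast
    have dc: "d \<in> carrier B" "c \<in> carrier B" using cd subbrace_mem[OF D] CD by blast+
    note cong = ideal_cong[OF I cd(1) dc(1) cd(2) dc(2) cd(5,6)]
    have "I +> (x \<oplus> y \<oplus> \<ominus> x) = I +> (d \<oplus> c \<oplus> \<ominus> d)"
      using ideal_cong(1)[OF I _ _ _ _ cong(1) cong(3)] cd(1,2) dc by simp
    moreover have "I +> (x \<otimes> y \<otimes> inv x) = I +> (d \<otimes> c \<otimes> inv d)"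
      using ideal_cong(2)[OF I _ _ _ _ cong(2) cong(4)] cd(1,2) dc by simp
    moreover have "lambda_map B d c \<in> C" "d \<oplus> c \<oplus> \<ominus> d \<in> C" "d \<otimes> c \<otimes> inv d \<in> C"
      using C cd(3,4) unfolding ideal_in_def by blast+
    moreover have "lambda_map B x y \<in> carrier B" using lambda_closed cd by blast
    ultimately show ?thesis unfolding memC using cong(5) cd(1,2) by (meson A.m_closed A.inv_closed M.m_closed M.inv_closed)
  qed
  moreover have "I <+>\<^bsub>B\<^esub> C \<subseteq> I <+>\<^bsub>B\<^esub> D" unfolding set_add_def' using CD(2) by blast
  ultimately show ?thesis using subbrace_set_add[OF fin I CD(1)] by (simp add: ideal_in_def)
qed

lemma subset_set_add:
  assumes "subgroup C (add_monoid B)" "subgroup D (add_monoid B)"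
  shows "C \<subseteq> C <+>\<^bsub>B\<^esub> D" "D \<subseteq> C <+>\<^bsub>B\<^esub> D"
proof -
  have z: "\<zero> \<in> C" "\<zero> \<in> D" using subgroup.one_closed[OF assms(1)] subgroup.one_closed[OF assms(2)] by simp_all
  have "c = c \<oplus> \<zero>" if "c \<in> C" for c using that subgroup.subset[OF assms(1)] by auto
  then show "C \<subseteq> C <+>\<^bsub>B\<^esub> D" unfolding set_add_def' using z by blast
  have "c = \<zero> \<oplus> c" if "c \<in> D" for c using that subgroup.subset[OF assms(2)] by auto
  then show "D \<subseteq> C <+>\<^bsub>B\<^esub> D" unfolding set_add_def' using z by blast
qed

lemma ideal_in_sum:
  assumes fin: "finite (carrier B)" and D: "subbrace D B" and S: "ideal_in B S D" and V: "ideal_in B V D"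
  shows "ideal_in B (S <+>\<^bsub>B\<^esub> V) D"
proof -
  interpret D: skew_brace "B\<lparr>carrier := D\<rparr>" by (rule subbrace_is_skew_brace[OF D])
  have SD: "subgroup S (add_monoid B)" "subgroup D (add_monoid B)" "S \<subseteq> D"
    using S D by (auto simp: ideal_in_def subbrace_def)
  have fD: "finite (carrier (B\<lparr>carrier := D\<rparr>))" using finite_subset[OF subbrace_subset[OF D] fin] by simp
  have SI: "brace_ideal S (B\<lparr>carrier := D\<rparr>)" using brace_ideal_restrict[OF D] S by simp
  have VI: "ideal_in (B\<lparr>carrier := D\<rparr>) V D" using ideal_in_restrict[OF D order_refl] V by simp
  have sa: "S <+>\<^bsub>B\<lparr>carrier := D\<rparr>\<^esub> Y = S <+>\<^bsub>B\<^esub> Y" for Y by (simp add: set_add_def')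
  have "S <+>\<^bsub>B\<^esub> D \<subseteq> D" unfolding set_add_def' using SD(3) subbrace_closed(1)[OF D] by blast
  then have SDD: "S <+>\<^bsub>B\<^esub> D = D" using subset_set_add(2)[OF SD(1,2)] by blast
  have "subbrace D (B\<lparr>carrier := D\<rparr>)" using subbrace_restrict[OF D] D by blast
  from D.ideal_in_set_add[OF fD SI this VI] show ?thesis
    unfolding sa SDD ideal_in_restrict[OF D order_refl] .
qed

section \<open>Sylow subbraces\<close>

lemma lambda_inverse:
  assumes "a \<in> carrier B" "x \<in> carrier B"
  shows "lambda_map B (inv a) (lambda_map B a x) = x" "lambda_map B a (lambda_map B (inv a) x) = x"
  using lambda_mult[of "inv a" a x] lambda_mult[of a "inv a" x] assms lambda_one by simp_all

lemma lambda_zero: "a \<in> carrier B \<Longrightarrow> lambda_map B a \<zero> = \<zero>"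
  by (simp add: lambda_map_def mult_zero)

lemma mult_add_eq:
  assumes "t \<in> carrier B" "y \<in> carrier B" "s \<in> carrier B"
  shows "t \<otimes> (y \<oplus> s) = (t \<otimes> y) \<oplus> lambda_map B t s"
  using assms by (simp add: brace_distrib lambda_map_def a_minus_def A.m_assoc)

lemma lambda_inj_on: "a \<in> carrier B \<Longrightarrow> inj_on (lambda_map B a) (carrier B)"
  by (intro inj_onI) (metis lambda_inverse(1))

lemma lambda_image_subgroup:
  assumes fin: "finite (carrier B)" and S: "subgroup S (add_monoid B)" and a: "a \<in> carrier B"
  shows "subgroup (lambda_map B a ` S) (add_monoid B)" "card (lambda_map B a ` S) = card S"
proof -
  have Sc: "S \<subseteq> carrier B" using subgroup.subset[OF S] by simp
  show "subgroup (lambda_map B a ` S) (add_monoid B)"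
  proof (rule A.finite_subgroupI[OF fin])
    show "lambda_map B a ` S \<subseteq> carrier B" using Sc a lambda_closed by blast
    have "\<zero> \<in> S" using subgroup.one_closed[OF S] by simp
    then show "\<zero> \<in> lambda_map B a ` S" using lambda_zero[OF a] by (metis imageI)
    fix u v assume "u \<in> lambda_map B a ` S" "v \<in> lambda_map B a ` S"
    then obtain x y where xy: "x \<in> S" "y \<in> S" "u = lambda_map B a x" "v = lambda_map B a y" by blast
    then have "u \<oplus> v = lambda_map B a (x \<oplus> y)" using lambda_add[OF a subsetD[OF Sc xy(1)] subsetD[OF Sc xy(2)]] by simp
    moreover have "x \<oplus> y \<in> S" using subgroup.m_closed[OF S xy(1,2)] by simp
    ultimately show "u \<oplus> v \<in> lambda_map B a ` S" by blast
  qed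
  show "card (lambda_map B a ` S) = card S"
    using card_image[OF inj_on_subset[OF lambda_inj_on[OF a] Sc]] .
qed

text \<open>
  Let \<open>T\<close> be a Sylow \<open>q\<close>-subgroup of \<open>(B,\<cdot>)\<close>. Through \<open>\<lambda>\<close> it acts on the Sylow \<open>q\<close>-subgroups of
  \<open>(B,+)\<close>; their number is prime to \<open>q\<close>, so \<open>T\<close> fixes one of them, \<open>S\<close>. Since \<open>\<lambda>\<^sub>t(S) = S\<close>, left
  multiplication by \<open>t \<in> T\<close> maps \<open>y + S\<close> to \<open>t y + S\<close>. Thus \<open>T\<close> also acts on these cosets, whose
  number is prime to \<open>q\<close>, and fixes some \<open>y + S\<close>. Comparing sizes, \<open>T y = y + S\<close>; multiplication
  by the inverse of \<open>y\<close> turns this into an equality between a conjugate of \<open>T\<close> and the image of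
  \<open>S\<close> under \<open>\<lambda>\<close> of that inverse. This set is a subgroup for both operations.
\<close>
theorem exists_sylow_subbrace:
  fixes q :: nat
  assumes fin: "finite (carrier B)" and q: "Factorial_Ring.prime q"
  shows "\<exists>Q k w. subbrace Q B \<and> card Q = q ^ k \<and> card (carrier B) = w * card Q \<and> \<not> q dvd w"
proof -
  let ?n = "card (carrier B)"
  define b where "b = multiplicity q ?n"
  have n0: "?n \<noteq> 0" using fin M.one_closed by auto
  have "\<not> is_unit q" using not_prime_unit q by blast
  then obtain m where m': "?n = q ^ b * m" and qm: "\<not> q dvd m"
    using multiplicity_decompose'[OF n0] unfolding b_def by blast
  have m: "?n = m * q ^ b" using m' by simp
  obtain T where T: "subgroup T B" "card T = q ^ b"
    using sylow_thm[OF q mult_group, of b m] m fin by (auto simp: order_def mult.commute)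
  interpret T: subgroup T B by (rule T(1))
  have Tc: "t \<in> carrier B" if "t \<in> T" for t using that by simp
  let ?Y = "{S. subgroup S (add_monoid B) \<and> card S = q ^ b}"
  have sub: "S \<subseteq> carrier B" if "S \<in> ?Y" for S using that subgroup.subset[of S "add_monoid B"] by simp
  have "\<exists>S\<in>?Y. \<forall>t\<in>T. lambda_map B t ` S = S"
  proof (rule M.p_action_fixed_point[OF q T])
    show "finite ?Y" by (rule finite_subset[of _ "Pow (carrier B)"]) (use fin sub in auto)
    show "\<not> q dvd card ?Y" using A.sylow_subgroups_card[OF fin q _ qm, of b] m by (simp add: order_def)
    show "lambda_map B t ` S \<in> ?Y" if "t \<in> T" "S \<in> ?Y" for t S
      using that lambda_image_subgroup[OF fin _ Tc] by simp
    show "lambda_map B \<one> ` S = S" if "S \<in> ?Y" for S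
      using sub[OF that] lambda_one by (force simp: subset_iff)
    show "lambda_map B (s \<otimes> t) ` S = lambda_map B s ` lambda_map B t ` S" if "s \<in> T" "t \<in> T" "S \<in> ?Y" for s t S
      using sub[OF that(3)] that(1,2) lambda_mult unfolding image_image
      by (intro image_cong) (auto simp: subset_iff)
  qed
  then obtain S where S: "subgroup S (add_monoid B)" "card S = q ^ b" and TS: "\<And>t. t \<in> T \<Longrightarrow> lambda_map B t ` S = S"
    by blast
  have Sc: "S \<subseteq> carrier B" using S sub by blast
  let ?X = "(\<lambda>y. y <+ S) ` carrier B"
  have X: "?X = lcosets\<^bsub>add_monoid B\<^esub> S" by (auto simp: LCOSETS_def a_l_coset_def)
  have move: "t <# (y <+ S) = (t \<otimes> y) <+ S" if t: "t \<in> T" and y: "y \<in> carrier B" for t y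
  proof -
    have "t <# (y <+ S) = (\<lambda>s. t \<otimes> (y \<oplus> s)) ` S" by (auto simp: l_coset_def a_l_coset_def')
    also have "\<dots> = (\<lambda>s. (t \<otimes> y) \<oplus> s) ` lambda_map B t ` S"
      unfolding image_image using mult_add_eq[OF Tc[OF t] y] Sc by (intro image_cong) auto
    also have "\<dots> = (t \<otimes> y) <+ S" unfolding TS[OF t] by (auto simp: a_l_coset_def')
    finally show ?thesis .
  qed
  have "\<exists>Z\<in>?X. \<forall>t\<in>T. t <#\<^bsub>B\<^esub> Z = Z"
  proof (rule M.p_action_fixed_point[OF q T])
    show "finite ?X" using fin by simp
    have "card ?X * card S = m * card S"
      using A.l_lagrange[OF fin S(1)] m S(2) unfolding X by (simp add: order_def)
    then show "\<not> q dvd card ?X" using qm A.card_subgroup_pos[OF fin S(1)] by simp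
    show "t <#\<^bsub>B\<^esub> Z \<in> ?X" if "t \<in> T" "Z \<in> ?X" for t Z
      using that move by auto
    show "\<one> <#\<^bsub>B\<^esub> Z = Z" if "Z \<in> ?X" for Z
      using that move[OF T.one_closed] by auto
    show "(s \<otimes> t) <#\<^bsub>B\<^esub> Z = s <#\<^bsub>B\<^esub> (t <#\<^bsub>B\<^esub> Z)" if "s \<in> T" "t \<in> T" "Z \<in> ?X" for s t Z
      using that move by (auto simp: M.m_assoc)
  qed
  then obtain y where y: "y \<in> carrier B" and fixed: "\<And>t. t \<in> T \<Longrightarrow> t <#\<^bsub>B\<^esub> (y <+ S) = y <+ S" by blast
  let ?Q = "lambda_map B (inv y) ` S" and ?P = "(\<lambda>t. inv y \<otimes> t \<otimes> inv (inv y)) ` T"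
  have Q: "subgroup ?Q (add_monoid B)" "card ?Q = q ^ b"
    using lambda_image_subgroup[OF fin S(1), of "inv y"] y S(2) by simp_all
  have P: "subgroup ?P B" "card ?P = q ^ b"
    using M.subgroup_conjugate[OF fin T(1), of "inv y"] y T(2) by simp_all
  have PQ: "?P \<subseteq> ?Q"
  proof
    fix z assume "z \<in> ?P"
    then obtain t where t: "t \<in> T" "z = inv y \<otimes> t \<otimes> y" using y by auto
    have z: "z \<in> carrier B" using t y Tc by simp
    have "\<zero> \<in> S" using subgroup.one_closed[OF S(1)] by simp
    then have "y \<in> y <+ S" unfolding a_l_coset_def' using y by force
    then have "t \<otimes> y \<in> t <#\<^bsub>B\<^esub> (y <+ S)" unfolding l_coset_def by blast
    then have "t \<otimes> y \<in> y <+ S" using fixed[OF t(1)] by simp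
    then obtain s where s: "s \<in> S" "t \<otimes> y = y \<oplus> s" unfolding a_l_coset_def' by blast
    have "y \<otimes> z = t \<otimes> y" using t y Tc by (simp add: M.group_normalise)
    then have "y \<oplus> lambda_map B y z = y \<oplus> s" using s mult_eq_add_lambda[OF y z] by simp
    then have "lambda_map B y z = s" using y z s Sc lambda_closed by auto
    then have "z = lambda_map B (inv y) s" using lambda_inverse(1)[OF y z] by simp
    then show "z \<in> ?Q" using s(1) by blast
  qed
  have "finite ?Q" using finite_subset[OF Sc fin] by (rule finite_imageI)
  from card_subset_eq[OF this PQ trans[OF P(2) Q(2)[symmetric]]] have "?P = ?Q" .
  from P(1)[unfolded this] have "subbrace ?Q B" unfolding subbrace_def using Q(1) by (intro conjI)
  moreover have "?n = m * card ?Q" unfolding Q(2) by (rule m)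
  ultimately show ?thesis using Q(2) qm by (intro exI conjI)
qed

corollary exists_sylow_subbrace_in:
  fixes q :: nat
  assumes fin: "finite (carrier B)" and q: "Factorial_Ring.prime q" and D: "subbrace D B"
  obtains Q k w where "subbrace Q B" "Q \<subseteq> D" "card Q = q ^ k" "card D = w * card Q" "\<not> q dvd w"
proof -
  interpret D: skew_brace "B\<lparr>carrier := D\<rparr>" by (rule subbrace_is_skew_brace[OF D])
  have "finite (carrier (B\<lparr>carrier := D\<rparr>))" using finite_subset[OF subbrace_subset[OF D] fin] by simp
  note syl = D.exists_sylow_subbrace[OF this q]
  have cD: "carrier (B\<lparr>carrier := D\<rparr>) = D" by simp
  from syl
  obtain Q k w where "subbrace Q B" "Q \<subseteq> D" "card Q = q ^ k" "card D = w * card Q" "\<not> q dvd w"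
    unfolding subbrace_restrict[OF D] cD by blast
  then show ?thesis by (rule that)
qed

section \<open>Central nilpotency\<close>

text \<open>
  The condition \<open>\<lambda>\<^sub>a(b) = b\<close> says that \<open>a b = a + b\<close>.
\<close>
lemma centre_iff:
  "a \<in> centre B \<longleftrightarrow> a \<in> carrier B \<and>
    (\<forall>b\<in>carrier B. a \<otimes> b = a \<oplus> b \<and> a \<oplus> b = b \<oplus> a \<and> a \<otimes> b = b \<otimes> a)"
proof -
  have "lambda_map B a b = b \<longleftrightarrow> a \<otimes> b = a \<oplus> b" if ab: "a \<in> carrier B" "b \<in> carrier B" for b
    using A.l_cancel[of a "lambda_map B a b" b] mult_eq_add_lambda[OF ab] lambda_closed[OF ab] ab by simp
  then show ?thesis unfolding centre_def socle_def lambda_kernel_def group_centre_def by auto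
qed

lemma zero_centre: "\<zero> \<in> centre B"
  unfolding centre_iff using M.one_closed by (simp add: mult_zero) (simp add: zero_eq_one)

lemma centreD:
  assumes a: "a \<in> centre B" and b: "b \<in> carrier B"
  shows "a \<otimes> b = a \<oplus> b" "b \<oplus> a = a \<oplus> b" "b \<otimes> a = a \<oplus> b"
proof -
  have e: "a \<otimes> b = a \<oplus> b" "a \<oplus> b = b \<oplus> a" "a \<otimes> b = b \<otimes> a" using a b unfolding centre_iff by blast+
  show "a \<otimes> b = a \<oplus> b" "b \<oplus> a = a \<oplus> b" by (rule e(1) e(2)[symmetric])+
  show "b \<otimes> a = a \<oplus> b" by (rule trans[OF e(3)[symmetric] e(1)])
qed

lemma centre_closed:
  assumes a: "a \<in> centre B" and c: "c \<in> centre B"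
  shows "a \<oplus> c \<in> centre B" "a \<otimes> c \<in> centre B"
proof -
  have ac: "a \<in> carrier B" using a by (simp add: centre_iff)
  note a1 = centreD[OF a]
  show "a \<oplus> c \<in> centre B"
  proof -
    have cc: "c \<in> carrier B" using c by (simp add: centre_iff)
    note c1 = centreD[OF c]
    have "(a \<oplus> c) \<otimes> b = (a \<oplus> c) \<oplus> b" "b \<oplus> (a \<oplus> c) = (a \<oplus> c) \<oplus> b" "b \<otimes> (a \<oplus> c) = (a \<oplus> c) \<oplus> b"
      if b: "b \<in> carrier B" for b
    proof -
      have ac': "a \<oplus> c = a \<otimes> c" using a1(1)[OF cc] by simp
      show 1: "(a \<oplus> c) \<otimes> b = (a \<oplus> c) \<oplus> b"
      proof -
        have "(a \<oplus> c) \<otimes> b = a \<otimes> (c \<otimes> b)" unfolding ac' by (rule M.m_assoc[OF ac cc b])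
        also have "\<dots> = a \<oplus> (c \<oplus> b)" using a1(1) c1(1) b cc by simp
        finally show ?thesis using ac cc b by (simp add: A.m_assoc)
      qed
      show "b \<oplus> (a \<oplus> c) = (a \<oplus> c) \<oplus> b"
      proof -
        have "b \<oplus> (a \<oplus> c) = (a \<oplus> b) \<oplus> c" using a1(2)[OF b] ac cc b by (simp flip: A.m_assoc)
        also have "\<dots> = a \<oplus> (b \<oplus> c)" using ac cc b by (simp add: A.m_assoc)
        also have "\<dots> = a \<oplus> (c \<oplus> b)" using c1(2)[OF b] by simp
        finally show ?thesis using ac cc b by (simp add: A.m_assoc)
      qed
      show "b \<otimes> (a \<oplus> c) = (a \<oplus> c) \<oplus> b"
      proof -
        have "b \<otimes> (a \<oplus> c) = (b \<otimes> a) \<otimes> c" unfolding ac' using M.m_assoc[OF b ac cc] by simp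
        also have "\<dots> = (a \<otimes> b) \<otimes> c" using a1(1,3)[OF b] by simp
        also have "\<dots> = a \<otimes> (b \<otimes> c)" by (rule M.m_assoc[OF ac b cc])
        also have "\<dots> = a \<otimes> (c \<otimes> b)" using c1(1,3)[OF b] by simp
        also have "\<dots> = (a \<oplus> c) \<otimes> b" unfolding ac' by (rule M.m_assoc[OF ac cc b, symmetric])
        finally show ?thesis using 1 by simp
      qed
    qed
    then show ?thesis unfolding centre_iff using ac cc by simp
  qed
  moreover have "c \<in> carrier B" using c unfolding centre_iff by blast
  ultimately show "a \<otimes> c \<in> centre B" unfolding a1(1)[OF \<open>c \<in> carrier B\<close>] by blast
qed

lemma quotient_brace_operations:
  assumes I: "brace_ideal I B"
  shows "carrier (quotient_brace B I) = (\<lambda>a. I +> a) ` carrier B"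
    and "\<And>a b. \<lbrakk>a \<in> carrier B; b \<in> carrier B\<rbrakk> \<Longrightarrow> (I +> a) \<oplus>\<^bsub>quotient_brace B I\<^esub> (I +> b) = I +> (a \<oplus> b)"
    and "\<And>a b. \<lbrakk>a \<in> carrier B; b \<in> carrier B\<rbrakk> \<Longrightarrow> (I +> a) \<otimes>\<^bsub>quotient_brace B I\<^esub> (I +> b) = I +> (a \<otimes> b)"
    and "\<zero>\<^bsub>quotient_brace B I\<^esub> = I +> \<zero>"
proof -
  interpret NA: normal I "add_monoid B" using I by (simp add: brace_ideal_def)
  interpret NM: normal I B using I by (simp add: brace_ideal_def)
  show "carrier (quotient_brace B I) = (\<lambda>a. I +> a) ` carrier B"
    by (auto simp: quotient_brace_def A_RCOSETS_def')
  show "(I +> a) \<oplus>\<^bsub>quotient_brace B I\<^esub> (I +> b) = I +> (a \<oplus> b)" if "a \<in> carrier B" "b \<in> carrier B" for a b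
    using NA.rcos_sum[of a b] that by (simp add: quotient_brace_def set_add_def a_r_coset_def)
  show "(I +> a) \<otimes>\<^bsub>quotient_brace B I\<^esub> (I +> b) = I +> (a \<otimes> b)" if "a \<in> carrier B" "b \<in> carrier B" for a b
    using NM.rcos_sum[of a b] that by (simp add: quotient_brace_def coset_eq[OF I])
  have "I +> \<zero> = I" using A.coset_mult_one[of I] NA.subset by simp
  then show "\<zero>\<^bsub>quotient_brace B I\<^esub> = I +> \<zero>" by (simp add: quotient_brace_def)
qed

lemma abelian_quotientD:
  assumes I: "brace_ideal I B" and ab: "abelian_brace (quotient_brace B I)" and a: "a \<in> carrier B" and b: "b \<in> carrier B"
  shows "I +> (a \<oplus> b) = I +> (b \<oplus> a)" "I +> (a \<otimes> b) = I +> (a \<oplus> b)"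
proof -
  note ops = quotient_brace_operations[OF I]
  have c: "I +> a \<in> carrier (quotient_brace B I)" "I +> b \<in> carrier (quotient_brace B I)" unfolding ops(1) using a b by blast+
  have "comm_monoid (add_monoid (quotient_brace B I))" using ab by (simp add: abelian_brace_def comm_group_def)
  from comm_monoid.m_comm[OF this, of "I +> a" "I +> b"] c
  show "I +> (a \<oplus> b) = I +> (b \<oplus> a)" using ops(2)[OF a b] ops(2)[OF b a] by simp
  show "I +> (a \<otimes> b) = I +> (a \<oplus> b)"
    using ab c ops(2,3)[OF a b] unfolding abelian_brace_def by simp
qed

text \<open>
  The preimage of the centre of \<open>B/Z\<close>, so the term that follows \<open>Z\<close> in a central series.
\<close>
definition "central_mod Z = {a \<in> carrier B. Z +> a \<in> centre (quotient_brace B Z)}"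

lemma central_mod_iff:
  assumes Z: "brace_ideal Z B"
  shows "a \<in> central_mod Z \<longleftrightarrow> a \<in> carrier B \<and> (\<forall>b\<in>carrier B.
    Z +> (a \<otimes> b) = Z +> (a \<oplus> b) \<and> Z +> (a \<oplus> b) = Z +> (b \<oplus> a) \<and> Z +> (a \<otimes> b) = Z +> (b \<otimes> a))"
proof -
  interpret Q: skew_brace "quotient_brace B Z" by (rule skew_brace_quotient[OF Z])
  show ?thesis
  proof (cases "a \<in> carrier B")
    case True
    then show ?thesis
      unfolding central_mod_def Q.centre_iff quotient_brace_operations(1)[OF Z]
      by (simp add: quotient_brace_operations(2,3)[OF Z])
  next
    case False
    then show ?thesis by (simp add: central_mod_def)
  qed
qed

lemma central_mod_cong:
  assumes Z: "brace_ideal Z B" and a: "a \<in> central_mod Z" and b: "b \<in> carrier B" "Z +> b = Z +> a"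
  shows "b \<in> central_mod Z"
  using a b unfolding central_mod_def by simp

lemma subset_central_mod:
  assumes Z: "brace_ideal Z B"
  shows "Z \<subseteq> central_mod Z"
proof
  interpret Q: skew_brace "quotient_brace B Z" by (rule skew_brace_quotient[OF Z])
  note Q0 = Q.zero_centre
  fix z assume z: "z \<in> Z"
  then have zc: "z \<in> carrier B" by (rule subbrace_mem[OF ideal_subgroups(1)[OF Z]])
  have "z = z \<oplus> \<zero>" using zc by simp
  then have "Z +> z = Z +> \<zero>"
    using coset_eq_iff[OF ideal_subgroups(2)[OF Z] zc A.one_closed] z by blast
  then show "z \<in> central_mod Z"
    unfolding central_mod_def using zc Q0 quotient_brace_operations(4)[OF Z] by simp
qed

lemma central_mod_ideal:
  assumes fin: "finite (carrier B)" and Z: "brace_ideal Z B"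
  shows "brace_ideal (central_mod Z) B"
proof -
  let ?Q = "quotient_brace B Z"
  interpret Q: skew_brace ?Q by (rule skew_brace_quotient[OF Z])
  note ops = quotient_brace_operations[OF Z]
  have sub: "central_mod Z \<subseteq> carrier B" unfolding central_mod_def by blast
  have zero: "\<zero> \<in> central_mod Z"
    using subset_central_mod[OF Z] subgroup.one_closed[OF ideal_subgroups(2)[OF Z]] by auto
  have sb: "subbrace (central_mod Z) B"
  proof (rule subbrace_finiteI[OF fin sub zero])
    fix x y assume "x \<in> central_mod Z" "y \<in> central_mod Z"
    then have xy: "x \<in> carrier B" "y \<in> carrier B" "Z +> x \<in> centre ?Q" "Z +> y \<in> centre ?Q"
      unfolding central_mod_def by simp_all
    show "x \<oplus> y \<in> central_mod Z"
      unfolding central_mod_def using Q.centre_closed(1)[OF xy(3,4)] ops(2)[OF xy(1,2)] xy(1,2) by simp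
    show "x \<otimes> y \<in> central_mod Z"
      unfolding central_mod_def using Q.centre_closed(2)[OF xy(3,4)] ops(3)[OF xy(1,2)] xy(1,2) by simp
  qed
  have "lambda_map B d a \<in> central_mod Z \<and> d \<oplus> a \<oplus> \<ominus> d \<in> central_mod Z \<and> d \<otimes> a \<otimes> inv d \<in> central_mod Z"
    if d: "d \<in> carrier B" and a: "a \<in> central_mod Z" for d a
  proof (intro conjI)
    have ac: "a \<in> carrier B" using a sub by blast
    have e: "Z +> (a \<otimes> d) = Z +> (a \<oplus> d)" "Z +> (a \<oplus> d) = Z +> (d \<oplus> a)" "Z +> (a \<otimes> d) = Z +> (d \<otimes> a)"
      using a d unfolding central_mod_iff[OF Z] by blast+
    have 1: "Z +> (d \<otimes> a) = Z +> (d \<oplus> a)" using e by simp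
    have "Z +> lambda_map B d a = Z +> (\<ominus> d \<oplus> (d \<oplus> a))"
      unfolding lambda_map_def using ideal_cong(1)[OF Z _ _ _ _ refl 1, of "\<ominus> d"] d ac by simp
    also have "\<ominus> d \<oplus> (d \<oplus> a) = a" by (rule A.inv_mult_cancel(1)[OF d ac])
    finally show "lambda_map B d a \<in> central_mod Z"
      using central_mod_cong[OF Z a lambda_closed[OF d ac]] by simp
    have "Z +> (d \<oplus> a \<oplus> \<ominus> d) = Z +> (a \<oplus> d \<oplus> \<ominus> d)"
      using ideal_cong(1)[OF Z _ _ _ _ e(2) refl, of "\<ominus> d"] d ac by simp
    then have "Z +> (d \<oplus> a \<oplus> \<ominus> d) = Z +> a" using d ac by (simp add: A.m_assoc)
    then show "d \<oplus> a \<oplus> \<ominus> d \<in> central_mod Z" using central_mod_cong[OF Z a] d ac by simp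
    have "Z +> (d \<otimes> a \<otimes> inv d) = Z +> (a \<otimes> d \<otimes> inv d)"
      using ideal_cong(2)[OF Z _ _ _ _ e(3) refl, of "inv d"] d ac by simp
    then have "Z +> (d \<otimes> a \<otimes> inv d) = Z +> a" using d ac by (simp add: M.m_assoc)
    then show "d \<otimes> a \<otimes> inv d \<in> central_mod Z" using central_mod_cong[OF Z a] d ac by simp
  qed
  then show ?thesis unfolding brace_ideal_iff ideal_in_def using sb sub by (intro conjI ballI) simp_all
qed

lemma zero_ideal:
  assumes fin: "finite (carrier B)"
  shows "brace_ideal {\<zero>} B"
  unfolding brace_ideal_iff ideal_in_def
proof (intro conjI ballI)
  show "subbrace {\<zero>} B" by (rule subbrace_finiteI[OF fin]) (simp_all add: mult_zero)
  fix d a assume d: "d \<in> carrier B" and a: "a \<in> {\<zero>}"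
  show "lambda_map B d a \<in> {\<zero>}" using a d by (simp add: lambda_map_def mult_zero)
  show "d \<oplus> a \<oplus> \<ominus> d \<in> {\<zero>}" using a d by simp
  show "d \<otimes> a \<otimes> inv d \<in> {\<zero>}" using a d by (simp add: zero_eq_one)
qed simp

text \<open>
  The convention for index \<open>0\<close> fits the recursion, so that one step of the series is
  \<open>central_mod\<close> at every index.
\<close>
lemma central_series_Suc:
  assumes fin: "finite (carrier B)"
  shows "brace_ideal (central_series B n) B" and "central_series B (Suc n) = central_mod (central_series B n)"
proof -
  have 0: "central_mod {\<zero>} = centre B"
  proof -
    have "{\<zero>} +> a = {\<zero>} +> b \<longleftrightarrow> a = b" if "a \<in> carrier B" "b \<in> carrier B" for a b
      using that by (simp add: a_r_coset_def')
    then show ?thesis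
      unfolding set_eq_iff central_mod_iff[OF zero_ideal[OF fin]] centre_iff by auto
  qed
  have suc: "central_series B (Suc n) = central_mod (central_series B n)" for n
    by (cases n) (simp_all add: 0, simp add: central_mod_def)
  then show "central_series B (Suc n) = central_mod (central_series B n)" .
  show "brace_ideal (central_series B n) B"
  proof (induction n)
    case 0 show ?case using zero_ideal[OF fin] by simp
  next
    case (Suc n) then show ?case unfolding suc by (rule central_mod_ideal[OF fin])
  qed
qed

text \<open>
  The additive and the multiplicative commutator of \<open>a\<close> and \<open>b\<close> lie in \<open>S \<inter> T\<close>. So \<open>a b = b a\<close>,
  that is, \<open>a + \<lambda>\<^sub>a(b) = b + \<lambda>\<^sub>b(a)\<close>; as \<open>a\<close> and \<open>b\<close> also commute additively,
  \<open>-b + \<lambda>\<^sub>a(b) = -a + \<lambda>\<^sub>b(a)\<close>, an element of \<open>T\<close> on the left and of \<open>S\<close> on the right. Hence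
  \<open>\<lambda>\<^sub>a(b) = b\<close>.
\<close>
lemma ideals_commute:
  assumes S: "ideal_in B S (carrier B)" and T: "ideal_in B T (carrier B)" and ST: "S \<inter> T = {\<zero>}"
    and a: "a \<in> S" and b: "b \<in> T"
  shows "a \<otimes> b = a \<oplus> b" "a \<oplus> b = b \<oplus> a" "a \<otimes> b = b \<otimes> a"
proof -
  have Ss: "subbrace S B" and Ts: "subbrace T B" using S T by (simp_all add: ideal_in_def)
  have ac: "a \<in> carrier B" and bc: "b \<in> carrier B" using subbrace_mem[OF Ss a] subbrace_mem[OF Ts b] .
  have nb: "\<ominus> b \<in> T" "inv b \<in> T" and na: "\<ominus> a \<in> S" using subbrace_closed(3,4)[OF Ts b b] subbrace_closed(3)[OF Ss a a] .
  have "a \<oplus> (b \<oplus> \<ominus> a \<oplus> \<ominus> b) \<in> S"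
    using subbrace_closed(1)[OF Ss a] S na bc by (simp add: ideal_in_def)
  moreover have "(a \<oplus> b \<oplus> \<ominus> a) \<oplus> \<ominus> b \<in> T"
    using subbrace_closed(1)[OF Ts _ nb(1)] T b ac by (simp add: ideal_in_def)
  moreover have "(a \<oplus> b \<oplus> \<ominus> a) \<oplus> \<ominus> b = a \<oplus> (b \<oplus> \<ominus> a \<oplus> \<ominus> b)" using ac bc by (simp add: A.m_assoc)
  ultimately have z: "(a \<oplus> b \<oplus> \<ominus> a) \<oplus> \<ominus> b = \<zero>" using ST by auto
  have "a \<oplus> b = ((a \<oplus> b \<oplus> \<ominus> a) \<oplus> \<ominus> b) \<oplus> (b \<oplus> a)" using ac bc by (simp add: A.group_normalise)
  then show add: "a \<oplus> b = b \<oplus> a" unfolding z using ac bc by simp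
  have ia: "inv a \<in> S" by (rule subbrace_closed(4)[OF Ss a a])
  have "a \<otimes> (b \<otimes> inv a \<otimes> inv b) \<in> S"
    using subbrace_closed(2)[OF Ss a] S ia bc by (simp add: ideal_in_def)
  moreover have "(a \<otimes> b \<otimes> inv a) \<otimes> inv b \<in> T"
    using subbrace_closed(2)[OF Ts _ nb(2)] T b ac by (simp add: ideal_in_def)
  moreover have "(a \<otimes> b \<otimes> inv a) \<otimes> inv b = a \<otimes> (b \<otimes> inv a \<otimes> inv b)" using ac bc by (simp add: M.m_assoc)
  ultimately have z: "(a \<otimes> b \<otimes> inv a) \<otimes> inv b = \<one>" using ST zero_eq_one by auto
  have "a \<otimes> b = ((a \<otimes> b \<otimes> inv a) \<otimes> inv b) \<otimes> (b \<otimes> a)" using ac bc by (simp add: M.group_normalise)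
  then show mult: "a \<otimes> b = b \<otimes> a" unfolding z using ac bc by simp
  have la: "lambda_map B b a \<in> S" and lb: "lambda_map B a b \<in> T"
    using S T a b ac bc by (simp_all add: ideal_in_def)
  note lc = subbrace_mem[OF Ss la] subbrace_mem[OF Ts lb]
  have "a \<oplus> lambda_map B a b = b \<oplus> lambda_map B b a"
    using mult mult_eq_add_lambda[OF ac bc] mult_eq_add_lambda[OF bc ac] by simp
  then have "\<ominus> b \<oplus> (\<ominus> a \<oplus> (a \<oplus> lambda_map B a b)) = \<ominus> b \<oplus> (\<ominus> a \<oplus> (b \<oplus> lambda_map B b a))" by simp
  moreover have "\<ominus> b \<oplus> (\<ominus> a \<oplus> (b \<oplus> lambda_map B b a)) = \<ominus> a \<oplus> lambda_map B b a"
  proof -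
    have "\<ominus> b \<oplus> (\<ominus> a \<oplus> (b \<oplus> lambda_map B b a)) = \<ominus> (a \<oplus> b) \<oplus> (b \<oplus> lambda_map B b a)"
      using ac bc lc by (simp add: A.group_normalise)
    also have "\<dots> = \<ominus> (b \<oplus> a) \<oplus> (b \<oplus> lambda_map B b a)" using add by simp
    also have "\<dots> = \<ominus> a \<oplus> lambda_map B b a" using ac bc lc by (simp add: A.group_normalise)
    finally show ?thesis .
  qed
  ultimately have "\<ominus> b \<oplus> lambda_map B a b = \<ominus> a \<oplus> lambda_map B b a"
    using A.inv_mult_cancel(1)[OF ac lc(2)] by simp
  moreover have "\<ominus> b \<oplus> lambda_map B a b \<in> T" by (rule subbrace_closed(1)[OF Ts nb(1) lb])
  moreover have "\<ominus> a \<oplus> lambda_map B b a \<in> S" by (rule subbrace_closed(1)[OF Ss na la])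
  ultimately have z: "\<ominus> b \<oplus> lambda_map B a b = \<zero>" using ST by auto
  have "lambda_map B a b = b \<oplus> (\<ominus> b \<oplus> lambda_map B a b)" using A.inv_mult_cancel(2)[OF bc lc(2)] by simp
  then have "lambda_map B a b = b" unfolding z using bc by simp
  then show "a \<otimes> b = a \<oplus> b" using mult_eq_add_lambda[OF ac bc] by simp
qed

lemma dvd_of_sylow_dvd:
  fixes n w :: nat
  assumes n: "n > 0" and w: "w > 0"
    and syl: "\<And>q. Factorial_Ring.prime q \<Longrightarrow> \<exists>r k m. r dvd w \<and> n = m * r \<and> \<not> q dvd m \<and> r = q ^ k"
  shows "n dvd w"
proof (rule multiplicity_le_imp_dvd)
  show "n \<noteq> 0" using n by simp
  fix q :: nat assume q: "Factorial_Ring.prime q"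
  obtain r k m where r: "r dvd w" "n = m * r" "\<not> q dvd m" "r = q ^ k" using syl[OF q] by blast
  have pos: "m \<noteq> 0" "r \<noteq> 0" using r(2) n by auto
  have "multiplicity q n = multiplicity q m + multiplicity q r"
    unfolding r(2) using prime_elem_multiplicity_mult_distrib[of q m r] q pos by simp
  also have "multiplicity q m = 0" by (rule not_dvd_imp_multiplicity_0[OF r(3)])
  finally have "multiplicity q n = multiplicity q r" by simp
  also have "\<dots> \<le> multiplicity q w" using r(1) w by (intro dvd_imp_multiplicity_le) simp_all
  finally show "multiplicity q n \<le> multiplicity q w" .
qed

text \<open>
  The upper central series grows as long as it has not reached \<open>B\<close>. If \<open>Z = Z\<^sub>n(B)\<close> is proper,
  then some Sylow ideal \<open>R\<close> is not contained in \<open>Z\<close>, and the upper central series of \<open>R\<close> provides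
  \<open>a \<in> R - Z\<close> that is central in \<open>R\<close> modulo \<open>Z\<close>. By \<open>ideals_commute\<close>, \<open>a\<close> commutes with the Sylow
  ideals for the other primes in every sense required. The \<open>b\<close> for which \<open>a b \<equiv> a + b \<equiv> b + a\<close>
  modulo \<open>Z\<close> form an additive subgroup, those with \<open>a b \<equiv> b a\<close> a multiplicative one; both
  contain all Sylow ideals, so they are \<open>B\<close> and \<open>a\<close> is central modulo \<open>Z\<close>.
\<close>
theorem centrally_nilpotent_if_sylow_ideals:
  assumes fin: "finite (carrier B)"
    and syl: "\<And>q. Factorial_Ring.prime (q::nat) \<Longrightarrow> \<exists>R k m. brace_ideal R B \<and> card R = q ^ k \<and>
      card (carrier B) = m * card R \<and> \<not> q dvd m \<and> centrally_nilpotent (B\<lparr>carrier := R\<rparr>)"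
  shows "centrally_nilpotent B"
proof -
  let ?cs = "central_series B" and ?n = "card (carrier B)"
  note cs = central_series_Suc[OF fin]
  have n0: "?n > 0" using fin A.one_closed by (auto simp: card_gt_0_iff)
  define R where "R q = (SOME R. \<exists>k m. brace_ideal R B \<and> card R = q ^ k \<and>
      ?n = m * card R \<and> \<not> q dvd m \<and> centrally_nilpotent (B\<lparr>carrier := R\<rparr>))" for q :: nat
  have R: "\<exists>k m. brace_ideal (R q) B \<and> card (R q) = q ^ k \<and>
      ?n = m * card (R q) \<and> \<not> q dvd m \<and> centrally_nilpotent (B\<lparr>carrier := R q\<rparr>)"
    if "Factorial_Ring.prime q" for q unfolding R_def by (rule someI_ex[OF syl[OF that]])
  have RI: "brace_ideal (R q) B" if "Factorial_Ring.prime q" for q using R[OF that] by blast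
  have Rin: "ideal_in B (R q) (carrier B)" if "Factorial_Ring.prime q" for q
    by (rule iffD1[OF brace_ideal_iff RI[OF that]])
  have Rs: "subbrace (R q) B" if "Factorial_Ring.prime q" for q by (rule ideal_subgroups(1)[OF RI[OF that]])
  \<comment> \<open>Each \<open>R q\<close> carries the full power of \<open>q\<close> in the order of \<open>B\<close>, so this order divides \<open>|W|\<close>.\<close>
  have full: "W = carrier B"
    if W: "W \<subseteq> carrier B" "W \<noteq> {}" and dvd: "\<And>q. Factorial_Ring.prime q \<Longrightarrow> card (R q) dvd card W" for W
  proof -
    have w0: "card W > 0" using W finite_subset[OF W(1) fin] by (simp add: card_gt_0_iff)
    have "?n dvd card W"
    proof (rule dvd_of_sylow_dvd[OF n0 w0])
      fix q :: nat assume q: "Factorial_Ring.prime q"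
      show "\<exists>r k m. r dvd card W \<and> ?n = m * r \<and> \<not> q dvd m \<and> r = q ^ k"
        using R[OF q] dvd[OF q] by blast
    qed
    then have "?n \<le> card W" using w0 by (rule dvd_imp_le)
    then show ?thesis using card_seteq[OF fin W(1)] by simp
  qed
  have RR: "R q \<inter> R r = {\<zero>}" if q: "Factorial_Ring.prime q" and r: "Factorial_Ring.prime r" and ne: "q \<noteq> r" for q r
  proof -
    have int: "subgroup (R q \<inter> R r) (add_monoid B)"
      by (rule A.subgroups_Inter_pair[OF ideal_subgroups(2)[OF RI[OF q]] ideal_subgroups(2)[OF RI[OF r]]])
    obtain k l where kl: "card (R q) = q ^ k" "card (R r) = r ^ l" using R[OF q] R[OF r] by blast
    have dvd: "card (R q \<inter> R r) dvd q ^ k" "card (R q \<inter> R r) dvd r ^ l"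
      using A.card_subgroup_dvd[OF fin int ideal_subgroups(2)[OF RI[OF q]]]
        A.card_subgroup_dvd[OF fin int ideal_subgroups(2)[OF RI[OF r]]] kl by simp_all
    have "coprime (q ^ k) (r ^ l)" using primes_coprime[OF q r ne] by simp
    from coprime_common_divisor[OF this dvd] have "is_unit (card (R q \<inter> R r))" .
    then have "card (R q \<inter> R r) = 1" by simp
    then obtain z where "R q \<inter> R r = {z}" by (rule card_1_singletonE)
    moreover have "\<zero> \<in> R q \<inter> R r" using subgroup.one_closed[OF int] by simp
    ultimately show ?thesis by auto
  qed
  have step: "?cs n \<subset> ?cs (Suc n)" if ne: "?cs n \<noteq> carrier B" for n
  proof -
    define Z where "Z = ?cs n"
    have Z: "brace_ideal Z B" unfolding Z_def by (rule cs(1))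
    note Zs = ideal_subgroups(2)[OF Z]
    have Zc: "Z \<subseteq> carrier B" by (rule subbrace_subset[OF ideal_subgroups(1)[OF Z]])
    have Zne: "Z \<noteq> {}" using subgroup.one_closed[OF Zs] by blast
    have "\<exists>q. Factorial_Ring.prime q \<and> \<not> R q \<subseteq> Z"
    proof (rule ccontr)
      assume no: "\<not> ?thesis"
      have "card (R q) dvd card Z" if q: "Factorial_Ring.prime q" for q
      proof (rule A.card_subgroup_dvd[OF fin ideal_subgroups(2)[OF RI[OF q]] Zs])
        show "R q \<subseteq> Z" using no q by blast
      qed
      from full[OF Zc Zne this] show False using ne unfolding Z_def by simp
    qed
    then obtain q where q: "Factorial_Ring.prime q" and qZ: "\<not> R q \<subseteq> Z" by blast
    let ?B = "B\<lparr>carrier := R q\<rparr>"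
    interpret Rq: skew_brace ?B by (rule subbrace_is_skew_brace[OF Rs[OF q]])
    have finR: "finite (carrier ?B)" using finite_subset[OF subbrace_subset[OF Rs[OF q]] fin] by simp
    note csR = Rq.central_series_Suc[OF finR]
    \<comment> \<open>Take the last term of the central series of \<open>R q\<close> that is contained in \<open>Z\<close>.\<close>
    have "\<exists>m. central_series ?B m \<subseteq> Z \<and> \<not> central_series ?B (Suc m) \<subseteq> Z"
    proof (rule ccontr)
      assume no: "\<not> ?thesis"
      have "central_series ?B m \<subseteq> Z" for m
      proof (induction m)
        case 0 show ?case using subgroup.one_closed[OF Zs] by simp
      next
        case (Suc m) then show ?case using no by blast
      qed
      moreover obtain m where "central_series ?B m = carrier ?B" using R[OF q] unfolding centrally_nilpotent_def by blast
      ultimately show False using qZ by force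
    qed
    then obtain m a where m: "central_series ?B m \<subseteq> Z" and a: "a \<in> central_series ?B (Suc m)" "a \<notin> Z" by blast
    define Y where "Y = central_series ?B m"
    have Y: "brace_ideal Y ?B" unfolding Y_def by (rule csR(1))
    have Ys: "subbrace Y B" using Rq.ideal_subgroups(1)[OF Y] subbrace_restrict[OF Rs[OF q]] by blast
    have Ysg: "subgroup Y (add_monoid B)" using Ys by (simp add: subbrace_def)
    have restr: "carrier ?B = R q" "monoid.mult ?B = monoid.mult B" "add ?B = add B" "a_r_coset ?B = a_r_coset B"
      by (simp_all add: a_r_coset_def r_coset_def fun_eq_iff)
    have "a \<in> R q \<and> (\<forall>b\<in>R q. Y +> (a \<otimes> b) = Y +> (a \<oplus> b) \<and> Y +> (a \<oplus> b) = Y +> (b \<oplus> a) \<and>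
        Y +> (a \<otimes> b) = Y +> (b \<otimes> a))"
      using a(1) unfolding csR(2) Y_def[symmetric] Rq.central_mod_iff[OF Y] restr .
    then have aR: "a \<in> R q" and aY: "\<And>b. b \<in> R q \<Longrightarrow> Y +> (a \<otimes> b) = Y +> (a \<oplus> b) \<and>
        Y +> (a \<oplus> b) = Y +> (b \<oplus> a) \<and> Y +> (a \<otimes> b) = Y +> (b \<otimes> a)" by blast+
    have ac: "a \<in> carrier B" by (rule subbrace_mem[OF Rs[OF q] aR])
    have YZ: "Z +> x = Z +> y" if eq: "Y +> x = Y +> y" and x: "x \<in> carrier B" and y: "y \<in> carrier B" for x y
    proof -
      obtain i where "i \<in> Y" "x = i \<oplus> y" using eq coset_eq_iff[OF Ysg x y] by blast
      then show ?thesis using m coset_eq_iff[OF Zs x y] unfolding Y_def by blast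
    qed
    have comm: "Z +> (a \<otimes> b) = Z +> (a \<oplus> b) \<and> Z +> (a \<oplus> b) = Z +> (b \<oplus> a) \<and> Z +> (a \<otimes> b) = Z +> (b \<otimes> a)"
      if r: "Factorial_Ring.prime r" and b: "b \<in> R r" for r b
    proof (cases "r = q")
      case True
      have bc: "b \<in> carrier B" by (rule subbrace_mem[OF Rs[OF r] b])
      have e: "Y +> (a \<otimes> b) = Y +> (a \<oplus> b)" "Y +> (a \<oplus> b) = Y +> (b \<oplus> a)" "Y +> (a \<otimes> b) = Y +> (b \<otimes> a)"
        using aY[of b] b True by blast+
      show ?thesis using YZ[OF e(1)] YZ[OF e(2)] YZ[OF e(3)] ac bc by blast
    next
      case False
      show ?thesis
        using ideals_commute[OF Rin[OF q] Rin[OF r] RR[OF q r False[symmetric]] aR b] by simp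
    qed
    define W1 where "W1 = {b \<in> carrier B. Z +> (a \<otimes> b) = Z +> (a \<oplus> b) \<and> Z +> (a \<oplus> b) = Z +> (b \<oplus> a)}"
    have W1: "subgroup W1 (add_monoid B)"
    proof (rule A.finite_subgroupI[OF fin])
      show "W1 \<subseteq> carrier B" unfolding W1_def by blast
      show "\<zero> \<in> W1" unfolding W1_def using ac by (simp add: mult_zero)
      fix b c assume "b \<in> W1" "c \<in> W1"
      then have bc: "b \<in> carrier B" "c \<in> carrier B"
        and e: "Z +> (a \<otimes> b) = Z +> (a \<oplus> b)" "Z +> (a \<oplus> b) = Z +> (b \<oplus> a)"
          "Z +> (a \<otimes> c) = Z +> (a \<oplus> c)" "Z +> (a \<oplus> c) = Z +> (c \<oplus> a)" unfolding W1_def by simp_all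
      have "Z +> (a \<otimes> (b \<oplus> c)) = Z +> ((a \<otimes> b) \<oplus> (\<ominus> a \<oplus> (a \<otimes> c)))"
        using brace_distrib[OF ac bc] ac bc by (simp add: a_minus_def A.m_assoc)
      also have "\<dots> = Z +> ((a \<oplus> b) \<oplus> (\<ominus> a \<oplus> (a \<oplus> c)))"
        using ideal_cong(1)[OF Z _ _ _ _ e(1) ideal_cong(1)[OF Z _ _ _ _ refl e(3), of "\<ominus> a"]] ac bc by simp
      finally have 1: "Z +> (a \<otimes> (b \<oplus> c)) = Z +> (a \<oplus> (b \<oplus> c))" using ac bc by (simp add: A.group_normalise)
      have "Z +> ((a \<oplus> b) \<oplus> c) = Z +> ((b \<oplus> a) \<oplus> c)"
        using ideal_cong(1)[OF Z _ _ _ _ e(2) refl, of c] ac bc by simp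
      also have "(b \<oplus> a) \<oplus> c = b \<oplus> (a \<oplus> c)" using ac bc by (simp add: A.m_assoc)
      also have "Z +> (b \<oplus> (a \<oplus> c)) = Z +> (b \<oplus> (c \<oplus> a))"
        using ideal_cong(1)[OF Z _ _ _ _ refl e(4), of b] ac bc by simp
      finally have "Z +> (a \<oplus> (b \<oplus> c)) = Z +> ((b \<oplus> c) \<oplus> a)" using ac bc by (simp add: A.m_assoc)
      then show "b \<oplus> c \<in> W1" unfolding W1_def using 1 bc by simp
    qed
    define W2 where "W2 = {b \<in> carrier B. Z +> (a \<otimes> b) = Z +> (b \<otimes> a)}"
    have W2: "subgroup W2 B"
    proof (rule M.finite_subgroupI[OF fin])
      show "W2 \<subseteq> carrier B" unfolding W2_def by blast
      show "\<one> \<in> W2" unfolding W2_def using ac by simp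
      fix b c assume "b \<in> W2" "c \<in> W2"
      then have bc: "b \<in> carrier B" "c \<in> carrier B"
        and e: "Z +> (a \<otimes> b) = Z +> (b \<otimes> a)" "Z +> (a \<otimes> c) = Z +> (c \<otimes> a)" unfolding W2_def by simp_all
      have "Z +> ((a \<otimes> b) \<otimes> c) = Z +> ((b \<otimes> a) \<otimes> c)"
        using ideal_cong(2)[OF Z _ _ _ _ e(1) refl, of c] ac bc by simp
      also have "(b \<otimes> a) \<otimes> c = b \<otimes> (a \<otimes> c)" using ac bc by (simp add: M.m_assoc)
      also have "Z +> (b \<otimes> (a \<otimes> c)) = Z +> (b \<otimes> (c \<otimes> a))"
        using ideal_cong(2)[OF Z _ _ _ _ refl e(2), of b] ac bc by simp
      finally have "Z +> (a \<otimes> (b \<otimes> c)) = Z +> ((b \<otimes> c) \<otimes> a)" using ac bc by (simp add: M.m_assoc)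
      then show "b \<otimes> c \<in> W2" unfolding W2_def using bc by simp
    qed
    have RW: "R r \<subseteq> W1" "R r \<subseteq> W2" if r: "Factorial_Ring.prime r" for r
      unfolding W1_def W2_def using comm[OF r] subbrace_mem[OF Rs[OF r]] by blast+
    have "W1 = carrier B"
    proof (rule full)
      show "W1 \<subseteq> carrier B" unfolding W1_def by blast
      show "W1 \<noteq> {}" using subgroup.one_closed[OF W1] by blast
      show "card (R r) dvd card W1" if "Factorial_Ring.prime r" for r
        by (rule A.card_subgroup_dvd[OF fin ideal_subgroups(2)[OF RI[OF that]] W1 RW(1)[OF that]])
    qed
    moreover have "W2 = carrier B"
    proof (rule full)
      show "W2 \<subseteq> carrier B" unfolding W2_def by blast
      show "W2 \<noteq> {}" using subgroup.one_closed[OF W2] by blast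
      show "card (R r) dvd card W2" if "Factorial_Ring.prime r" for r
        by (rule M.card_subgroup_dvd[OF fin ideal_subgroups(3)[OF RI[OF that]] W2 RW(2)[OF that]])
    qed
    ultimately have "a \<in> central_mod Z"
      unfolding central_mod_iff[OF Z] W1_def W2_def using ac by blast
    then have "a \<in> ?cs (Suc n)" unfolding cs(2) Z_def .
    moreover have "?cs n \<subseteq> ?cs (Suc n)" unfolding cs(2) by (rule subset_central_mod[OF cs(1)])
    ultimately show ?thesis using a(2) unfolding Z_def by blast
  qed
  have "\<exists>n. ?cs n = carrier B"
  proof (rule ccontr)
    assume no: "\<not> ?thesis"
    have "n \<le> card (?cs n)" for n
    proof (induction n)
      case (Suc n)
      have "?cs n \<noteq> carrier B" using no by blast
      then have "?cs n \<subset> ?cs (Suc n)" by (rule step)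
      moreover have "finite (?cs (Suc n))"
        using finite_subset[OF subbrace_subset[OF ideal_subgroups(1)[OF cs(1)]] fin] .
      ultimately have "card (?cs n) < card (?cs (Suc n))" by (metis psubset_card_mono)
      then show ?case using Suc by simp
    qed simp
    from this[of "Suc ?n"] card_mono[OF fin subbrace_subset[OF ideal_subgroups(1)[OF cs(1)[of "Suc ?n"]]]]
    show False by simp
  qed
  then obtain n where n: "?cs n = carrier B" by blast
  \<comment> \<open>Central nilpotency requires an index of at least 1.\<close>
  have "?cs (Suc n) = carrier B"
    using subset_central_mod[OF cs(1)[of n]] subbrace_subset[OF ideal_subgroups(1)[OF cs(1)[of "Suc n"]]] n
    unfolding cs(2)[of n] by blast
  then show ?thesis unfolding centrally_nilpotent_def by (intro exI[of _ "Suc n"]) simp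
qed

end

section \<open>Nilpotency modulo an ideal\<close>

text \<open>
  \<open>R\<close> is an ideal of \<open>C\<close> and \<open>R/I\<close> is a Sylow \<open>q\<close>-subgroup of \<open>C/I\<close>.
\<close>
definition sylow_ideal_over :: "('a, 'm) ring_scheme \<Rightarrow> nat \<Rightarrow> 'a set \<Rightarrow> 'a set \<Rightarrow> 'a set \<Rightarrow> bool" where
  "sylow_ideal_over B q I R C \<longleftrightarrow> ideal_in B R C \<and> I \<subseteq> R \<and>
    (\<exists>k. card R = q ^ k * card I) \<and> (\<exists>m. card C = m * card R \<and> \<not> q dvd m)"

text \<open>
  This stands for the nilpotency of \<open>C/I\<close>. A condition on orders and ideals alone is easy to
  transfer to supplements and sums; for \<open>I = 0\<close> it yields central nilpotency as soon as the
  Sylow ideals are centrally nilpotent (\<open>centrally_nilpotent_if_sylow_ideals\<close>).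
\<close>
definition nilpotent_over :: "('a, 'm) ring_scheme \<Rightarrow> 'a set \<Rightarrow> 'a set \<Rightarrow> bool" where
  "nilpotent_over B I C \<longleftrightarrow> (\<forall>q. Factorial_Ring.prime q \<longrightarrow> (\<exists>R. sylow_ideal_over B q I R C))"

locale finite_brace_prime_power_left_ideals = skew_brace +
  assumes fin: "finite (carrier B)"
    and prime_power_left_ideal:
      "\<And>A p k. \<lbrakk>subbrace A B; Factorial_Ring.prime (p::nat); card A = p ^ k\<rbrakk> \<Longrightarrow> left_ideal A B"
begin

interpretation A: group "add_monoid B"
  rewrites "carrier (add_monoid B) = carrier B"
    and "monoid.mult (add_monoid B) = add B"
    and "one (add_monoid B) = ring.zero B"
    and "m_inv (add_monoid B) = a_inv B"
    and "set_mult (add_monoid B) = set_add B"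
    and "r_coset (add_monoid B) = a_r_coset B"
    and "l_coset (add_monoid B) = a_l_coset B"
  using add_group by (simp_all add: a_inv_def set_add_def a_r_coset_def a_l_coset_def)

interpretation M: group B
  by (rule mult_group)

lemma subbrace_groups: "subbrace A B \<Longrightarrow> subgroup A (add_monoid B)" "subbrace A B \<Longrightarrow> subgroup A B"
  by (simp_all add: subbrace_def)

lemma subbrace_card_pos: "subbrace A B \<Longrightarrow> 0 < card A"
  using A.card_subgroup_pos[OF fin subbrace_groups(1)] .

lemma subbrace_card_dvd: "\<lbrakk>subbrace C B; subbrace D B; C \<subseteq> D\<rbrakk> \<Longrightarrow> card C dvd card D"
  using A.card_subgroup_dvd[OF fin subbrace_groups(1) subbrace_groups(1)] .

lemma card_set_add_Int:
  "\<lbrakk>subbrace C B; subbrace D B\<rbrakk> \<Longrightarrow> card (C <+>\<^bsub>B\<^esub> D) * card (C \<inter> D) = card C * card D"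
  using A.card_set_mult_Int[OF fin subbrace_groups(1) subbrace_groups(1)] .

lemma set_add_mono: "\<lbrakk>I \<subseteq> C; J \<subseteq> C; subbrace C B\<rbrakk> \<Longrightarrow> I <+>\<^bsub>B\<^esub> J \<subseteq> C"
  unfolding set_add_def' using subbrace_closed(1) by blast

lemma left_ideal_set_add:
  assumes I: "brace_ideal I B" and Q: "left_ideal Q B"
  shows "left_ideal (I <+>\<^bsub>B\<^esub> Q) B"
proof -
  have Q': "subbrace Q B" using Q by (simp add: left_ideal_def)
  have Is: "subbrace I B" by (rule ideal_subgroups(1)[OF I])
  have "lambda_map B b x \<in> I <+>\<^bsub>B\<^esub> Q" if b: "b \<in> carrier B" and x: "x \<in> I <+>\<^bsub>B\<^esub> Q" for b x
  proof -
    obtain i y where iy: "i \<in> I" "y \<in> Q" "x = i \<oplus> y" using x unfolding set_add_def' by blast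
    have "lambda_map B b x = lambda_map B b i \<oplus> lambda_map B b y"
      using lambda_add[OF b subbrace_mem[OF Is iy(1)] subbrace_mem[OF Q' iy(2)]] iy(3) by simp
    moreover have "lambda_map B b i \<in> I" using I b iy(1) by (auto simp: brace_ideal_def left_ideal_iff)
    moreover have "lambda_map B b y \<in> Q" using Q b iy(2) by (auto simp: left_ideal_iff)
    ultimately show ?thesis unfolding set_add_def' by blast
  qed
  then show ?thesis unfolding left_ideal_iff using subbrace_set_add[OF fin I Q'] by blast
qed

text \<open>
  The order of \<open>I + Q\<close> modulo \<open>I\<close> divides that of \<open>Q\<close>, and the index of \<open>I + Q\<close> in \<open>C\<close> divides that
  of \<open>Q\<close>. So \<open>I + Q\<close> induces a Sylow \<open>q\<close>-subgroup of \<open>C/I\<close>.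
\<close>
lemma sylow_image:
  fixes q :: nat
  assumes q: "Factorial_Ring.prime q" and I: "brace_ideal I B" and C: "subbrace C B" "I \<subseteq> C"
    and Q: "subbrace Q B" "Q \<subseteq> C" "card Q = q ^ j" "card C = w * card Q" "\<not> q dvd w"
  shows "subbrace (I <+>\<^bsub>B\<^esub> Q) B" "I \<subseteq> I <+>\<^bsub>B\<^esub> Q" "Q \<subseteq> I <+>\<^bsub>B\<^esub> Q" "I <+>\<^bsub>B\<^esub> Q \<subseteq> C"
    "\<exists>k. card (I <+>\<^bsub>B\<^esub> Q) = q ^ k * card I"
    "\<exists>m. card C = m * card (I <+>\<^bsub>B\<^esub> Q) \<and> \<not> q dvd m"
proof -
  let ?S = "I <+>\<^bsub>B\<^esub> Q"
  have Is: "subbrace I B" by (rule ideal_subgroups(1)[OF I])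
  show S: "subbrace ?S B" by (rule subbrace_set_add[OF fin I Q(1)])
  show IS: "I \<subseteq> ?S" and QS: "Q \<subseteq> ?S"
    using subset_set_add[OF subbrace_groups(1)[OF Is] subbrace_groups(1)[OF Q(1)]] by blast+
  show SC: "?S \<subseteq> C" by (rule set_add_mono[OF C(2) Q(2) C(1)])
  show "\<exists>k. card ?S = q ^ k * card I"
  proof -
    obtain t where t: "card Q = card (I \<inter> Q) * t"
      using subbrace_card_dvd[OF subbrace_Int[OF Is Q(1)] Q(1)] by (auto elim: dvdE)
    have pos: "0 < card (I \<inter> Q)" by (rule subbrace_card_pos[OF subbrace_Int[OF Is Q(1)]])
    have "t dvd q ^ j" using t Q(3) by simp
    then obtain k where "t = q ^ k" using divides_primepow_nat[OF q] by blast
    moreover have "card ?S * card (I \<inter> Q) = (t * card I) * card (I \<inter> Q)"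
      using card_set_add_Int[OF Is Q(1)] t by (simp add: mult_ac)
    then have "card ?S = t * card I" using pos by simp
    ultimately show ?thesis by blast
  qed
  show "\<exists>m. card C = m * card ?S \<and> \<not> q dvd m"
  proof -
    obtain u where u: "card C = card ?S * u" using subbrace_card_dvd[OF S C(1) SC] by (rule dvdE)
    obtain y where y: "card ?S = card Q * y" using subbrace_card_dvd[OF Q(1) S QS] by (rule dvdE)
    have "card Q * w = card Q * (y * u)" using u y Q(4) by (simp add: mult_ac)
    then have "w = y * u" using subbrace_card_pos[OF Q(1)] by simp
    then have "\<not> q dvd u" using Q(5) by auto
    then show ?thesis using u by (auto simp: mult.commute)
  qed
qed

text \<open>
  For a Sylow \<open>q\<close>-subbrace \<open>Q\<close> of \<open>R\<close> the subbrace \<open>I + Q\<close> is all of \<open>R\<close>, by orders, and both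
  summands are left ideals of \<open>B\<close>. So \<open>R\<close> is invariant under \<open>\<lambda>\<^sub>b\<close> even for \<open>b\<close> outside \<open>C\<close>; this is
  what makes the next lemma work.
\<close>
lemma sylow_ideal_over_left_ideal:
  fixes q :: nat
  assumes q: "Factorial_Ring.prime q" and I: "brace_ideal I B" and R: "sylow_ideal_over B q I R C"
  shows "left_ideal R B"
proof -
  have R': "subbrace R B" "I \<subseteq> R" using R by (simp_all add: sylow_ideal_over_def ideal_in_def)
  obtain k where k: "card R = q ^ k * card I" using R by (auto simp: sylow_ideal_over_def)
  obtain Q j w where Q: "subbrace Q B" "Q \<subseteq> R" "card Q = q ^ j" "card R = w * card Q" "\<not> q dvd w"
    by (rule exists_sylow_subbrace_in[OF fin q R'(1)])
  note S = sylow_image[OF q I R' Q]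
  have "I <+>\<^bsub>B\<^esub> Q = R"
    by (rule A.eq_of_coprime_indices[OF fin q ideal_subgroups(2)[OF I] subbrace_groups(1)[OF Q(1)]
          subbrace_groups(1)[OF S(1)] subbrace_groups(1)[OF R'(1)] S(2-4) k Q(4,5)])
  moreover have "left_ideal (I <+>\<^bsub>B\<^esub> Q) B"
    by (rule left_ideal_set_add[OF I prime_power_left_ideal[OF Q(1) q Q(3)]])
  ultimately show ?thesis by simp
qed

lemma ideal_conj_image:
  assumes I: "brace_ideal I B" and d: "d \<in> carrier B" and i: "i \<in> I"
  shows "i \<in> (\<lambda>x. d \<oplus> x \<oplus> \<ominus> d) ` I" "i \<in> (\<lambda>x. d \<otimes> x \<otimes> inv d) ` I"
proof -
  have ic: "i \<in> carrier B" using subbrace_mem[OF ideal_subgroups(1)[OF I] i] .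
  have *: "ideal_in B I (carrier B)" using I brace_ideal_iff by blast
  have "\<ominus> d \<in> carrier B" "inv d \<in> carrier B" using d by simp_all
  then have "\<ominus> d \<oplus> i \<oplus> \<ominus> (\<ominus> d) \<in> I" "inv d \<otimes> i \<otimes> inv (inv d) \<in> I"
    using * i unfolding ideal_in_def by blast+
  moreover have "i = d \<oplus> (\<ominus> d \<oplus> i \<oplus> \<ominus> (\<ominus> d)) \<oplus> \<ominus> d" "i = d \<otimes> (inv d \<otimes> i \<otimes> inv (inv d)) \<otimes> inv d"
    using d ic by (simp_all add: A.group_normalise M.group_normalise)
  ultimately show "i \<in> (\<lambda>x. d \<oplus> x \<oplus> \<ominus> d) ` I" "i \<in> (\<lambda>x. d \<otimes> x \<otimes> inv d) ` I" by blast+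
qed

text \<open>
  The counterpart of "a normal Sylow subgroup is characteristic". A conjugate of \<open>R\<close> by \<open>d \<in> D\<close>
  lies in \<open>U\<close> and has the same order modulo \<open>I\<close>, so \<open>R\<close> contains it. Invariance under \<open>\<lambda>\<^sub>d\<close> does not
  follow from uniqueness; it comes from the hypothesis on subbraces of prime-power order.
\<close>
lemma sylow_ideal_over_characteristic:
  fixes q :: nat
  assumes q: "Factorial_Ring.prime q" and I: "brace_ideal I B" and D: "subbrace D B"
    and U: "ideal_in B U D" and R: "sylow_ideal_over B q I R U"
  shows "ideal_in B R D"
proof -
  have R': "subbrace R B" "I \<subseteq> R" "R \<subseteq> U" using R by (simp_all add: sylow_ideal_over_def ideal_in_def)
  have U': "subbrace U B" "U \<subseteq> D" using U by (simp_all add: ideal_in_def)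
  obtain k where k: "card R = q ^ k * card I" using R by (auto simp: sylow_ideal_over_def)
  obtain m where m: "card U = m * card R" "\<not> q dvd m" using R by (auto simp: sylow_ideal_over_def)
  have RU: "ideal_in B R U" using R by (simp add: sylow_ideal_over_def)
  have "lambda_map B d r \<in> R \<and> d \<oplus> r \<oplus> \<ominus> d \<in> R \<and> d \<otimes> r \<otimes> inv d \<in> R" if d: "d \<in> D" and r: "r \<in> R" for d r
  proof (intro conjI)
    have dc: "d \<in> carrier B" by (rule subbrace_mem[OF D d])
    show "lambda_map B d r \<in> R"
      using sylow_ideal_over_left_ideal[OF q I R] dc r by (simp add: left_ideal_iff)
    let ?T = "(\<lambda>x. d \<oplus> x \<oplus> \<ominus> d) ` R"
    have T: "subgroup ?T (add_monoid B)" "card ?T = q ^ k * card I"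
      using A.subgroup_conjugate[OF fin subbrace_groups(1)[OF R'(1)] dc] k by simp_all
    have TU: "?T \<subseteq> U" using U d R'(3) unfolding ideal_in_def by blast
    have IT: "I \<subseteq> ?T" using ideal_conj_image(1)[OF I dc] R'(2) by blast
    have "?T \<subseteq> R"
    proof (rule A.q_subgroup_le_normal_sylow[OF fin q ideal_subgroups(2)[OF I] subbrace_groups(1)[OF R'(1)] T(1)
          subbrace_groups(1)[OF U'(1)] R'(2) IT R'(3) TU _ T(2) m])
      fix s t assume "s \<in> R" "t \<in> ?T"
      then have "s \<in> R" "t \<in> U" using TU by blast+
      then show "t \<oplus> s \<oplus> \<ominus> t \<in> R" using RU by (simp add: ideal_in_def)
    qed
    then show "d \<oplus> r \<oplus> \<ominus> d \<in> R" using r by blast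
    let ?T = "(\<lambda>x. d \<otimes> x \<otimes> inv d) ` R"
    have T: "subgroup ?T B" "card ?T = q ^ k * card I"
      using M.subgroup_conjugate[OF fin subbrace_groups(2)[OF R'(1)] dc] k by simp_all
    have TU: "?T \<subseteq> U" using U d R'(3) unfolding ideal_in_def by blast
    have IT: "I \<subseteq> ?T" using ideal_conj_image(2)[OF I dc] R'(2) by blast
    have "?T \<subseteq> R"
    proof (rule M.q_subgroup_le_normal_sylow[OF fin q ideal_subgroups(3)[OF I] subbrace_groups(2)[OF R'(1)] T(1)
          subbrace_groups(2)[OF U'(1)] R'(2) IT R'(3) TU _ T(2) m])
      fix s t assume "s \<in> R" "t \<in> ?T"
      then have "s \<in> R" "t \<in> U" using TU by blast+
      then show "t \<otimes> s \<otimes> inv t \<in> R" using RU by (simp add: ideal_in_def)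
    qed
    then show "d \<otimes> r \<otimes> inv d \<in> R" using r by blast
  qed
  then show ?thesis unfolding ideal_in_def using R' U' by blast
qed

text \<open>
  All subbraces between \<open>I\<close> and \<open>V\<close> are ideals of \<open>V\<close>, so the image of any Sylow subbrace of \<open>V\<close>
  will do.
\<close>
lemma abelian_nilpotent_over:
  assumes I: "brace_ideal I B" and V: "subbrace V B" "I \<subseteq> V"
    and comm: "\<And>a b. \<lbrakk>a \<in> V; b \<in> V\<rbrakk> \<Longrightarrow> I +> (a \<oplus> b) = I +> (b \<oplus> a)"
    and triv: "\<And>a b. \<lbrakk>a \<in> V; b \<in> V\<rbrakk> \<Longrightarrow> I +> (a \<otimes> b) = I +> (a \<oplus> b)"
  shows "nilpotent_over B I V"
  unfolding nilpotent_over_def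
proof (intro allI impI)
  fix q :: nat assume q: "Factorial_Ring.prime q"
  obtain Q j w where Q: "subbrace Q B" "Q \<subseteq> V" "card Q = q ^ j" "card V = w * card Q" "\<not> q dvd w"
    by (rule exists_sylow_subbrace_in[OF fin q V(1)])
  note S = sylow_image[OF q I V Q]
  let ?R = "I <+>\<^bsub>B\<^esub> Q"
  note mem = set_add_iff_coset[OF ideal_subgroups(2)[OF I] subbrace_subset[OF Q(1)]]
  have "lambda_map B d r \<in> ?R \<and> d \<oplus> r \<oplus> \<ominus> d \<in> ?R \<and> d \<otimes> r \<otimes> inv d \<in> ?R" if d: "d \<in> V" and r: "r \<in> ?R" for d r
  proof -
    have rV: "r \<in> V" using r S(4) by blast
    have c: "d \<in> carrier B" "r \<in> carrier B" using subbrace_mem[OF V(1)] d rV by blast+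
    obtain x where x: "x \<in> Q" "I +> r = I +> x" using r unfolding mem by blast
    have 1: "I +> (d \<oplus> r \<oplus> \<ominus> d) = I +> r"
    proof -
      have "I +> (d \<oplus> r \<oplus> \<ominus> d) = I +> (r \<oplus> d \<oplus> \<ominus> d)"
        using ideal_cong(1)[OF I _ _ _ _ comm[OF d rV] refl, of "\<ominus> d"] c by simp
      then show ?thesis using c by (simp add: A.m_assoc)
    qed
    have 2: "I +> (d \<otimes> r \<otimes> inv d) = I +> r"
    proof -
      have "I +> (d \<otimes> r) = I +> (r \<otimes> d)" using triv comm d rV by simp
      then have "I +> (d \<otimes> r \<otimes> inv d) = I +> (r \<otimes> d \<otimes> inv d)"
        using ideal_cong(2)[OF I _ _ _ _ _ refl, of "d \<otimes> r" "r \<otimes> d" "inv d"] c by simp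
      then show ?thesis using c by (simp add: M.m_assoc)
    qed
    have 3: "I +> lambda_map B d r = I +> r"
    proof -
      have "I +> lambda_map B d r = I +> (\<ominus> d \<oplus> (d \<oplus> r))"
        unfolding lambda_map_def using ideal_cong(1)[OF I _ _ _ _ refl triv[OF d rV], of "\<ominus> d"] c by simp
      then show ?thesis using c by (simp add: A.group_normalise)
    qed
    have "lambda_map B d r \<in> carrier B" "d \<oplus> r \<oplus> \<ominus> d \<in> carrier B" "d \<otimes> r \<otimes> inv d \<in> carrier B"
      using c lambda_closed by simp_all
    then show ?thesis unfolding mem 1 2 3 using x by blast
  qed
  then have "ideal_in B ?R V" using S(1,4) by (simp add: ideal_in_def)
  then show "\<exists>R. sylow_ideal_over B q I R V" using S(2,5,6) unfolding sylow_ideal_over_def by blast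
qed

section \<open>Supplements of an ideal\<close>

text \<open>
  For \<open>a \<in> C\<close> the map \<open>\<lambda>\<^sub>a\<close> is an automorphism of \<open>(B,+)\<close> that preserves \<open>S\<close> and \<open>C\<close>, so it preserves
  the additive normaliser of \<open>S\<close> in \<open>C\<close>. Closure under products follows because
  \<open>c d = c + \<lambda>\<^sub>c(d)\<close>.
\<close>
lemma additive_normaliser_subbrace:
  assumes S: "left_ideal S B" and C: "subbrace C B" "S \<subseteq> C"
  shows "subbrace {c \<in> C. \<forall>s\<in>S. c \<oplus> s \<oplus> \<ominus> c \<in> S} B"
proof -
  let ?E = "{c \<in> C. \<forall>s\<in>S. c \<oplus> s \<oplus> \<ominus> c \<in> S}"
  have Ss: "subbrace S B" using S by (simp add: left_ideal_def)
  have Cc: "c \<in> carrier B" if "c \<in> C" for c by (rule subbrace_mem[OF C(1) that])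
  have lam: "lambda_map B a s \<in> S" if "a \<in> carrier B" "s \<in> S" for a s
    using S that by (simp add: left_ideal_iff)
  have lamE: "lambda_map B a c \<in> ?E" if a: "a \<in> C" and c: "c \<in> ?E" for a c
  proof -
    have cC: "c \<in> C" "lambda_map B a c \<in> C" using c a subbrace_closed(7)[OF C(1)] by simp_all
    have "lambda_map B a c \<oplus> s \<oplus> \<ominus> (lambda_map B a c) \<in> S" if s: "s \<in> S" for s
    proof -
      have ac: "a \<in> carrier B" by (rule Cc[OF a])
      have cc: "c \<in> carrier B" by (rule Cc[OF cC(1)])
      have sc: "s \<in> carrier B" by (rule subbrace_mem[OF Ss s])
      let ?s = "lambda_map B (inv a) s"
      have s': "?s \<in> S" using lam s ac by simp
      have s'c: "?s \<in> carrier B" by (rule subbrace_mem[OF Ss s'])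
      let ?l = "lambda_map B a"
      have "?l (\<ominus> c) \<oplus> ?l c = \<zero>" using lambda_add[OF ac, of "\<ominus> c" c] cc lambda_zero[OF ac] by simp
      then have neg: "?l (\<ominus> c) = \<ominus> (?l c)" using A.inv_equality[of "?l (\<ominus> c)" "?l c"] cc ac lambda_closed by simp
      have "?l (c \<oplus> ?s \<oplus> \<ominus> c) = ?l c \<oplus> ?l ?s \<oplus> ?l (\<ominus> c)"
        using lambda_add[OF ac] cc s'c by simp
      also have "\<dots> = ?l c \<oplus> s \<oplus> \<ominus> (?l c)" using neg lambda_inverse(2)[OF ac sc] by simp
      finally show ?thesis using lam[OF ac, of "c \<oplus> ?s \<oplus> \<ominus> c"] c s' by simp
    qed
    then show ?thesis using cC(2) by simp
  qed
  have addE: "c \<oplus> d \<in> ?E" if "c \<in> ?E" "d \<in> ?E" for c d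
  proof -
    have cd: "c \<in> C" "d \<in> C" using that by simp_all
    have "c \<oplus> d \<oplus> s \<oplus> \<ominus> (c \<oplus> d) \<in> S" if s: "s \<in> S" for s
    proof -
      have "c \<oplus> d \<oplus> s \<oplus> \<ominus> (c \<oplus> d) = c \<oplus> (d \<oplus> s \<oplus> \<ominus> d) \<oplus> \<ominus> c"
        using Cc[OF cd(1)] Cc[OF cd(2)] subbrace_mem[OF Ss s] by (simp add: A.group_normalise)
      then show ?thesis using \<open>c \<in> ?E\<close> \<open>d \<in> ?E\<close> s by simp
    qed
    then show ?thesis using subbrace_closed(1)[OF C(1) cd] by simp
  qed
  show ?thesis
  proof (rule subbrace_finiteI[OF fin])
    show "?E \<subseteq> carrier B" using Cc by blast
    have "\<zero> \<in> C" using subgroup.one_closed[OF subbrace_groups(1)[OF C(1)]] by simp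
    then show "\<zero> \<in> ?E" using subbrace_mem[OF Ss] by simp
    show "c \<oplus> d \<in> ?E" if "c \<in> ?E" "d \<in> ?E" for c d by (rule addE[OF that])
    show "c \<otimes> d \<in> ?E" if cd: "c \<in> ?E" "d \<in> ?E" for c d
    proof -
      have "c \<in> C" "d \<in> C" using cd by simp_all
      then have "c \<otimes> d = c \<oplus> lambda_map B c d" using mult_eq_add_lambda Cc by simp
      then show ?thesis using addE[OF cd(1) lamE[OF \<open>c \<in> C\<close> cd(2)]] by simp
    qed
  qed
qed

text \<open>
  The point is closure under addition. For \<open>s \<in> S\<close> the condition reads \<open>s c \<in> c S\<close>. Here
  \<open>c S = c + S\<close>, because \<open>S\<close> is a left ideal, and \<open>c + S = S + c\<close> by additive normality. As
  \<open>s c = s + \<lambda>\<^sub>s(c)\<close>, the condition becomes \<open>\<lambda>\<^sub>s(c) \<in> S + c\<close>: the class of \<open>c\<close> modulo \<open>S\<close> is fixed by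
  \<open>\<lambda>\<^sub>s\<close>, which is additive in \<open>c\<close>.
\<close>
lemma multiplicative_normaliser_subbrace:
  assumes S: "left_ideal S B" and C: "subbrace C B" "S \<subseteq> C"
    and nrm: "\<And>c s. \<lbrakk>c \<in> C; s \<in> S\<rbrakk> \<Longrightarrow> c \<oplus> s \<oplus> \<ominus> c \<in> S"
  shows "subbrace {c \<in> C. \<forall>s\<in>S. inv c \<otimes> s \<otimes> c \<in> S} B"
proof -
  let ?F = "{c \<in> C. \<forall>s\<in>S. inv c \<otimes> s \<otimes> c \<in> S}"
  have Ss: "subbrace S B" using S by (simp add: left_ideal_def)
  have Cc: "c \<in> carrier B" if "c \<in> C" for c by (rule subbrace_mem[OF C(1) that])
  have Sc: "s \<in> carrier B" if "s \<in> S" for s by (rule subbrace_mem[OF Ss that])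
  have lam: "lambda_map B a s \<in> S" if "a \<in> carrier B" "s \<in> S" for a s
    using S that by (simp add: left_ideal_iff)
  have nrm': "\<ominus> c \<oplus> s \<oplus> c \<in> S" if "c \<in> C" "s \<in> S" for c s
    using nrm[OF subbrace_closed(3)[OF C(1) that(1) that(1)] that(2)] Cc[OF that(1)] by simp
  have F_iff: "inv c \<otimes> s \<otimes> c \<in> S \<longleftrightarrow> (\<exists>u\<in>S. lambda_map B s c = u \<oplus> c)" if c: "c \<in> C" and s: "s \<in> S" for c s
  proof -
    note cc = Cc[OF c] and sc = Sc[OF s]
    have lc: "lambda_map B s c \<in> carrier B" using lambda_closed cc sc by simp
    show ?thesis
    proof
      assume z: "inv c \<otimes> s \<otimes> c \<in> S"
      define v where "v = lambda_map B c (inv c \<otimes> s \<otimes> c)"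
      have v: "v \<in> S" unfolding v_def by (rule lam[OF cc z])
      have "s \<otimes> c = c \<otimes> (inv c \<otimes> s \<otimes> c)" using cc sc by (simp add: M.group_normalise)
      also have "\<dots> = c \<oplus> v" unfolding v_def by (rule mult_eq_add_lambda[OF cc Sc[OF z]])
      finally have "s \<oplus> lambda_map B s c = c \<oplus> v" using mult_eq_add_lambda[OF sc cc] by simp
      then have "lambda_map B s c = \<ominus> s \<oplus> (c \<oplus> v)" using sc lc A.inv_mult_cancel(1)[OF sc lc] by simp
      also have "\<dots> = (\<ominus> s \<oplus> (c \<oplus> v \<oplus> \<ominus> c)) \<oplus> c" using sc cc Sc[OF v] by (simp add: A.group_normalise)
      finally show "\<exists>u\<in>S. lambda_map B s c = u \<oplus> c"
        using subbrace_closed(1)[OF Ss subbrace_closed(3)[OF Ss s s] nrm[OF c v]] by blast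
    next
      assume "\<exists>u\<in>S. lambda_map B s c = u \<oplus> c"
      then obtain u where u: "u \<in> S" "lambda_map B s c = u \<oplus> c" by blast
      have w: "s \<oplus> u \<in> S" by (rule subbrace_closed(1)[OF Ss s u(1)])
      define v where "v = \<ominus> c \<oplus> (s \<oplus> u) \<oplus> c"
      have v: "v \<in> S" unfolding v_def by (rule nrm'[OF c w])
      have "s \<otimes> c = s \<oplus> (u \<oplus> c)" using mult_eq_add_lambda[OF sc cc] u(2) by simp
      also have "\<dots> = c \<oplus> v" unfolding v_def using sc cc Sc[OF u(1)] by (simp add: A.group_normalise)
      finally have sv: "s \<otimes> c = c \<oplus> v" .
      define z where "z = lambda_map B (inv c) v"
      have z: "z \<in> S" unfolding z_def using lam cc v by simp
      have "c \<otimes> z = c \<oplus> v" using mult_eq_add_lambda[OF cc Sc[OF z]] lambda_inverse(2)[OF cc Sc[OF v]] unfolding z_def by simp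
      then have "c \<otimes> z = s \<otimes> c" using sv by simp
      then have "inv c \<otimes> s \<otimes> c = z" using cc sc Sc[OF z] M.inv_mult_cancel(1)[OF cc Sc[OF z]] by (simp add: M.m_assoc)
      then show "inv c \<otimes> s \<otimes> c \<in> S" using z by simp
    qed
  qed
  show ?thesis
  proof (rule subbrace_finiteI[OF fin])
    show "?F \<subseteq> carrier B" using Cc by blast
    have "\<zero> \<in> C" using subgroup.one_closed[OF subbrace_groups(1)[OF C(1)]] by simp
    then show "\<zero> \<in> ?F" using Sc by (simp add: zero_eq_one)
    fix c d assume cd: "c \<in> ?F" "d \<in> ?F"
    then have cC: "c \<in> C" "d \<in> C" by simp_all
    note cc = Cc[OF cC(1)] Cc[OF cC(2)]
    show "c \<oplus> d \<in> ?F"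
    proof -
      have cdC: "c \<oplus> d \<in> C" by (rule subbrace_closed(1)[OF C(1) cC])
      have "inv (c \<oplus> d) \<otimes> s \<otimes> (c \<oplus> d) \<in> S" if s: "s \<in> S" for s
      proof -
        obtain u where u: "u \<in> S" "lambda_map B s c = u \<oplus> c" using cd(1) F_iff[OF cC(1) s] s by blast
        obtain v where v: "v \<in> S" "lambda_map B s d = v \<oplus> d" using cd(2) F_iff[OF cC(2) s] s by blast
        have "lambda_map B s (c \<oplus> d) = (u \<oplus> (c \<oplus> v \<oplus> \<ominus> c)) \<oplus> (c \<oplus> d)"
          using lambda_add[OF Sc[OF s] cc] u v cc Sc[OF u(1)] Sc[OF v(1)] by (simp add: A.group_normalise)
        moreover have "u \<oplus> (c \<oplus> v \<oplus> \<ominus> c) \<in> S" by (rule subbrace_closed(1)[OF Ss u(1) nrm[OF cC(1) v(1)]])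
        ultimately show ?thesis unfolding F_iff[OF cdC s] by blast
      qed
      then show ?thesis using cdC by simp
    qed
    show "c \<otimes> d \<in> ?F"
    proof -
      have "inv (c \<otimes> d) \<otimes> s \<otimes> (c \<otimes> d) \<in> S" if s: "s \<in> S" for s
      proof -
        have "inv (c \<otimes> d) \<otimes> s \<otimes> (c \<otimes> d) = inv d \<otimes> (inv c \<otimes> s \<otimes> c) \<otimes> d"
          using cc Sc[OF s] by (simp add: M.group_normalise)
        then show ?thesis using cd s by simp
      qed
      then show ?thesis using subbrace_closed(2)[OF C(1) cC] by simp
    qed
  qed
qed

lemma set_add_dedekind:
  assumes N: "subbrace N B" and C: "C \<subseteq> carrier B" and D: "subbrace D B" "N \<subseteq> D" "D \<subseteq> N <+>\<^bsub>B\<^esub> C"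
  shows "N <+>\<^bsub>B\<^esub> (D \<inter> C) = D"
proof
  show "N <+>\<^bsub>B\<^esub> (D \<inter> C) \<subseteq> D" by (rule set_add_mono[OF D(2) _ D(1)]) simp
  show "D \<subseteq> N <+>\<^bsub>B\<^esub> (D \<inter> C)"
  proof
    fix x assume x: "x \<in> D"
    then have "x \<in> N <+>\<^bsub>B\<^esub> C" using D(3) by blast
    then obtain n c where nc: "n \<in> N" "c \<in> C" "x = n \<oplus> c" unfolding set_add_def' by blast
    have "n \<in> carrier B" "c \<in> carrier B" using nc subbrace_mem[OF N] C by blast+
    then have "c = \<ominus> n \<oplus> x" using nc(3) by (simp add: A.group_normalise)
    then have "c \<in> D" using subbrace_closed(1)[OF D(1) subbrace_closed(3)[OF D(1)] x, of n] D(2) nc(1) by blast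
    then show "x \<in> N <+>\<^bsub>B\<^esub> (D \<inter> C)" unfolding set_add_def' using nc by blast
  qed
qed

text \<open>
  This is the isomorphism between \<open>C/(N \<inter> C)\<close> and \<open>K/N\<close>, on the level of orders.
\<close>
lemma sylow_ideal_over_Int:
  assumes N: "brace_ideal N B" and K: "subbrace K B" and C: "subbrace C B" "N <+>\<^bsub>B\<^esub> C = K"
    and R: "sylow_ideal_over B q N R K"
  shows "sylow_ideal_over B q (N \<inter> C) (R \<inter> C) C"
proof -
  have Ns: "subbrace N B" by (rule ideal_subgroups(1)[OF N])
  have R': "ideal_in B R K" "subbrace R B" "R \<subseteq> K" "N \<subseteq> R" using R by (simp_all add: sylow_ideal_over_def ideal_in_def)
  obtain k where k: "card R = q ^ k * card N" using R by (auto simp: sylow_ideal_over_def)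
  obtain m where m: "card K = m * card R" "\<not> q dvd m" using R by (auto simp: sylow_ideal_over_def)
  have CK: "C \<subseteq> K" using subset_set_add(2)[OF subbrace_groups(1)[OF Ns] subbrace_groups(1)[OF C(1)]] C(2) by simp
  have RC: "subbrace (R \<inter> C) B" by (rule subbrace_Int[OF R'(2) C(1)])
  have "N <+>\<^bsub>B\<^esub> (R \<inter> C) = R"
    by (rule set_add_dedekind[OF Ns subbrace_subset[OF C(1)] R'(2,4)]) (simp add: C(2) R'(3))
  moreover have "N \<inter> (R \<inter> C) = N \<inter> C" using R'(4) by blast
  ultimately have 1: "card R * card (N \<inter> C) = card N * card (R \<inter> C)"
    using card_set_add_Int[OF Ns RC] by simp
  have 2: "card K * card (N \<inter> C) = card N * card C" using card_set_add_Int[OF Ns C(1)] C(2) by simp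
  have pos: "card N > 0" by (rule subbrace_card_pos[OF Ns])
  have "card N * (q ^ k * card (N \<inter> C)) = card R * card (N \<inter> C)" unfolding k by (simp add: mult_ac)
  also note 1
  finally have 3: "card (R \<inter> C) = q ^ k * card (N \<inter> C)" using pos by simp
  have "card N * card C = m * (card R * card (N \<inter> C))" using 2 m(1) by (simp add: mult_ac)
  also have "\<dots> = card N * (m * card (R \<inter> C))" unfolding 1 by (simp add: mult_ac)
  finally have 4: "card C = m * card (R \<inter> C)" using pos by simp
  have "ideal_in B (R \<inter> C) C" by (rule ideal_in_Int[OF R'(1) C(1) CK])
  moreover have "N \<inter> C \<subseteq> R \<inter> C" using R'(4) by blast
  ultimately show ?thesis unfolding sylow_ideal_over_def using 3 4 m(2) by blast
qed

text \<open>
  Let \<open>M = N \<inter> C\<close> and let \<open>R/M\<close> be the Sylow \<open>q\<close>-subgroup of \<open>C/M\<close>, which is an ideal because \<open>C/M\<close>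
  is isomorphic to \<open>(N + C)/N\<close>. For a Sylow \<open>q\<close>-subbrace \<open>Q\<close> of \<open>R\<close> the Frattini argument writes
  each \<open>c \<in> C\<close> as an element of \<open>R = M + Q\<close> plus an element of the additive normaliser \<open>E\<close> of
  \<open>S = I + Q\<close>. As \<open>Q \<subseteq> E\<close>, this gives \<open>N + E = N + C\<close>, and minimality gives \<open>E = C\<close>. Now the
  multiplicative normaliser of \<open>S\<close> is a subbrace too, and the same argument in the
  multiplicative group shows that it equals \<open>C\<close>. So \<open>S\<close> is the required ideal of \<open>C\<close>.
\<close>
lemma minimal_supplement_nilpotent_over:
  assumes N: "brace_ideal N B" and I: "brace_ideal I B" and IN: "I \<subseteq> N"
    and C: "subbrace C B" "I \<subseteq> C"
    and nilK: "nilpotent_over B N (N <+>\<^bsub>B\<^esub> C)"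
    and minimal: "\<And>E. \<lbrakk>subbrace E B; I \<subseteq> E; E \<subseteq> C; N <+>\<^bsub>B\<^esub> E = N <+>\<^bsub>B\<^esub> C\<rbrakk> \<Longrightarrow> E = C"
  shows "nilpotent_over B I C"
  unfolding nilpotent_over_def
proof (intro allI impI)
  fix q :: nat assume q: "Factorial_Ring.prime q"
  let ?K = "N <+>\<^bsub>B\<^esub> C"
  have Ns: "subbrace N B" and Is: "subbrace I B" by (rule ideal_subgroups(1)[OF N] ideal_subgroups(1)[OF I])+
  have K: "subbrace ?K B" by (rule subbrace_set_add[OF fin N C(1)])
  have CK: "C \<subseteq> ?K" by (rule subset_set_add(2)[OF subbrace_groups(1)[OF Ns] subbrace_groups(1)[OF C(1)]])
  obtain R0 where R0: "sylow_ideal_over B q N R0 ?K" using nilK q unfolding nilpotent_over_def by blast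
  define M where "M = N \<inter> C"
  define R where "R = R0 \<inter> C"
  have R: "sylow_ideal_over B q M R C" unfolding M_def R_def by (rule sylow_ideal_over_Int[OF N K C(1) refl R0])
  have Ms: "subbrace M B" unfolding M_def by (rule subbrace_Int[OF Ns C(1)])
  have M: "M \<subseteq> N" "M \<subseteq> C" unfolding M_def by blast+
  have MI: "ideal_in B M C"
    unfolding M_def by (rule ideal_in_Int[OF iffD1[OF brace_ideal_iff N] C(1) subbrace_subset[OF C(1)]])
  have R': "ideal_in B R C" "subbrace R B" "R \<subseteq> C" "M \<subseteq> R" using R by (simp_all add: sylow_ideal_over_def ideal_in_def)
  obtain k where k: "card R = q ^ k * card M" using R by (auto simp: sylow_ideal_over_def)
  obtain m where m: "card C = m * card R" "\<not> q dvd m" using R by (auto simp: sylow_ideal_over_def)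
  obtain Q j w where Q: "subbrace Q B" "Q \<subseteq> R" "card Q = q ^ j" "card R = w * card Q" "\<not> q dvd w"
    by (rule exists_sylow_subbrace_in[OF fin q R'(2)])
  have QC: "Q \<subseteq> C" using Q(2) R'(3) by blast
  have Ql: "left_ideal Q B" by (rule prime_power_left_ideal[OF Q(1) q Q(3)])
  have cardC: "card C = (m * w) * card Q" "\<not> q dvd m * w" using m Q(4,5) prime_dvd_mult_iff[OF q, of m w] by (simp_all add: mult.assoc)
  let ?S = "I <+>\<^bsub>B\<^esub> Q"
  note S = sylow_image[OF q I C Q(1) QC Q(3) cardC]
  have Sl: "left_ideal ?S B" by (rule left_ideal_set_add[OF I Ql])
  have Cc: "c \<in> carrier B" if "c \<in> C" for c by (rule subbrace_mem[OF C(1) that])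
  have II: "ideal_in B I (carrier B)" by (rule iffD1[OF brace_ideal_iff I])
  have MQ: "M <+>\<^bsub>B\<^esub> Q = R"
  proof (rule A.eq_of_coprime_indices[OF fin q subbrace_groups(1)[OF Ms] subbrace_groups(1)[OF Q(1)] _
        subbrace_groups(1)[OF R'(2)] _ _ set_add_mono[OF R'(4) Q(2) R'(2)] k Q(4,5)])
    show "subgroup (M <+>\<^bsub>B\<^esub> Q) (add_monoid B)"
      by (rule A.set_mult_subgroupI[OF fin subbrace_groups(1)[OF Ms] subbrace_groups(1)[OF Q(1)]])
        (use MI QC in \<open>auto simp: ideal_in_def\<close>)
    show "M \<subseteq> M <+>\<^bsub>B\<^esub> Q" "Q \<subseteq> M <+>\<^bsub>B\<^esub> Q"
      using subset_set_add[OF subbrace_groups(1)[OF Ms] subbrace_groups(1)[OF Q(1)]] by blast+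
  qed
  have Nsum: "n \<oplus> c \<in> N <+>\<^bsub>B\<^esub> D" if "n \<in> N" "c \<in> D" for n c D unfolding set_add_def' using that by blast

  define E where "E = {c \<in> C. \<forall>s\<in>?S. c \<oplus> s \<oplus> \<ominus> c \<in> ?S}"
  have Es: "subbrace E B" unfolding E_def by (rule additive_normaliser_subbrace[OF Sl C(1) S(4)])
  have EC: "E \<subseteq> C" unfolding E_def by blast
  have SE: "?S \<subseteq> E"
    unfolding E_def using S(4) subbrace_closed(1)[OF S(1) subbrace_closed(1)[OF S(1)] subbrace_closed(3)[OF S(1)]] by auto
  have "?K \<subseteq> N <+>\<^bsub>B\<^esub> E"
  proof
    fix x assume "x \<in> ?K"
    then obtain n c where nc: "n \<in> N" "c \<in> C" "x = n \<oplus> c" unfolding set_add_def' by blast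
    have cc: "c \<in> carrier B" by (rule Cc[OF nc(2)])
    have "c \<oplus> y \<oplus> \<ominus> c \<in> R" if "y \<in> Q" for y using R'(1) nc(2) Q(2) that unfolding ideal_in_def by blast
    from A.frattini_argument[OF fin q subbrace_groups(1)[OF Q(1)] subbrace_groups(1)[OF R'(2)] Q(2-5) cc this]
    obtain r where r: "r \<in> R" "\<And>y. y \<in> Q \<Longrightarrow> (\<ominus> r \<oplus> c) \<oplus> y \<oplus> \<ominus> (\<ominus> r \<oplus> c) \<in> Q" by blast
    define f where "f = \<ominus> r \<oplus> c"
    have rC: "r \<in> C" using r(1) R'(3) by blast
    have rc: "r \<in> carrier B" by (rule Cc[OF rC])
    have fC: "f \<in> C" unfolding f_def by (rule subbrace_closed(1)[OF C(1) subbrace_closed(3)[OF C(1) rC rC] nc(2)])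
    have fc: "f \<in> carrier B" by (rule Cc[OF fC])
    have "f \<oplus> s \<oplus> \<ominus> f \<in> ?S" if "s \<in> ?S" for s
    proof -
      obtain i y where iy: "i \<in> I" "y \<in> Q" "s = i \<oplus> y" using \<open>s \<in> ?S\<close> unfolding set_add_def' by blast
      have "f \<oplus> s \<oplus> \<ominus> f = (f \<oplus> i \<oplus> \<ominus> f) \<oplus> (f \<oplus> y \<oplus> \<ominus> f)"
        using fc subbrace_mem[OF Is iy(1)] subbrace_mem[OF Q(1) iy(2)] iy(3) by (simp add: A.group_normalise)
      moreover have "f \<oplus> i \<oplus> \<ominus> f \<in> I" using II fc iy(1) by (simp add: ideal_in_def)
      moreover have "f \<oplus> y \<oplus> \<ominus> f \<in> Q" unfolding f_def by (rule r(2)[OF iy(2)])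
      ultimately show ?thesis unfolding set_add_def' by blast
    qed
    then have fE: "f \<in> E" unfolding E_def using fC by blast
    obtain u y where uy: "u \<in> M" "y \<in> Q" "r = u \<oplus> y" using r(1) unfolding MQ[symmetric] set_add_def' by blast
    have cs: "n \<in> carrier B" "u \<in> carrier B" "y \<in> carrier B"
      using subbrace_mem[OF Ns nc(1)] subbrace_mem[OF Ms uy(1)] subbrace_mem[OF Q(1) uy(2)] by simp_all
    have "c = r \<oplus> f" unfolding f_def using rc cc by (simp add: A.group_normalise)
    then have "x = (n \<oplus> u) \<oplus> (y \<oplus> f)" using nc(3) uy(3) cs fc by (simp add: A.m_assoc)
    moreover have "n \<oplus> u \<in> N" using subbrace_closed(1)[OF Ns nc(1)] uy(1) M(1) by blast
    moreover have "y \<oplus> f \<in> E" using subbrace_closed(1)[OF Es _ fE] uy(2) SE S(3) by blast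
    ultimately show "x \<in> N <+>\<^bsub>B\<^esub> E" using Nsum by simp
  qed
  moreover have "N <+>\<^bsub>B\<^esub> E \<subseteq> ?K" unfolding set_add_def' using EC by blast
  ultimately have "N <+>\<^bsub>B\<^esub> E = ?K" by blast
  from minimal[OF Es subset_trans[OF S(2) SE] EC this] have EC': "E = C" .
  have addn: "c \<oplus> s \<oplus> \<ominus> c \<in> ?S" if "c \<in> C" "s \<in> ?S" for c s
    using that EC' unfolding E_def by blast

  define F where "F = {c \<in> C. \<forall>s\<in>?S. inv c \<otimes> s \<otimes> c \<in> ?S}"
  have Fs: "subbrace F B" unfolding F_def by (rule multiplicative_normaliser_subbrace[OF Sl C(1) S(4) addn])
  have FC: "F \<subseteq> C" unfolding F_def by blast
  have SF: "?S \<subseteq> F"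
    unfolding F_def using S(4) subbrace_closed(2)[OF S(1) subbrace_closed(2)[OF S(1) subbrace_closed(4)[OF S(1)]]] by auto
  have "?K \<subseteq> N <+>\<^bsub>B\<^esub> F"
  proof
    fix x assume "x \<in> ?K"
    then have "x \<in> N <#> C" using set_add_eq_set_mult[OF N subbrace_subset[OF C(1)]] by simp
    then obtain n c where nc: "n \<in> N" "c \<in> C" "x = n \<otimes> c" by (rule set_multE)
    have cc: "c \<in> carrier B" by (rule Cc[OF nc(2)])
    have "c \<otimes> y \<otimes> inv c \<in> R" if "y \<in> Q" for y using R'(1) nc(2) Q(2) that unfolding ideal_in_def by blast
    from M.frattini_argument[OF fin q subbrace_groups(2)[OF Q(1)] subbrace_groups(2)[OF R'(2)] Q(2-5) cc this]
    obtain r where r: "r \<in> R" "\<And>y. y \<in> Q \<Longrightarrow> (inv r \<otimes> c) \<otimes> y \<otimes> inv (inv r \<otimes> c) \<in> Q" by blast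
    define f where "f = inv r \<otimes> c"
    have rC: "r \<in> C" using r(1) R'(3) by blast
    have rc: "r \<in> carrier B" by (rule Cc[OF rC])
    have fC: "f \<in> C" unfolding f_def by (rule subbrace_closed(2)[OF C(1) subbrace_closed(4)[OF C(1) rC rC] nc(2)])
    have fc: "f \<in> carrier B" by (rule Cc[OF fC])
    have Smult: "?S = I <#> Q" by (rule set_add_eq_set_mult[OF I subbrace_subset[OF Q(1)]])
    have "f \<otimes> s \<otimes> inv f \<in> ?S" if "s \<in> ?S" for s
    proof -
      have "s \<in> I <#> Q" using that Smult by simp
      then obtain i y where iy: "i \<in> I" "y \<in> Q" "s = i \<otimes> y" by (rule set_multE)
      have "f \<otimes> s \<otimes> inv f = (f \<otimes> i \<otimes> inv f) \<otimes> (f \<otimes> y \<otimes> inv f)"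
        using fc subbrace_mem[OF Is iy(1)] subbrace_mem[OF Q(1) iy(2)] iy(3) by (simp add: M.group_normalise)
      moreover have "f \<otimes> i \<otimes> inv f \<in> I" using II fc iy(1) by (simp add: ideal_in_def)
      moreover have "f \<otimes> y \<otimes> inv f \<in> Q" unfolding f_def by (rule r(2)[OF iy(2)])
      ultimately show ?thesis unfolding Smult using set_multI[of _ I _ Q B] by simp
    qed
    \<comment> \<open>The condition that defines \<open>F\<close> conjugates by the inverse.\<close>
    then have "inv f \<in> F" unfolding F_def using subbrace_closed(4)[OF C(1) fC fC] fc by simp
    then have fF: "f \<in> F" using subbrace_closed(4)[OF Fs, of "inv f" "inv f"] fc by simp
    obtain u' y where uy': "u' \<in> M" "y \<in> Q" "r = u' \<oplus> y" using r(1) unfolding MQ[symmetric] set_add_def' by blast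
    have yc: "y \<in> carrier B" by (rule subbrace_mem[OF Q(1) uy'(2)])
    \<comment> \<open>The additive and multiplicative cosets of \<open>N\<close> agree, so \<open>r\<close> can be written as a product too.\<close>
    have "r \<in> N +> y" using uy' M(1) unfolding a_r_coset_def' by blast
    then have "r \<in> N #> y" using coset_eq[OF N yc] by simp
    then obtain u where u: "u \<in> N" "r = u \<otimes> y" unfolding r_coset_def by blast
    have cs: "n \<in> carrier B" "u \<in> carrier B"
      using subbrace_mem[OF Ns nc(1)] subbrace_mem[OF Ns u(1)] by simp_all
    have "c = r \<otimes> f" unfolding f_def using rc cc by (simp add: M.group_normalise)
    then have "x = (n \<otimes> u) \<otimes> (y \<otimes> f)" using nc(3) u(2) cs fc yc by (simp add: M.m_assoc)
    moreover have "n \<otimes> u \<in> N" by (rule subbrace_closed(2)[OF Ns nc(1) u(1)])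
    moreover have "y \<otimes> f \<in> F" using subbrace_closed(2)[OF Fs _ fF] uy'(2) SF S(3) by blast
    ultimately have "x \<in> N <#> F" using set_multI[of "n \<otimes> u" N "y \<otimes> f" F B] by simp
    then show "x \<in> N <+>\<^bsub>B\<^esub> F" using set_add_eq_set_mult[OF N subbrace_subset[OF Fs]] by simp
  qed
  moreover have "N <+>\<^bsub>B\<^esub> F \<subseteq> ?K" unfolding set_add_def' using FC by blast
  ultimately have "N <+>\<^bsub>B\<^esub> F = ?K" by blast
  from minimal[OF Fs subset_trans[OF S(2) SF] FC this] have FC': "F = C" .
  have multn: "c \<otimes> s \<otimes> inv c \<in> ?S" if "c \<in> C" "s \<in> ?S" for c s
  proof -
    have "inv c \<in> F" using subbrace_closed(4)[OF C(1) that(1) that(1)] FC' by simp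
    then have "inv (inv c) \<otimes> s \<otimes> inv c \<in> ?S" using that(2) unfolding F_def by blast
    then show ?thesis using Cc[OF that(1)] by simp
  qed
  have "ideal_in B ?S C"
    unfolding ideal_in_def using S(1,4) addn multn Sl Cc by (simp add: left_ideal_iff)
  then show "\<exists>R. sylow_ideal_over B q I R C" using S(2,5,6) unfolding sylow_ideal_over_def by blast
qed

section \<open>Self-idealising subbraces along a soluble series\<close>

text \<open>
  The analogue of Fitting's theorem: the sum of the Sylow ideals of \<open>U\<close> and \<open>V\<close> modulo \<open>I\<close> is one
  of \<open>U + V\<close>. They are ideals of \<open>D\<close> by \<open>sylow_ideal_over_characteristic\<close>.
\<close>
lemma nilpotent_over_sum:
  assumes I: "brace_ideal I B" and D: "subbrace D B"
    and U: "ideal_in B U D" "nilpotent_over B I U" and V: "ideal_in B V D" "nilpotent_over B I V"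
    and UV: "U <+>\<^bsub>B\<^esub> V = D"
  shows "nilpotent_over B I D"
  unfolding nilpotent_over_def
proof (intro allI impI)
  fix q :: nat assume q: "Factorial_Ring.prime q"
  obtain R1 where R1: "sylow_ideal_over B q I R1 U" using U(2) q unfolding nilpotent_over_def by blast
  obtain R2 where R2: "sylow_ideal_over B q I R2 V" using V(2) q unfolding nilpotent_over_def by blast
  have Is: "subbrace I B" by (rule ideal_subgroups(1)[OF I])
  have Us: "subbrace U B" and Vs: "subbrace V B" using U(1) V(1) by (simp_all add: ideal_in_def)
  have R1': "subbrace R1 B" "R1 \<subseteq> U" "I \<subseteq> R1" using R1 by (simp_all add: sylow_ideal_over_def ideal_in_def)
  have R2': "subbrace R2 B" "R2 \<subseteq> V" "I \<subseteq> R2" using R2 by (simp_all add: sylow_ideal_over_def ideal_in_def)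
  obtain k1 where k1: "card R1 = q ^ k1 * card I" using R1 by (auto simp: sylow_ideal_over_def)
  obtain k2 where k2: "card R2 = q ^ k2 * card I" using R2 by (auto simp: sylow_ideal_over_def)
  obtain m1 where m1: "card U = m1 * card R1" "\<not> q dvd m1" using R1 by (auto simp: sylow_ideal_over_def)
  obtain m2 where m2: "card V = m2 * card R2" "\<not> q dvd m2" using R2 by (auto simp: sylow_ideal_over_def)
  have R1D: "ideal_in B R1 D" by (rule sylow_ideal_over_characteristic[OF q I D U(1) R1])
  have R2D: "ideal_in B R2 D" by (rule sylow_ideal_over_characteristic[OF q I D V(1) R2])
  let ?T = "R1 <+>\<^bsub>B\<^esub> R2" and ?L = "R1 <+>\<^bsub>B\<^esub> V"
  have T: "ideal_in B ?T D" by (rule ideal_in_sum[OF fin D R1D R2D])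
  have L: "ideal_in B ?L D" by (rule ideal_in_sum[OF fin D R1D V(1)])
  have Ts: "subbrace ?T B" "?T \<subseteq> D" using T by (simp_all add: ideal_in_def)
  have Ls: "subbrace ?L B" "?L \<subseteq> D" using L by (simp_all add: ideal_in_def)
  have TL: "?T \<subseteq> ?L" unfolding set_add_def' using R2'(2) by blast
  have IT: "I \<subseteq> ?T" using subset_set_add(1)[OF subbrace_groups(1)[OF R1'(1)] subbrace_groups(1)[OF R2'(1)]] R1'(3) by blast
  have "\<exists>k. card ?T = q ^ k * card I"
  proof -
    have "I \<subseteq> R1 \<inter> R2" using R1'(3) R2'(3) by blast
    from subbrace_card_dvd[OF Is subbrace_Int[OF R1'(1) R2'(1)] this]
    obtain y where y: "card (R1 \<inter> R2) = card I * y" by (rule dvdE)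
    obtain z where z: "card ?T = card I * z" using subbrace_card_dvd[OF Is Ts(1) IT] by (rule dvdE)
    have "z * y * (card I * card I) = q ^ (k1 + k2) * (card I * card I)"
      using card_set_add_Int[OF R1'(1) R2'(1)] k1 k2 y z by (simp add: power_add mult_ac)
    then have "z * y = q ^ (k1 + k2)" using subbrace_card_pos[OF Is] by simp
    then have "z dvd q ^ (k1 + k2)" by (rule dvdI[OF sym])
    then obtain k where "z = q ^ k" using divides_primepow_nat[OF q] by blast
    then show ?thesis using z by (auto simp: mult.commute)
  qed
  moreover have "\<exists>m. card D = m * card ?T \<and> \<not> q dvd m"
  proof -
    obtain u1 where u1': "card D = card ?L * u1" using subbrace_card_dvd[OF Ls(1) D Ls(2)] by (rule dvdE)
    obtain u2 where u2': "card ?L = card ?T * u2" using subbrace_card_dvd[OF Ts(1) Ls(1) TL] by (rule dvdE)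
    have u1: "card D = u1 * card ?L" and u2: "card ?L = u2 * card ?T" using u1' u2' by (simp_all only: mult.commute)
    \<comment> \<open>Replace the summands one at a time, from \<open>U + V\<close> over \<open>R1 + V\<close> to \<open>R1 + R2\<close>.\<close>
    have "u1 dvd m1"
      by (rule A.index_set_mult_dvd[OF fin subbrace_groups(1)[OF R1'(1)] subbrace_groups(1)[OF Us]
            subbrace_groups(1)[OF Vs] R1'(2) m1(1)]) (simp add: UV u1)
    moreover have "u2 dvd m2"
    proof (rule A.index_set_mult_dvd[OF fin subbrace_groups(1)[OF R2'(1)] subbrace_groups(1)[OF Vs]
            subbrace_groups(1)[OF R1'(1)] R2'(2) m2(1)])
      show "card (V <+>\<^bsub>B\<^esub> R1) = u2 * card (R2 <+>\<^bsub>B\<^esub> R1)"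
        using u2 A.card_set_mult_commute[OF fin subbrace_groups(1)[OF Vs] subbrace_groups(1)[OF R1'(1)]]
          A.card_set_mult_commute[OF fin subbrace_groups(1)[OF R2'(1)] subbrace_groups(1)[OF R1'(1)]] by simp
    qed
    ultimately have "\<not> q dvd u1 * u2"
      using m1(2) m2(2) prime_dvd_mult_iff[OF q, of u1 u2] dvd_trans[of q u1 m1] dvd_trans[of q u2 m2] by blast
    moreover have "card D = (u1 * u2) * card ?T" using u1 u2 by (simp add: mult_ac)
    ultimately show ?thesis by blast
  qed
  ultimately show "\<exists>R. sylow_ideal_over B q I R D" unfolding sylow_ideal_over_def using T IT by blast
qed

text \<open>
  The largest subbrace \<open>C\<close> that is nilpotent modulo \<open>I\<close> and supplements \<open>N\<close> in \<open>K\<close> does it; a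
  minimal supplement shows that there is one. The case that \<open>C\<close> is an ideal of a larger \<open>D\<close> is
  excluded because \<open>D\<close> would be a larger subbrace of the same kind.
\<close>
lemma self_idealising_nilpotent_over_step:
  assumes N: "brace_ideal N B" and I: "brace_ideal I B" and IN: "I \<subseteq> N"
    and comm: "\<And>a b. \<lbrakk>a \<in> N; b \<in> N\<rbrakk> \<Longrightarrow> I +> (a \<oplus> b) = I +> (b \<oplus> a)"
    and triv: "\<And>a b. \<lbrakk>a \<in> N; b \<in> N\<rbrakk> \<Longrightarrow> I +> (a \<otimes> b) = I +> (a \<oplus> b)"
    and K: "subbrace K B" "N \<subseteq> K" "nilpotent_over B N K"
    and Kself: "\<And>D. \<lbrakk>subbrace D B; K \<subset> D\<rbrakk> \<Longrightarrow> \<not> ideal_in B K D"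
  shows "\<exists>C. subbrace C B \<and> I \<subseteq> C \<and> nilpotent_over B I C \<and>
    (\<forall>D. subbrace D B \<longrightarrow> C \<subset> D \<longrightarrow> \<not> ideal_in B C D)"
proof -
  have Ns: "subbrace N B" by (rule ideal_subgroups(1)[OF N])
  have NI: "ideal_in B N (carrier B)" by (rule iffD1[OF brace_ideal_iff N])
  have card_le: "card C \<le> card (carrier B)" if "subbrace C B" for C
    using card_mono[OF fin subbrace_subset[OF that]] .
  have card_less: "card C < card D" if "subbrace D B" "C \<subset> D" for C D
    using psubset_card_mono[OF finite_subset[OF subbrace_subset[OF that(1)] fin] that(2)] .
  define P where "P C \<longleftrightarrow> subbrace C B \<and> I \<subseteq> C \<and> N <+>\<^bsub>B\<^esub> C = K" for C
  have "N <+>\<^bsub>B\<^esub> K = K"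
    using set_add_mono[OF K(2) order_refl K(1)] subset_set_add(2)[OF subbrace_groups(1)[OF Ns] subbrace_groups(1)[OF K(1)]] by blast
  then have PK: "P K" unfolding P_def using K(1,2) IN by blast
  obtain C0 where C0: "P C0" "\<And>E. P E \<Longrightarrow> card C0 \<le> card E"
    using ex_has_least_nat[of P K card] PK by blast
  have "nilpotent_over B I C0"
  proof (rule minimal_supplement_nilpotent_over[OF N I IN])
    show "subbrace C0 B" "I \<subseteq> C0" "nilpotent_over B N (N <+>\<^bsub>B\<^esub> C0)"
      using C0(1) K(3) unfolding P_def by simp_all
    fix E assume E: "subbrace E B" "I \<subseteq> E" "E \<subseteq> C0" "N <+>\<^bsub>B\<^esub> E = N <+>\<^bsub>B\<^esub> C0"
    then have "P E" using C0(1) unfolding P_def by simp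
    then have "card C0 \<le> card E" by (rule C0(2))
    then show "E = C0" using card_less[of C0 E] E(3) C0(1) unfolding P_def by force
  qed
  then have "P C0 \<and> nilpotent_over B I C0" using C0(1) by simp
  moreover have "\<forall>E. P E \<and> nilpotent_over B I E \<longrightarrow> card E < Suc (card (carrier B))"
    unfolding P_def using card_le le_imp_less_Suc by blast
  ultimately have "\<exists>C. (P C \<and> nilpotent_over B I C) \<and> (\<forall>E. P E \<and> nilpotent_over B I E \<longrightarrow> card E \<le> card C)"
    by (rule ex_has_greatest_nat)
  then obtain C where C: "P C" "nilpotent_over B I C"
    and Cmax: "\<And>E. P E \<and> nilpotent_over B I E \<Longrightarrow> card E \<le> card C" by blast
  have C': "subbrace C B" "I \<subseteq> C" "N <+>\<^bsub>B\<^esub> C = K" using C(1) by (simp_all add: P_def)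
  have "\<not> ideal_in B C D" if D: "subbrace D B" "C \<subset> D" for D
  proof
    assume CD: "ideal_in B C D"
    have ND: "subbrace (N <+>\<^bsub>B\<^esub> D) B" by (rule subbrace_set_add[OF fin N D(1)])
    have "ideal_in B K (N <+>\<^bsub>B\<^esub> D)" using ideal_in_set_add[OF fin N D(1) CD] C'(3) by simp
    moreover have "K \<subseteq> N <+>\<^bsub>B\<^esub> D" unfolding C'(3)[symmetric] set_add_def' using D(2) by blast
    ultimately have KND: "N <+>\<^bsub>B\<^esub> D = K" using Kself[OF ND] by blast
    have DK: "D \<subseteq> K" using subset_set_add(2)[OF subbrace_groups(1)[OF Ns] subbrace_groups(1)[OF D(1)]] KND by simp
    let ?V = "N \<inter> D"
    have V: "ideal_in B ?V D" by (rule ideal_in_Int[OF NI D(1) subbrace_subset[OF D(1)]])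
    have Vs: "subbrace ?V B" by (rule subbrace_Int[OF Ns D(1)])
    have ID: "I \<subseteq> ?V" using IN C'(2) D(2) by blast
    have Vn: "nilpotent_over B I ?V"
      by (rule abelian_nilpotent_over[OF I Vs ID]) (simp_all add: comm triv)
    have "?V <+>\<^bsub>B\<^esub> C = D"
    proof
      show "?V <+>\<^bsub>B\<^esub> C \<subseteq> D" using D(2) by (intro set_add_mono[OF _ _ D(1)]) blast+
      show "D \<subseteq> ?V <+>\<^bsub>B\<^esub> C"
      proof
        fix x assume x: "x \<in> D"
        then have "x \<in> N <+>\<^bsub>B\<^esub> C" using DK C'(3) by blast
        then obtain n c where nc: "n \<in> N" "c \<in> C" "x = n \<oplus> c" unfolding set_add_def' by blast
        have "n \<in> carrier B" "c \<in> carrier B" using subbrace_mem[OF Ns nc(1)] subbrace_mem[OF C'(1) nc(2)] .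
        then have "n = x \<oplus> \<ominus> c" using nc(3) by (simp add: A.group_normalise)
        moreover have cD: "c \<in> D" using nc(2) D(2) by blast
        ultimately have "n \<in> D" using subbrace_closed(1)[OF D(1) x subbrace_closed(3)[OF D(1) cD cD]] by simp
        then show "x \<in> ?V <+>\<^bsub>B\<^esub> C" unfolding set_add_def' using nc by blast
      qed
    qed
    from nilpotent_over_sum[OF I D(1) V Vn CD C(2) this] have "nilpotent_over B I D" .
    moreover have "P D" unfolding P_def using D C'(2) KND by blast
    ultimately have "card D \<le> card C" using Cmax by blast
    then show False using card_less[OF D] by simp
  qed
  then show ?thesis using C' C(2) by blast
qed

end

section \<open>Existence of Carter subbraces\<close>

theorem theorem1:
  fixes B :: "('a, 'm) ring_scheme"
  assumes "skew_brace B"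
    and "finite (carrier B)"
    and "soluble_brace B"
    and "\<And>A p k. \<lbrakk>subbrace A B; Factorial_Ring.prime (p::nat); card A = p ^ k\<rbrakk>
      \<Longrightarrow> centrally_nilpotent (B\<lparr>carrier := A\<rparr>) \<and> left_ideal A B"
  shows "\<exists>C. carter_subbrace C B"
proof -
  interpret skew_brace B by (rule assms(1))
  interpret finite_brace_prime_power_left_ideals B
    using assms(2,4) by unfold_locales blast+
  obtain n :: nat and I where series: "I 0 = {\<zero>\<^bsub>B\<^esub>} \<and> I n = carrier B \<and> (\<forall>j\<le>n. brace_ideal (I j) B) \<and>
      (\<forall>j<n. I j \<subseteq> I (Suc j) \<and> abelian_brace (quotient_brace (B\<lparr>carrier := I (Suc j)\<rparr>) (I j)))"
    using assms(3) unfolding soluble_brace_def by (elim exE)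
  have I0: "I 0 = {\<zero>\<^bsub>B\<^esub>}" and In: "I n = carrier B" using series by simp_all
  have ideal: "brace_ideal (I j) B" if "j \<le> n" for j using series that by simp
  have incl: "I j \<subseteq> I (Suc j)"
    and abelian: "abelian_brace (quotient_brace (B\<lparr>carrier := I (Suc j)\<rparr>) (I j))" if "j < n" for j
    using series that by simp_all
  have "\<exists>C. subbrace C B \<and> I 0 \<subseteq> C \<and> nilpotent_over B (I 0) C \<and>
      (\<forall>D. subbrace D B \<longrightarrow> C \<subset> D \<longrightarrow> \<not> ideal_in B C D)"
  proof (rule inc_induct[of 0 n])
    have "ideal_in B (carrier B) (carrier B)"
      using ideal[of n] unfolding In brace_ideal_iff by simp
    \<comment> \<open>Modulo \<open>B\<close> everything is trivial, with \<open>q\<^sup>0\<close> as the Sylow order.\<close>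
    then have "sylow_ideal_over B q (carrier B) (carrier B) (carrier B)" if "Factorial_Ring.prime q" for q
      unfolding sylow_ideal_over_def using not_prime_unit that
      by (intro conjI exI[of _ "0::nat"] exI[of _ "1::nat"]) auto
    then have "nilpotent_over B (carrier B) (carrier B)" unfolding nilpotent_over_def by blast
    then show "\<exists>C. subbrace C B \<and> I n \<subseteq> C \<and> nilpotent_over B (I n) C \<and>
        (\<forall>D. subbrace D B \<longrightarrow> C \<subset> D \<longrightarrow> \<not> ideal_in B C D)"
      unfolding In using subbrace_carrier subbrace_subset by (intro exI[of _ "carrier B"]) auto
  next
    fix j assume j: "0 \<le> j" "j < n"
    let ?N = "I (Suc j)" and ?J = "I j"
    assume "\<exists>C. subbrace C B \<and> ?N \<subseteq> C \<and> nilpotent_over B ?N C \<and>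
        (\<forall>D. subbrace D B \<longrightarrow> C \<subset> D \<longrightarrow> \<not> ideal_in B C D)"
    then obtain K where K: "subbrace K B" "?N \<subseteq> K" "nilpotent_over B ?N K"
      and Kself: "\<And>D. \<lbrakk>subbrace D B; K \<subset> D\<rbrakk> \<Longrightarrow> \<not> ideal_in B K D" by blast
    have N: "brace_ideal ?N B" and J: "brace_ideal ?J B" using ideal j(2) by simp_all
    have Ns: "subbrace ?N B" by (rule ideal_subgroups(1)[OF N])
    interpret N: skew_brace "B\<lparr>carrier := ?N\<rparr>" by (rule subbrace_is_skew_brace[OF Ns])
    have JN: "brace_ideal ?J (B\<lparr>carrier := ?N\<rparr>)"
      unfolding brace_ideal_restrict[OF Ns]
      by (rule ideal_in_mono[OF iffD1[OF brace_ideal_iff J] subbrace_subset[OF Ns] incl[OF j(2)]])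
    note ab = N.abelian_quotientD[OF JN abelian[OF j(2)]]
    show "\<exists>C. subbrace C B \<and> ?J \<subseteq> C \<and> nilpotent_over B ?J C \<and>
        (\<forall>D. subbrace D B \<longrightarrow> C \<subset> D \<longrightarrow> \<not> ideal_in B C D)"
    proof (rule self_idealising_nilpotent_over_step[OF N J incl[OF j(2)] _ _ K Kself])
      fix a b assume "a \<in> ?N" "b \<in> ?N"
      then show "?J +>\<^bsub>B\<^esub> (a \<oplus>\<^bsub>B\<^esub> b) = ?J +>\<^bsub>B\<^esub> (b \<oplus>\<^bsub>B\<^esub> a)" "?J +>\<^bsub>B\<^esub> (a \<otimes>\<^bsub>B\<^esub> b) = ?J +>\<^bsub>B\<^esub> (a \<oplus>\<^bsub>B\<^esub> b)"
        using ab[of a b] by (simp_all add: a_r_coset_def')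
    qed
  qed simp
  then obtain C where C: "subbrace C B" "nilpotent_over B {\<zero>\<^bsub>B\<^esub>} C"
    and Cself: "\<And>D. \<lbrakk>subbrace D B; C \<subset> D\<rbrakk> \<Longrightarrow> \<not> ideal_in B C D"
    unfolding I0 by blast
  interpret C: skew_brace "B\<lparr>carrier := C\<rparr>" by (rule subbrace_is_skew_brace[OF C(1)])
  have "centrally_nilpotent (B\<lparr>carrier := C\<rparr>)"
  proof (rule C.centrally_nilpotent_if_sylow_ideals)
    show "finite (carrier (B\<lparr>carrier := C\<rparr>))" using finite_subset[OF subbrace_subset[OF C(1)] assms(2)] by simp
    fix q :: nat assume q: "Factorial_Ring.prime q"
    then obtain R where R: "sylow_ideal_over B q {\<zero>\<^bsub>B\<^esub>} R C" using C(2) unfolding nilpotent_over_def by blast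
    obtain k where "card R = q ^ k * card {\<zero>\<^bsub>B\<^esub>}" using R unfolding sylow_ideal_over_def by blast
    then have k: "card R = q ^ k" by simp
    obtain m where m: "card C = m * card R" "\<not> q dvd m" using R unfolding sylow_ideal_over_def by blast
    have "ideal_in B R C" using R unfolding sylow_ideal_over_def by blast
    then have "brace_ideal R (B\<lparr>carrier := C\<rparr>)" "subbrace R B"
      unfolding brace_ideal_restrict[OF C(1)] by (simp_all add: ideal_in_def)
    then show "\<exists>R k m. brace_ideal R (B\<lparr>carrier := C\<rparr>) \<and> card R = q ^ k \<and>
        card (carrier (B\<lparr>carrier := C\<rparr>)) = m * card R \<and> \<not> q dvd m \<and>
        centrally_nilpotent (B\<lparr>carrier := C, carrier := R\<rparr>)"
      using k m assms(4)[OF _ q k] by (intro exI[of _ R] exI[of _ k] exI[of _ m]) simp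
  qed
  moreover have "self_idealising C B"
    unfolding self_idealising_def using Cself brace_ideal_restrict by blast
  ultimately show ?thesis unfolding carter_subbrace_def using C(1) by blast
qed

end
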